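(* Let $\mathcal U_1=\{f\in \mathrm{End}^1_\mu(\mathbb T^2): C_\chi(f)>-\tfrac12 C_{\det}(f)\}$. The maps $$\mathcal U_1\ni f\mapsto \int_{\mathbb T^2}\chi^-(f)\,d\mu,\qquad \mathcal U_1\ni f\mapsto \int_{\mathbb T^2}\chi^+(f)\,d\mu$$ are continuous in the $\mathcal C^1$ topology.
   Context: $\mathbb T^2=\mathbb R^2/\mathbb Z^2$ and $\mu$ is the Lebesgue (Haar) probability measure. $\mathrm{End}^1_\mu(\mathbb T^2)$ is the set of $\mathcal C^1$ local diffeomorphisms of $\mathbb T^2$ that preserve $\mu$ and are not invertible. $T^1\mathbb T^2$ is the unit tangent bundle. For $f\in \mathrm{End}^1_\mu(\mathbb T^2)$, $n\ge1$ and $(x,v)\in T^1\mathbb T^2$ put $$I(x,v;f^n)=\sum_{y\in f^{-n}(x)}\frac{\log\|(D_yf^n)^{-1}v\|}{|\det(D_yf^n)|},\qquad C_\chi(f)=\sup_{n\in\mathbb N}\frac1n\inf_{(x,v)\in T^1\mathbb T^2}I(x,v;f^n),$$ $$C_{\det}(f)=\sup_{n\in\mathbb N}\frac1n\inf_{x\in\mathbb T^2}\log|\det(D_xf^n)|,$$ and one has $C_{\det}(f)>0$. The Lyapunov exponents $\chi^+(f)(x)=\lim_{n\to\infty}\frac1n\log\|D_xf^n\|$ and $\chi^-(f)(x)=\lim_{n\to\infty}\frac1n\log \mathrm m(D_xf^n)$ exist for $\mu$-a.e. $x$, where $\mathrm m(A)=\inf\{\|Av\|:\|v\|=1\}$.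 *)

theory Defs
  imports "HOL-Analysis.Analysis"
begin

quotient_type torus2 = "real^2" / "\<lambda>p q :: real^2. \<forall>i. p $ i - q $ i \<in> \<int>"
proof (rule equivpI)
  show "reflp (\<lambda>p q :: real^2. \<forall>i. p $ i - q $ i \<in> \<int>)"
    by (simp add: reflp_def)
  show "symp (\<lambda>p q :: real^2. \<forall>i. p $ i - q $ i \<in> \<int>)"
    by (auto simp: symp_def) (metis Ints_minus minus_diff_eq)
  show "transp (\<lambda>p q :: real^2. \<forall>i. p $ i - q $ i \<in> \<int>)"
  proof (rule transpI, rule allI)
    fix p q r :: "real^2" and i
    assume "\<forall>i. p $ i - q $ i \<in> \<int>" "\<forall>i. q $ i - r $ i \<in> \<int>"
    then have "(p $ i - q $ i) + (q $ i - r $ i) \<in> \<int>" by (intro Ints_add) auto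
    then show "p $ i - r $ i \<in> \<int>" by simp
  qed
qed

definition tproj :: "real^2 \<Rightarrow> torus2" where
  "tproj p = abs_torus2 p"

lemma tproj_eq_iff: "tproj p = tproj q \<longleftrightarrow> (\<forall>i. p $ i - q $ i \<in> \<int>)"
  unfolding tproj_def using torus2.abs_eq_iff by simp

lemma tproj_surj: "\<exists>p. tproj p = x"
  unfolding tproj_def by (induction x rule: torus2.abs_induct) blast

lemma tproj_translate:
  assumes "tproj p = tproj q"
  shows "tproj (r + (p - q)) = tproj r" "tproj (r - (p - q)) = tproj r"
proof -
  have pq: "p $ i - q $ i \<in> \<int>" for i
    using assms[unfolded tproj_eq_iff] by (rule spec)
  have qp: "q $ i - p $ i \<in> \<int>" for i
    using assms[symmetric, unfolded tproj_eq_iff] by (rule spec)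
  have "(r + (p - q)) $ i - r $ i = p $ i - q $ i" "(r - (p - q)) $ i - r $ i = q $ i - p $ i" for i
    by simp_all
  then show "tproj (r + (p - q)) = tproj r" "tproj (r - (p - q)) = tproj r"
    unfolding tproj_eq_iff by (simp_all only: pq qp simp_thms)
qed

subsection \<open>The flat metric on the torus\<close>

instantiation torus2 :: metric_space
begin

definition dist_torus2 :: "torus2 \<Rightarrow> torus2 \<Rightarrow> real" where
  "dist_torus2 x y = Inf {norm (p - q) | p q. tproj p = x \<and> tproj q = y}"

definition uniformity_torus2 :: "(torus2 \<times> torus2) filter" where
  "uniformity_torus2 = (INF e\<in>{0 <..}. principal {(x, y). dist x y < e})"

definition open_torus2 :: "torus2 set \<Rightarrow> bool" where
  "open_torus2 U \<longleftrightarrow> (\<forall>x\<in>U. eventually (\<lambda>(x', y). x' = x \<longrightarrow> y \<in> U) uniformity)"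

lemma dist_torus2_set:
  fixes x y :: torus2
  shows "{norm (p - q) | p q. tproj p = x \<and> tproj q = y} \<noteq> {}"
    and "bdd_below {norm (p - q) | p q. tproj p = x \<and> tproj q = y}"
  using tproj_surj[of x] tproj_surj[of y] by (auto intro!: bdd_belowI[of _ 0])

lemma dist_torus2_le: "dist (tproj p) (tproj q) \<le> norm (p - q)"
  unfolding dist_torus2_def by (rule cInf_lower) (auto intro: dist_torus2_set)

lemma dist_torus2_nonneg: "0 \<le> dist (x::torus2) y"
  unfolding dist_torus2_def by (rule cInf_greatest[OF dist_torus2_set(1)]) auto

lemma dist_torus2_lessE:
  fixes x y :: torus2
  assumes "dist x y < e"
  obtains p q where "tproj p = x" "tproj q = y" "norm (p - q) < e"
  using assms cInf_less_iff[OF dist_torus2_set, of x y e] unfolding dist_torus2_def by blast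

instance
proof
  fix x y z :: torus2
  show "dist x y = 0 \<longleftrightarrow> x = y"
  proof
    assume "x = y"
    obtain p where p: "tproj p = x" using tproj_surj[of x] by blast
    have "dist x y \<le> 0" using dist_torus2_le[of p p] p \<open>x = y\<close> by simp
    then show "dist x y = 0" using dist_torus2_nonneg[of x y] by (rule antisym)
  next
    assume d0: "dist x y = 0"
    obtain p0 q0 where pq0: "tproj p0 = x" "tproj q0 = y"
      using tproj_surj[of x] tproj_surj[of y] by blast
    have "p0 $ i - q0 $ i \<in> \<int>" for i
    proof (rule ccontr)
      define c where "c = p0 $ i - q0 $ i"
      assume "p0 $ i - q0 $ i \<notin> \<int>"
      then have c: "c \<notin> \<int>" by (simp add: c_def)
      define e where "e = min (frac c) (1 - frac c)"
      have "e > 0" using c by (auto simp: e_def frac_lt_1 frac_gt_0_iff)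
      then have "dist x y < e" using d0 by simp
      then obtain p q where pq: "tproj p = x" "tproj q = y" "norm (p - q) < e"
        by (rule dist_torus2_lessE)
      have "(p0 $ i - p $ i) - (q0 $ i - q $ i) \<in> \<int>"
        using pq pq0 tproj_eq_iff[of p0 p] tproj_eq_iff[of q0 q]
        by (intro Ints_diff[of "p0 $ i - p $ i"]) simp_all
      then obtain k where k: "c - (p - q) $ i = of_int k"
        unfolding c_def Ints_def by (auto simp: algebra_simps)
      have "\<bar>(p - q) $ i\<bar> < e" using component_le_norm_cart[of "p - q" i] pq(3) by linarith
      then have "\<bar>c - of_int k\<bar> < e" using k by auto
      then have "\<bar>frac c + of_int (\<lfloor>c\<rfloor> - k)\<bar> < e" by (simp add: frac_def)
      moreover have "of_int m \<ge> (0::real) \<or> of_int m \<le> (-1::real)" for m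
        using of_int_le_iff[of 0 m, where ?'a = real] of_int_le_iff[of m "-1", where ?'a = real]
        by (cases "0 \<le> m") simp_all
      then have "of_int (\<lfloor>c\<rfloor> - k) \<ge> (0::real) \<or> of_int (\<lfloor>c\<rfloor> - k) \<le> (-1::real)" .
      ultimately show False unfolding e_def by linarith
    qed
    then have "tproj p0 = tproj q0" unfolding tproj_eq_iff by blast
    then show "x = y" using pq0 by simp
  qed
  show "dist x y \<le> dist x z + dist y z"
  proof (rule field_le_epsilon)
    fix e :: real assume "e > 0"
    then have e: "dist x z < dist x z + e/2" "dist y z < dist y z + e/2" by simp_all
    obtain p r where 1: "tproj p = x" "tproj r = z" "norm (p - r) < dist x z + e/2"
      using e(1) by (rule dist_torus2_lessE)
    obtain q r' where 2: "tproj q = y" "tproj r' = z" "norm (q - r') < dist y z + e/2"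
      using e(2) by (rule dist_torus2_lessE)
    have "tproj (q + (r - r')) = y" using tproj_translate(1)[of r r' q] 1 2 by simp
    then have "dist x y \<le> norm (p - (q + (r - r')))"
      using dist_torus2_le[of p "q + (r - r')"] 1 by simp
    also have "\<dots> = norm ((p - r) - (q - r'))" by (simp add: algebra_simps)
    also have "\<dots> \<le> norm (p - r) + norm (q - r')" by (rule norm_triangle_ineq4)
    finally show "dist x y \<le> dist x z + dist y z + e" using 1 2 by linarith
  qed
qed (simp_all add: uniformity_torus2_def open_torus2_def)

end

lemma continuous_on_tproj: "continuous_on S tproj"
proof (rule continuous_onI)
  fix p :: "real^2" and e :: real assume "e > 0"
  moreover have "dist (tproj q) (tproj p) \<le> dist q p" for q
    unfolding dist_norm by (rule dist_torus2_le)
  ultimately show "\<exists>d>0. \<forall>q\<in>S. dist q p < d \<longrightarrow> dist (tproj q) (tproj p) \<le> e"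
    by (intro exI[of _ e]) (auto intro: order_trans less_imp_le)
qed

lemma tproj_image_unit_square: "tproj ` {p. \<forall>i. 0 \<le> p $ i \<and> p $ i < 1} = UNIV"
proof -
  have "x \<in> tproj ` {p. \<forall>i. 0 \<le> p $ i \<and> p $ i < 1}" for x
  proof -
    obtain p where p: "tproj p = x" using tproj_surj[of x] by blast
    have "tproj (\<chi> i. frac (p $ i)) = tproj p"
      unfolding tproj_eq_iff by (auto simp: frac_def)
    then have "x = tproj (\<chi> i. frac (p $ i))" using p by simp
    then show ?thesis by (rule image_eqI) (simp add: frac_lt_1)
  qed
  then show ?thesis by blast
qed

lemma compact_torus2: "compact (UNIV :: torus2 set)"
proof -
  have "compact (tproj ` cbox 0 1)"
    by (intro compact_continuous_image continuous_on_tproj compact_cbox)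
  moreover have "{p::real^2. \<forall>i. 0 \<le> p $ i \<and> p $ i < 1} \<subseteq> cbox 0 1"
    by (auto simp: mem_box_cart less_imp_le)
  then have "tproj ` cbox 0 1 = UNIV"
    using image_mono[of _ _ tproj] tproj_image_unit_square by fastforce
  ultimately show ?thesis by simp
qed

text \<open>The metric topology is the quotient topology.\<close>

lemma open_torus2_iff: "open U \<longleftrightarrow> open (tproj -` U)"
proof
  assume "open U"
  then show "open (tproj -` U)"
    using continuous_on_tproj[of UNIV] by (simp add: continuous_on_open_vimage)
next
  assume op: "open (tproj -` U)"
  show "open U"
    unfolding open_dist
  proof
    fix x assume "x \<in> U"
    obtain p where p: "tproj p = x" using tproj_surj[of x] by blast
    then have "p \<in> tproj -` U" using \<open>x \<in> U\<close> by simp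
    then obtain e where e: "e > 0" "ball p e \<subseteq> tproj -` U"
      using op openE by blast
    have "y \<in> U" if less: "dist y x < e" for y
    proof -
      obtain q p' where q: "tproj q = y" "tproj p' = x" "norm (q - p') < e"
        using dist_torus2_lessE[OF less] by blast
      have "q + (p - p') \<in> ball p e"
        using q by (simp add: dist_norm norm_minus_commute algebra_simps)
      then show ?thesis using e q p tproj_translate(1)[of p p' q] by auto
    qed
    then show "\<exists>e>0. \<forall>y. dist y x < e \<longrightarrow> y \<in> U" using e by blast
  qed
qed

subsection \<open>Haar probability measure\<close>

definition haar :: "torus2 measure" where
  "haar = distr (restrict_space lborel {p. \<forall>i. 0 \<le> p $ i \<and> p $ i < 1}) borel tproj"

lemma space_haar: "space haar = UNIV"
  and sets_haar: "sets haar = sets borel"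
  unfolding haar_def by simp_all

lemma emeasure_haar_UNIV: "emeasure haar UNIV = 1"
proof -
  let ?Q = "{p::real^2. \<forall>i. 0 \<le> p $ i \<and> p $ i < 1}"
  have Q: "?Q \<in> sets borel" by measurable
  have "tproj \<in> borel_measurable (restrict_space lborel ?Q)"
    using borel_measurable_continuous_onI[OF continuous_on_tproj]
    by (intro measurable_restrict_space1) simp
  then have "emeasure haar UNIV = emeasure (restrict_space lborel ?Q) ?Q"
    unfolding haar_def by (subst emeasure_distr) (simp_all add: space_restrict_space)
  also have "\<dots> = emeasure lborel ?Q"
    using Q by (subst emeasure_restrict_space) simp_all
  finally have eq: "emeasure haar UNIV = emeasure lborel ?Q" .
  have one: "(1::real^2) \<bullet> b = 1" "0 \<bullet> b \<le> 1 \<bullet> b" if "b \<in> Basis" for b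
    using that by (auto simp: Basis_vec_def inner_axis)
  have "emeasure lborel ?Q \<le> emeasure lborel (cbox (0::real^2) 1)"
    by (intro emeasure_mono) (auto simp: mem_box_cart less_imp_le)
  moreover have "emeasure lborel (box (0::real^2) 1) \<le> emeasure lborel ?Q"
    using Q by (intro emeasure_mono) (auto simp: mem_box_cart less_imp_le)
  moreover have "emeasure lborel (cbox (0::real^2) 1) = 1" "emeasure lborel (box (0::real^2) 1) = 1"
    using one by (simp_all add: emeasure_lborel_cbox_eq emeasure_lborel_box_eq)
  ultimately show ?thesis using eq by simp
qed

subsection \<open>Differentiability\<close>

text \<open>
  Tangent spaces are identified with \<open>\<real>\<^sup>2\<close> through \<^const>\<open>tproj\<close>, so a derivative is a
  matrix: that of a lift of the map near some point above \<open>x\<close>. It depends neither on this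
  point nor on the lift.
\<close>

definition has_tderiv :: "(torus2 \<Rightarrow> torus2) \<Rightarrow> real^2^2 \<Rightarrow> torus2 \<Rightarrow> bool" where
  "has_tderiv f A x \<longleftrightarrow> (\<exists>F p. tproj p = x \<and> (\<forall>\<^sub>F q in nhds p. tproj (F q) = f (tproj q)) \<and>
     (F has_derivative (\<lambda>v. A *v v)) (at p))"

definition tderiv :: "(torus2 \<Rightarrow> torus2) \<Rightarrow> torus2 \<Rightarrow> real^2^2" where
  "tderiv f x = (THE A. has_tderiv f A x)"

lemma has_tderiv_unique:
  assumes "has_tderiv f A x" "has_tderiv f B x"
  shows "A = B"
proof -
  obtain F p where F: "tproj p = x" "\<forall>\<^sub>F q in nhds p. tproj (F q) = f (tproj q)"
    "(F has_derivative (\<lambda>v. A *v v)) (at p)"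
    using assms(1) unfolding has_tderiv_def by blast
  obtain G r where G: "tproj r = x" "\<forall>\<^sub>F q in nhds r. tproj (G q) = f (tproj q)"
    "(G has_derivative (\<lambda>v. B *v v)) (at r)"
    using assms(2) unfolding has_tderiv_def by blast
  define H where "H q = G (q + (r - p))" for q
  have H': "(H has_derivative (\<lambda>v. B *v v)) (at p)"
  proof -
    have "((\<lambda>q. q + (r - p)) has_derivative (\<lambda>v. v)) (at p)"
      by (auto intro!: derivative_eq_intros)
    moreover have "(G has_derivative (\<lambda>v. B *v v)) (at (p + (r - p)))" using G(3) by simp
    ultimately show ?thesis unfolding H_def by (rule has_derivative_compose)
  qed
  have "filterlim (\<lambda>q. q + (r - p)) (nhds (p + (r - p))) (nhds p)"
    by (intro tendsto_add tendsto_const filterlim_ident)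
  then have "filterlim (\<lambda>q. q + (r - p)) (nhds r) (nhds p)" by simp
  then have "\<forall>\<^sub>F q in nhds p. tproj (G (q + (r - p))) = f (tproj (q + (r - p)))"
    using G(2) by (rule eventually_compose_filterlim[rotated])
  moreover have "tproj (q + (r - p)) = tproj q" for q
    using tproj_translate(1)[of r p q] F(1) G(1) by simp
  ultimately have Hl: "\<forall>\<^sub>F q in nhds p. tproj (H q) = f (tproj q)"
    by (simp add: H_def)
  define D where "D q = F q - H q" for q
  have DZ: "\<forall>\<^sub>F q in nhds p. \<forall>i. D q $ i \<in> \<int>"
    using F(2) Hl
  proof eventually_elim
    case (elim q)
    then have "tproj (F q) = tproj (H q)" by simp
    then show ?case by (simp add: D_def tproj_eq_iff)
  qed
  have D': "(D has_derivative (\<lambda>v. A *v v - B *v v)) (at p)"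
    unfolding D_def using F(3) H' by (rule has_derivative_diff)
  have DpZ: "\<forall>i. D p $ i \<in> \<int>" using DZ by (rule eventually_nhds_x_imp_x)
  have "(D \<longlongrightarrow> D p) (at p)"
    using has_derivative_continuous[OF D'] by (simp add: continuous_at)
  then have "\<forall>\<^sub>F q in at p. dist (D q) (D p) < 1" by (rule tendstoD) simp
  moreover have "\<forall>\<^sub>F q in at p. \<forall>i. D q $ i \<in> \<int>"
    using DZ unfolding eventually_at_filter by eventually_elim simp
  ultimately have "\<forall>\<^sub>F q in at p. D q = D p"
  proof eventually_elim
    case (elim q)
    have "D q $ i = D p $ i" for i
    proof -
      have "D q $ i - D p $ i \<in> \<int>" using elim(2) DpZ by (intro Ints_diff) blast+
      moreover have "\<bar>D q $ i - D p $ i\<bar> < 1"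
        using component_le_norm_cart[of "D q - D p" i] elim(1) by (simp add: dist_norm)
      ultimately have "D q $ i - D p $ i = 0" by (rule Ints_nonzero_abs_less1)
      then show ?thesis by simp
    qed
    then show ?case by (simp add: vec_eq_iff)
  qed
  then have "\<forall>\<^sub>F q in at p. D p = D q" by eventually_elim simp
  then have "(D has_derivative (\<lambda>v. 0)) (at p)"
    by (rule has_derivative_transform_eventually[OF has_derivative_const]) auto
  then have "(\<lambda>v. A *v v - B *v v) = (\<lambda>v. 0)"
    using D' has_derivative_unique by blast
  then have "A *v v = B *v v" for v by (simp add: fun_eq_iff)
  then show ?thesis by (simp add: matrix_eq)
qed

lemma tderiv_eq: "has_tderiv f A x \<Longrightarrow> tderiv f x = A"
  unfolding tderiv_def using has_tderiv_unique by blast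

definition C1_on :: "torus2 set \<Rightarrow> (torus2 \<Rightarrow> torus2) \<Rightarrow> bool" where
  "C1_on S f \<longleftrightarrow> (\<forall>x\<in>S. \<exists>A. has_tderiv f A x) \<and> continuous_on S (tderiv f)"

definition C1_local_diffeo :: "(torus2 \<Rightarrow> torus2) \<Rightarrow> bool" where
  "C1_local_diffeo f \<longleftrightarrow> (\<forall>x. \<exists>U g. x \<in> U \<and> open U \<and> open (f ` U) \<and>
     homeomorphism U (f ` U) f g \<and> C1_on U f \<and> C1_on (f ` U) g)"

subsection \<open>The \<open>C\<^sup>1\<close> topology\<close>

definition C1_maps :: "(torus2 \<Rightarrow> torus2) set" where
  "C1_maps = {f. C1_on UNIV f}"

text \<open>The guard outside \<^const>\<open>C1_maps\<close>, where the suprema may be unbounded, only serves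
  the form of the axioms of \<^locale>\<open>Metric_space\<close>.\<close>

definition C1_dist :: "(torus2 \<Rightarrow> torus2) \<Rightarrow> (torus2 \<Rightarrow> torus2) \<Rightarrow> real" where
  "C1_dist f g = (if f \<in> C1_maps \<and> g \<in> C1_maps then
     (SUP x. dist (f x) (g x)) + (SUP x. onorm (\<lambda>v. (tderiv f x - tderiv g x) *v v)) else 0)"

definition C1_topology :: "(torus2 \<Rightarrow> torus2) topology" where
  "C1_topology = Metric_space.mtopology C1_maps C1_dist"

lemma bdd_above_dist_torus2: "bdd_above (range (\<lambda>x::torus2. dist (f x :: torus2) (g x)))"
proof -
  obtain B where "\<And>x y :: torus2. dist x y \<le> B"
    using compact_imp_bounded[OF compact_torus2] unfolding bounded_two_points by auto
  then show ?thesis by (intro bdd_aboveI2)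
qed

lemma onorm_matrix_le_norm: "onorm (\<lambda>v. (A::real^2^2) *v v) \<le> norm A * 2"
proof (rule onorm_le)
  fix v :: "real^2"
  have "norm (A *v v) \<le> (\<Sum>i\<in>UNIV. \<bar>(A *v v) $ i\<bar>)" by (rule norm_le_l1_cart)
  also have "\<dots> \<le> (\<Sum>i\<in>(UNIV::2 set). norm A * norm v)"
  proof (rule sum_mono)
    fix i :: 2
    have "\<bar>(A *v v) $ i\<bar> = \<bar>A $ i \<bullet> v\<bar>" by (simp add: matrix_vector_mul_component)
    also have "\<dots> \<le> norm (A $ i) * norm v" by (rule Cauchy_Schwarz_ineq2)
    also have "\<dots> \<le> norm A * norm v"
      by (intro mult_right_mono norm_ge_zero) (rule Finite_Cartesian_Product.norm_nth_le)
    finally show "\<bar>(A *v v) $ i\<bar> \<le> norm A * norm v" .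
  qed
  also have "\<dots> = norm A * 2 * norm v" by simp
  finally show "norm (A *v v) \<le> norm A * 2 * norm v" .
qed

lemma bdd_above_onorm_tderiv:
  assumes "f \<in> C1_maps" "g \<in> C1_maps"
  shows "bdd_above (range (\<lambda>x. onorm (\<lambda>v. (tderiv f x - tderiv g x) *v v)))"
proof -
  have "continuous_on UNIV (\<lambda>x. norm (tderiv f x - tderiv g x))"
    using assms unfolding C1_maps_def C1_on_def by (auto intro!: continuous_intros)
  then have "compact (range (\<lambda>x. norm (tderiv f x - tderiv g x)))"
    using compact_continuous_image compact_torus2 by blast
  then have "bdd_above (range (\<lambda>x. norm (tderiv f x - tderiv g x)))"
    by (intro bounded_imp_bdd_above compact_imp_bounded)
  then obtain B where B: "norm (tderiv f x - tderiv g x) \<le> B" for x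
    unfolding bdd_above_def by blast
  show ?thesis
  proof (rule bdd_aboveI2)
    fix x
    show "onorm (\<lambda>v. (tderiv f x - tderiv g x) *v v) \<le> B * 2"
      using onorm_matrix_le_norm[of "tderiv f x - tderiv g x"] B[of x] by linarith
  qed
qed

lemma onorm_matrix_minus: "onorm (\<lambda>v. (A - B) *v v) = onorm (\<lambda>v. (B - A) *v v)"
  for A B :: "real^2^2"
proof -
  have "(\<lambda>v. (A - B) *v v) = (\<lambda>v. - ((B - A) *v v))"
    by (simp add: fun_eq_iff matrix_vector_mult_diff_rdistrib)
  then show ?thesis by (simp add: onorm_neg)
qed

lemma onorm_matrix_triangle:
  "onorm (\<lambda>v. (A - C) *v v) \<le> onorm (\<lambda>v. (A - B) *v v) + onorm (\<lambda>v. (B - C) *v v)"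
  for A B C :: "real^2^2"
proof -
  have "(\<lambda>v. (A - C) *v v) = (\<lambda>v. (A - B) *v v + (B - C) *v v)"
    by (simp add: fun_eq_iff matrix_vector_mult_diff_rdistrib)
  then show ?thesis by (simp add: onorm_triangle)
qed

interpretation C1: Metric_space C1_maps C1_dist
proof
  fix f g h :: "torus2 \<Rightarrow> torus2"
  note bd = bdd_above_dist_torus2 and bo = bdd_above_onorm_tderiv
  have pos: "0 \<le> onorm (\<lambda>v. A *v v)" for A :: "real^2^2"
    by (intro onorm_pos_le matrix_vector_mul_bounded_linear)
  have d_le: "dist (f x) (g x) \<le> (SUP x. dist (f x) (g x))" for f g :: "torus2 \<Rightarrow> torus2" and x
    by (rule cSUP_upper[OF UNIV_I bd])
  have o_le: "onorm (\<lambda>v. (tderiv f x - tderiv g x) *v v)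
      \<le> (SUP x. onorm (\<lambda>v. (tderiv f x - tderiv g x) *v v))"
    if "f \<in> C1_maps" "g \<in> C1_maps" for f g x
    by (rule cSUP_upper[OF UNIV_I bo[OF that]])
  have d0: "0 \<le> (SUP x. dist (f x) (g x))" for f g :: "torus2 \<Rightarrow> torus2"
    using d_le order_trans zero_le_dist by blast
  have o0: "0 \<le> (SUP x. onorm (\<lambda>v. (tderiv f x - tderiv g x) *v v))"
    if "f \<in> C1_maps" "g \<in> C1_maps" for f g
    using o_le[OF that] order_trans pos by blast
  show "0 \<le> C1_dist f g"
    using d0 o0 unfolding C1_dist_def by (auto intro: add_nonneg_nonneg)
  show "C1_dist f g = C1_dist g f"
    unfolding C1_dist_def
    by (simp add: dist_commute onorm_matrix_minus[of "tderiv f _"] conj_commute)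
  show "C1_dist f g = 0 \<longleftrightarrow> f = g" if fg: "f \<in> C1_maps" "g \<in> C1_maps"
  proof
    assume "C1_dist f g = 0"
    then have "(SUP x. dist (f x) (g x)) = 0"
      using fg d0[of f g] o0[OF fg] unfolding C1_dist_def by auto
    then have "dist (f x) (g x) = 0" for x using d_le[of f x g] by simp
    then show "f = g" by (simp add: fun_eq_iff)
  next
    have "((*v) 0) = (\<lambda>v::real^2. 0 :: real^2)" by (simp add: fun_eq_iff)
    then have "onorm ((*v) (0 :: real^2^2)) = 0" using onorm_zero by metis
    moreover assume "f = g"
    ultimately show "C1_dist f g = 0" unfolding C1_dist_def by simp
  qed
  show "C1_dist f h \<le> C1_dist f g + C1_dist g h"
    if fgh: "f \<in> C1_maps" "g \<in> C1_maps" "h \<in> C1_maps"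
  proof -
    have "(SUP x. dist (f x) (h x)) \<le> (SUP x. dist (f x) (g x)) + (SUP x. dist (g x) (h x))"
    proof (rule cSUP_least)
      fix x
      show "dist (f x) (h x) \<le> (SUP x. dist (f x) (g x)) + (SUP x. dist (g x) (h x))"
        using d_le[of f x g] d_le[of g x h] dist_triangle[of "f x" "h x" "g x"] by linarith
    qed simp
    moreover have "(SUP x. onorm (\<lambda>v. (tderiv f x - tderiv h x) *v v))
      \<le> (SUP x. onorm (\<lambda>v. (tderiv f x - tderiv g x) *v v))
        + (SUP x. onorm (\<lambda>v. (tderiv g x - tderiv h x) *v v))"
    proof (rule cSUP_least)
      fix x
      show "onorm (\<lambda>v. (tderiv f x - tderiv h x) *v v)
        \<le> (SUP x. onorm (\<lambda>v. (tderiv f x - tderiv g x) *v v))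
          + (SUP x. onorm (\<lambda>v. (tderiv g x - tderiv h x) *v v))"
        using o_le[OF fgh(1,2), of x] o_le[OF fgh(2,3), of x]
          onorm_matrix_triangle[of "tderiv f x" "tderiv h x" "tderiv g x"] by linarith
    qed simp
    ultimately show ?thesis using fgh unfolding C1_dist_def by simp
  qed
qed

subsection \<open>Endomorphisms, the constants and the exponents\<close>

definition End1 :: "(torus2 \<Rightarrow> torus2) set" where
  "End1 = {f. C1_local_diffeo f \<and> f \<in> measurable haar haar \<and> distr haar haar f = haar \<and> \<not> bij f}"

lemma C1_local_diffeo_imp_C1:
  assumes "C1_local_diffeo f"
  shows "f \<in> C1_maps"
proof -
  have loc: "\<exists>U. x \<in> U \<and> open U \<and> C1_on U f" for x
    using assms unfolding C1_local_diffeo_def by blast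
  have "isCont (tderiv f) x" for x
    using loc[of x] continuous_on_eq_continuous_at unfolding C1_on_def by blast
  then have "continuous_on UNIV (tderiv f)"
    by (simp add: continuous_at_imp_continuous_on)
  then show ?thesis
    using loc unfolding C1_maps_def C1_on_def by blast
qed

definition unit_tangent :: "(torus2 \<times> (real^2)) set" where
  "unit_tangent = UNIV \<times> sphere 0 1"

text \<open>
  \<open>I_chi f n x v\<close> is \<open>I(x, v; f\<^sup>n)\<close>. For \<open>f\<close> in \<^const>\<open>End1\<close> the fibres of \<open>f\<^sup>n\<close> are finite,
  the derivatives are invertible, and by compactness all the real-valued suprema and infima below
  are taken over bounded nonempty sets.
\<close>

definition I_chi :: "(torus2 \<Rightarrow> torus2) \<Rightarrow> nat \<Rightarrow> torus2 \<Rightarrow> real^2 \<Rightarrow> real" where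
  "I_chi f n x v = (\<Sum>y\<in>(f ^^ n) -` {x}.
     ln (norm (matrix_inv (tderiv (f ^^ n) y) *v v)) / \<bar>det (tderiv (f ^^ n) y)\<bar>)"

definition C_chi :: "(torus2 \<Rightarrow> torus2) \<Rightarrow> real" where
  "C_chi f = (SUP n\<in>{1..}. 1 / real n * (INF (x, v)\<in>unit_tangent. I_chi f n x v))"

definition C_det :: "(torus2 \<Rightarrow> torus2) \<Rightarrow> real" where
  "C_det f = (SUP n\<in>{1..}. 1 / real n * (INF x. ln \<bar>det (tderiv (f ^^ n) x)\<bar>))"

definition conorm :: "real^2^2 \<Rightarrow> real" where
  "conorm A = (INF v\<in>sphere 0 1. norm (A *v v))"

text \<open>The limits exist only almost everywhere; elsewhere \<^const>\<open>lim\<close> has an unspecified value,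
  on a null set.\<close>

definition chi_plus :: "(torus2 \<Rightarrow> torus2) \<Rightarrow> torus2 \<Rightarrow> real" where
  "chi_plus f x = lim (\<lambda>n. 1 / real n * ln (onorm (\<lambda>v. tderiv (f ^^ n) x *v v)))"

definition chi_minus :: "(torus2 \<Rightarrow> torus2) \<Rightarrow> torus2 \<Rightarrow> real" where
  "chi_minus f x = lim (\<lambda>n. 1 / real n * ln (conorm (tderiv (f ^^ n) x)))"

definition U1 :: "(torus2 \<Rightarrow> torus2) set" where
  "U1 = {f \<in> End1. C_chi f > - (1/2) * C_det f}"

lemma U1_subset_topspace: "U1 \<subseteq> topspace C1_topology"
  using C1_local_diffeo_imp_C1 unfolding U1_def End1_def C1_topology_def by auto

end

theory Submission
  imports Defs "HOL-Probability.Probability_Measure"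
begin

text \<open>
  The integrals of \<open>\<chi>\<^sup>-\<close> and \<open>\<chi>\<^sup>+\<close> add up to that of \<open>ln \<bar>det Df\<bar>\<close>, which is continuous in \<open>f\<close>, so only
  \<open>\<chi>\<^sup>-\<close> matters. By Kingman's theorem \<open>- \<integral> \<chi>\<^sup>-(g)\<close> is the limit of \<open>\<beta>\<^sub>n(g) / n\<close>, where
  \<open>\<beta>\<^sub>n(g) = \<integral> ln \<parallel>(Dg\<^sup>n)\<^sup>-\<^sup>1\<parallel> d\<mu>\<close>. Each \<open>\<beta>\<^sub>n\<close> is continuous and \<open>n \<mapsto> \<beta>\<^sub>n(g)\<close> is subadditive. If it is also
  superadditive along multiples of some \<open>N\<close>, up to a constant uniform for \<open>g\<close> near \<open>f\<close>, the
  convergence is uniform near \<open>f\<close> and the limit is continuous.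

  The hypothesis \<open>C\<^sub>\<chi>(f) > - C\<^sub>d\<^sub>e\<^sub>t(f) / 2\<close> says that the random walk by inverse branches, which moves
  from \<open>x\<close> to \<open>y \<in> f\<^sup>-\<^sup>n(x)\<close> with probability \<open>1 / \<bar>det D\<^sub>yf\<^sup>n\<bar>\<close> and applies \<open>A = (D\<^sub>yf\<^sup>n)\<^sup>-\<^sup>1\<close>, stretches every
  direction on average by more than \<open>\<bar>det A\<bar>\<^sup>1\<^sup>/\<^sup>2\<close>. Expanding the exponential, this becomes a bound on
  the moments \<open>E \<bar>Av\<bar>\<^sup>-\<^sup>s\<close> for a small \<open>s > 0\<close>. As \<open>A\<close> multiplies the sine of the angle of two unit vectors
  \<open>v\<close>, \<open>w\<close> by \<open>\<bar>det A\<bar> / (\<bar>Av\<bar> \<bar>Aw\<bar>)\<close>, angles contract exponentially in the mean. Hence \<open>ln \<bar>A v\<bar>\<close> depends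
  on \<open>v\<close> only up to an error bounded in the mean, which gives the superadditivity.

  The moment bound is used in the integrated form
  \<open>\<integral> \<bar>(D\<^sub>yg)\<^sup>-\<^sup>1 \<xi>(g y)\<bar>\<^sup>-\<^sup>s d\<mu>(y) \<le> S \<integral> \<bar>\<xi>\<bar>\<^sup>-\<^sup>s d\<mu>\<close> for all nowhere vanishing Borel vector fields \<open>\<xi>\<close>. It follows
  from the bound on fibres of \<open>f\<close> by a change of variables near each preimage, and compactness
  makes it stable under perturbation of \<open>f\<close>.
\<close>

section \<open>A subadditive ergodic theorem\<close>

text \<open>The exponents of the moments explain the threshold. The sine of the angle between two
  pulled back directions is raised to the power s/2 and split, by the inequality of arithmetic and
  geometric means, into two negative moments of order s. Over time n its mean is thus multiplied by
  about exp (- s n (C_chi + C_det / 2) + O(s^2)), a contraction for small s when C_chi > - C_det /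
  2. The two suprema may be approached at different times n0 and n1, so both estimates are carried
  to the common time n0 * n1.

  The obstacle is uniformity in g, whose fibres are hard to compare with those of f. A bound on
  integrals of vector fields avoids the comparison, because it needs only a one-sided change of
  variables in charts. It has to hold for all Borel fields and not only for constant ones: it is
  iterated by inserting pulled back fields, and in the superadditivity the direction produced by one
  block is the initial direction of the other.\<close>

definition rliminf :: "(nat \<Rightarrow> real) \<Rightarrow> real" where
  "rliminf b = real_of_ereal (liminf (\<lambda>n. ereal (b n)))"

lemma rliminf_ereal:
  assumes "\<And>n. \<bar>b n\<bar> \<le> C"
  shows "liminf (\<lambda>n. ereal (b n)) = ereal (rliminf b)"
proof -
  have 1: "- C \<le> b n" "b n \<le> C" for n using assms[of n] by auto
  have "ereal (- C) \<le> liminf (\<lambda>n. ereal (b n))"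
    by (intro Liminf_bounded always_eventually allI) (use 1 in simp)
  moreover have "liminf (\<lambda>n. ereal (b n)) \<le> limsup (\<lambda>n. ereal (b n))"
    by (intro Liminf_le_Limsup) simp
  moreover have "limsup (\<lambda>n. ereal (b n)) \<le> ereal C"
    by (intro Limsup_bounded always_eventually allI) (use 1 in simp)
  ultimately have "\<bar>liminf (\<lambda>n. ereal (b n))\<bar> \<noteq> \<infinity>"
    by (cases "liminf (\<lambda>n. ereal (b n))") auto
  then show ?thesis unfolding rliminf_def by (simp add: ereal_real)
qed

lemma rliminf_ge:
  assumes "\<And>n. \<bar>b n\<bar> \<le> C" "\<forall>\<^sub>F n in sequentially. c \<le> b n"
  shows "c \<le> rliminf b"
proof -
  have "ereal c \<le> liminf (\<lambda>n. ereal (b n))"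
    by (intro Liminf_bounded eventually_mono[OF assms(2)]) simp
  then show ?thesis using rliminf_ereal[OF assms(1)] by simp
qed

lemma rliminf_eventually:
  assumes "\<And>n. \<bar>b n\<bar> \<le> C" "c < rliminf b"
  shows "\<forall>\<^sub>F n in sequentially. c < b n"
  using rliminf_ereal[OF assms(1)] assms(2) less_LiminfD[of "ereal c" sequentially "\<lambda>n. ereal (b n)"]
  by simp

lemma rliminf_frequently:
  assumes "\<And>n. \<bar>b n\<bar> \<le> C" "rliminf b < c"
  shows "\<exists>n\<ge>N. b n < c"
proof (rule ccontr)
  assume "\<not> ?thesis"
  then have "\<forall>\<^sub>F n in sequentially. c \<le> b n"
    unfolding eventually_sequentially by (auto simp: not_less)
  from rliminf_ge[OF assms(1) this] assms(2) show False by simp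
qed

lemma rliminf_abs_le:
  assumes "\<And>n. \<bar>b n\<bar> \<le> C"
  shows "\<bar>rliminf b\<bar> \<le> C"
proof -
  have "- C \<le> rliminf b"
    using assms by (intro rliminf_ge[OF assms] always_eventually allI) (simp add: abs_le_iff minus_le_iff)
  moreover have "rliminf b \<le> C"
  proof (rule ccontr)
    assume "\<not> ?thesis"
    then have "\<forall>\<^sub>F n in sequentially. C < b n" by (intro rliminf_eventually[OF assms]) auto
    then obtain n where "C < b n" by (auto simp: eventually_sequentially)
    then show False using assms[of n] by simp
  qed
  ultimately show ?thesis by simp
qed

lemma rliminf_measurable [measurable]:
  assumes [measurable]: "\<And>n. b n \<in> borel_measurable M"
  shows "(\<lambda>x. rliminf (\<lambda>n. b n x)) \<in> borel_measurable M"
  unfolding rliminf_def by measurable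

text \<open>The left side of the second hypothesis is the limit superior written through
  \<open>rliminf\<close>, so the hypothesis says that limsup is at most liminf.\<close>

lemma rliminf_convergent:
  assumes bd: "\<And>n. \<bar>b n\<bar> \<le> C" and le: "- rliminf (\<lambda>n. - b n) \<le> rliminf b"
  shows "b \<longlonglongrightarrow> rliminf b"
proof (rule tendstoI)
  fix e :: real assume e: "e > 0"
  have bd': "\<bar>- b n\<bar> \<le> C" for n using bd[of n] by simp
  have "\<forall>\<^sub>F n in sequentially. rliminf b - e < b n"
    using e by (intro rliminf_eventually[OF bd]) simp
  moreover have "\<forall>\<^sub>F n in sequentially. rliminf (\<lambda>n. - b n) - e < - b n"
    using e by (intro rliminf_eventually[OF bd']) simp
  ultimately show "\<forall>\<^sub>F n in sequentially. dist (b n) (rliminf b) < e"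
    by eventually_elim (use le in \<open>auto simp: dist_real_def\<close>)
qed

section \<open>Maps preserving a probability measure, and bounded subadditive cocycles over
  them\<close>

locale mpt = prob_space M for M :: "'a measure" +
  fixes T :: "'a \<Rightarrow> 'a"
  assumes T_measurable [measurable]: "T \<in> measurable M M"
    and T_invariant: "distr M M T = M"
begin

lemma iter_measurable [measurable]: "T ^^ n \<in> measurable M M"
  by (induction n) (auto simp: id_def comp_def intro: measurable_compose[OF _ T_measurable])

lemma iter_invariant: "distr M M (T ^^ n) = M"
proof (induction n)
  case 0 show ?case by (simp add: id_def distr_id)
next
  case (Suc n)
  have "distr (distr M M (T ^^ n)) M T = distr M M (T \<circ> T ^^ n)"
    by (rule distr_distr) measurable
  then show ?case using Suc T_invariant by (simp add: comp_def)
qed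

lemma iter_space: "x \<in> space M \<Longrightarrow> (T ^^ n) x \<in> space M"
  using iter_measurable measurable_space by metis

lemma mpt_iter: "mpt M (T ^^ n)"
  by unfold_locales (use iter_invariant in auto)

lemma integral_iter:
  assumes "f \<in> borel_measurable M"
  shows "(\<integral>x. f ((T ^^ n) x) \<partial>M) = (\<integral>x. f x \<partial>M :: real)"
  using integral_distr[OF iter_measurable assms, of n] iter_invariant[of n] by simp

lemma nn_integral_iter:
  assumes "f \<in> borel_measurable M"
  shows "(\<integral>\<^sup>+x. f ((T ^^ n) x) \<partial>M) = (\<integral>\<^sup>+x. f x \<partial>M)"
  using nn_integral_distr[OF iter_measurable, of f n] assms iter_invariant[of n] by simp

lemma integrable_bounded:
  assumes "f \<in> borel_measurable M" "\<And>x. x \<in> space M \<Longrightarrow> \<bar>f x\<bar> \<le> (B::real)"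
  shows "integrable M f"
  by (rule integrable_const_bound[where B = B]) (use assms in auto)

end

text \<open>The linear bound takes the place of Kingman's integrability assumption. Logarithms of
  norms of derivative cocycles satisfy it with C = ln R, and it bounds every quotient a n x / n by
  C. At n = 0 it forces a 0 x = 0.\<close>

locale subadditive_cocycle = mpt +
  fixes a :: "nat \<Rightarrow> 'a \<Rightarrow> real" and C :: real
  assumes a_measurable [measurable]: "\<And>n. a n \<in> borel_measurable M"
    and a_sub: "\<And>m n x. x \<in> space M \<Longrightarrow> a (m + n) x \<le> a m x + a n ((T ^^ m) x)"
    and a_bound: "\<And>n x. x \<in> space M \<Longrightarrow> \<bar>a n x\<bar> \<le> C * real n"
begin

definition lower :: "'a \<Rightarrow> real" where
  "lower x = rliminf (\<lambda>n. a n x / real n)"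

lemma lower_measurable [measurable]: "lower \<in> borel_measurable M"
  unfolding lower_def by measurable

lemma C_nonneg: "0 \<le> C"
proof -
  obtain x where "x \<in> space M" using not_empty by blast
  then show ?thesis using a_bound[of x 1] by simp
qed

lemma quotient_bound: "x \<in> space M \<Longrightarrow> \<bar>a n x / real n\<bar> \<le> C"
  using a_bound[of x n] C_nonneg by (cases "n = 0") (simp_all add: divide_le_eq abs_divide)

text \<open>Comes from a (n + 1) x <= a 1 x + a n (T x); passing from the denominator n + 1 to n
  costs at most 2 C / (n + 1). In \<open>tiling\<close> it bounds \<open>lower\<close> at the start
  of a block by its values inside the block.\<close>

lemma lower_mono:
  assumes x: "x \<in> space M"
  shows "lower x \<le> lower (T x)"
proof (rule field_le_epsilon)
  fix e :: real assume e: "e > 0"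
  have Tx: "T x \<in> space M" using iter_space[OF x, of 1] by simp
  have "\<forall>\<^sub>F n in sequentially. lower x - e/2 < a n x / real n"
    unfolding lower_def using e by (intro rliminf_eventually[OF quotient_bound[OF x]]) simp
  then have 1: "\<forall>\<^sub>F n in sequentially. lower x - e/2 < a (Suc n) x / real (Suc n)"
    by (rule eventually_sequentially_Suc[THEN iffD2])
  have "(\<lambda>n. 2 * C / real (Suc n)) \<longlonglongrightarrow> 0"
    by (rule LIMSEQ_Suc) (rule lim_const_over_n)
  then have 2: "\<forall>\<^sub>F n in sequentially. 2 * C / real (Suc n) < e/2"
    by (rule order_tendstoD) (use e in simp)
  have "\<forall>\<^sub>F n in sequentially. lower x - e \<le> a n (T x) / real n"
    using 1 2 eventually_gt_at_top[of 0]
  proof eventually_elim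
    case (elim n)
    have "a (Suc n) x \<le> C + a n (T x)"
      using a_sub[OF x, of 1 n] a_bound[OF x, of 1] by simp
    then have "a (Suc n) x / real (Suc n) \<le> (C + a n (T x)) / real (Suc n)"
      by (rule divide_right_mono) simp
    also have "\<dots> = a n (T x) / real n + (C - a n (T x) / real n) / real (Suc n)"
    proof -
      define q where "q = a n (T x) / real n"
      have "a n (T x) = q * real n" using elim(3) by (simp add: q_def)
      then show ?thesis unfolding q_def[symmetric] by (simp add: field_simps)
    qed
    also have "\<dots> \<le> a n (T x) / real n + 2 * C / real (Suc n)"
    proof -
      have "C - a n (T x) / real n \<le> 2 * C" using abs_le_D2[OF quotient_bound[OF Tx, of n]] by linarith
      then show ?thesis by (intro add_left_mono divide_right_mono) auto
    qed
    finally show ?case using elim by linarith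
  qed
  then have "lower x - e \<le> lower (T x)"
    unfolding lower_def[of "T x"] by (intro rliminf_ge[OF quotient_bound[OF Tx]])
  then show "lower x \<le> lower (T x) + e" by simp
qed

lemma lower_mono_iter: "x \<in> space M \<Longrightarrow> lower x \<le> lower ((T ^^ n) x)"
proof (induction n)
  case (Suc n)
  then show ?case using lower_mono[OF iter_space[of x n]] by force
qed simp

text \<open>The tiling argument of Katznelson and Weiss: an orbit segment is cut into blocks of length at
  most \<open>N\<close> along which \<open>a\<close> is as small as \<^const>\<open>lower\<close> predicts, except at visits to \<open>A\<close>.\<close>

lemma tiling:
  fixes e :: real and N :: nat
  defines "A \<equiv> {x \<in> space M. \<forall>m\<in>{1..N}. real m * (lower x + e) < a m x}"
  assumes e: "e > 0" and x: "x \<in> space M"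
  shows "a n x \<le> (\<Sum>i<n. lower ((T ^^ i) x) + e + 2 * (C + e) * indicator A ((T ^^ i) x))
            + 2 * (C + e) * real N"
  using x
proof (induction n arbitrary: x rule: less_induct)
  case (less n)
  \<comment> \<open>Since \<open>lower\<close> is at least - C, the surcharge 2 (C + e) lifts the
    summand at a visit to A above C and hence above a 1 x.\<close>
  define g where "g x = lower x + e + 2 * (C + e) * indicator A x" for x
  have low: "\<bar>lower x\<bar> \<le> C" if "x \<in> space M" for x
    unfolding lower_def by (rule rliminf_abs_le[OF quotient_bound[OF that]])
  have g_ge: "lower x + e \<le> g x" for x
    using e C_nonneg by (simp add: g_def indicator_def)
  have split: "(\<Sum>i<m + k. g ((T ^^ i) x)) = (\<Sum>i<m. g ((T ^^ i) x)) + (\<Sum>i<k. g ((T ^^ i) ((T ^^ m) x)))"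
    for m k
    by (induction k) (simp_all add: funpow_add add.commute[of m])
  have sp: "(T ^^ i) x \<in> space M" for i using iter_space[OF less.prems] .
  \<comment> \<open>A remainder of length at most N is paid for by the final constant, a point of A
    is passed in a single step, and any other point starts a block of some length m <= N.\<close>
  consider "n \<le> N" | "N < n" "x \<in> A" | m where "N < n" "m \<in> {1..N}" "a m x \<le> real m * (lower x + e)"
    using less.prems unfolding A_def by fastforce
  then have "a n x \<le> (\<Sum>i<n. g ((T ^^ i) x)) + 2 * (C + e) * real N"
  proof cases
    case 1
    have "(\<Sum>i<n. - (C + e)) \<le> (\<Sum>i<n. g ((T ^^ i) x))"
      using low[OF sp] g_ge e by (intro sum_mono) (smt (verit))
    moreover have "(2 * C + e) * real n \<le> (2 * C + 2 * e) * real N"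
      using 1 e C_nonneg by (intro mult_mono) auto
    ultimately show ?thesis
      using a_bound[OF less.prems, of n] by (simp add: algebra_simps)
  next
    case 2
    then obtain k where n: "n = 1 + k" by (metis add.commute le_Suc_ex less_imp_Suc_add plus_1_eq_Suc)
    have "a 1 x \<le> g x"
      using a_bound[OF less.prems, of 1] low[OF less.prems] 2 e by (simp add: g_def)
    moreover have "a k (T x) \<le> (\<Sum>i<k. g ((T ^^ i) (T x))) + 2 * (C + e) * real N"
      using less.IH[of k "T x"] n sp[of 1] by (simp add: g_def)
    ultimately show ?thesis
      using a_sub[OF less.prems, of 1 k] split[of 1 k] n by simp
  next
    case 3
    then obtain k where n: "n = m + k" by (metis atLeastAtMost_iff le_Suc_ex less_imp_le order_trans)
    have "a m x \<le> (\<Sum>i<m. lower x + e)" using 3 by simp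
    also have "\<dots> \<le> (\<Sum>i<m. g ((T ^^ i) x))"
    proof (rule sum_mono)
      fix i
      show "lower x + e \<le> g ((T ^^ i) x)"
        using lower_mono_iter[OF less.prems, of i] g_ge[of "(T ^^ i) x"] by linarith
    qed
    finally have "a m x \<le> (\<Sum>i<m. g ((T ^^ i) x))" .
    moreover have "a k ((T ^^ m) x) \<le> (\<Sum>i<k. g ((T ^^ i) ((T ^^ m) x))) + 2 * (C + e) * real N"
      using less.IH[of k "(T ^^ m) x"] n 3 sp[of m] by (simp add: g_def)
    ultimately show ?thesis
      using a_sub[OF less.prems, of m k] split[of m k] n by simp
  qed
  then show ?case by (simp add: g_def)
qed

lemma lower_bound: "x \<in> space M \<Longrightarrow> \<bar>lower x\<bar> \<le> C"
  unfolding lower_def by (rule rliminf_abs_le[OF quotient_bound])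

lemma integrable_lower: "integrable M lower"
  by (rule integrable_bounded[OF _ lower_bound]) simp_all

lemma integrable_a: "integrable M (a n)"
  by (rule integrable_bounded[OF _ a_bound]) simp_all

text \<open>Integrate \<open>tiling\<close>. The exceptional sets A N decrease to the empty set,
  because every point has a length at which the quotient is below lower x + e; so N can be chosen
  with K * measure (A N) < e. The remainder K N disappears on division by n.\<close>

lemma integral_lower_ge:
  assumes d: "d > 0"
  shows "\<forall>\<^sub>F n in sequentially. (\<integral>x. a n x \<partial>M) / real n \<le> (\<integral>x. lower x \<partial>M) + d"
proof -
  define e where "e = d / 3"
  have e: "e > 0" using d by (simp add: e_def)
  define K where "K = 2 * (C + e)"
  have K: "K > 0" using e C_nonneg by (simp add: K_def)
  define A where "A N = {x \<in> space M. \<forall>m\<in>{1..N}. real m * (lower x + e) < a m x}" for N :: nat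
  have A[measurable]: "A N \<in> sets M" for N unfolding A_def by measurable
  have "decseq A" unfolding A_def decseq_def by force
  moreover have "(\<Inter>N. A N) = {}"
  proof (rule ccontr)
    assume "\<not> ?thesis"
    then obtain x where x: "\<And>N. x \<in> A N" by blast
    then have xs: "x \<in> space M" by (simp add: A_def)
    obtain n where n: "n \<ge> 1" "a n x / real n < lower x + e"
      using rliminf_frequently[where b = "\<lambda>n. a n x / real n" and c = "lower x + e" and N = 1,
          OF quotient_bound[OF xs]] e
      by (auto simp: lower_def)
    then have "a n x < real n * (lower x + e)" by (simp add: divide_less_eq mult.commute)
    moreover have "real n * (lower x + e) < a n x" using x[of n] n by (simp add: A_def)
    ultimately show False by simp
  qed
  ultimately have "(\<lambda>N. measure M (A N)) \<longlonglongrightarrow> 0"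
    using finite_Lim_measure_decseq[of A] A by (simp add: image_subset_iff)
  then have "\<forall>\<^sub>F N in sequentially. measure M (A N) < e / K"
    by (rule order_tendstoD) (use e K in simp)
  then obtain N where N: "measure M (A N) < e / K" by (auto simp: eventually_sequentially)
  define g where "g x = lower x + e + K * indicator (A N) x" for x
  have g[measurable]: "g \<in> borel_measurable M" unfolding g_def by measurable
  have gi: "integrable M g" unfolding g_def
    by (intro Bochner_Integration.integrable_add integrable_lower integrable_mult_right
        integrable_real_indicator) (simp_all add: less_top[symmetric])
  have gi': "integrable M (\<lambda>x. g ((T ^^ i) x))" for i
    using integrable_distr[OF iter_measurable[of i], of g] iter_invariant[of i] gi by simp
  have "(\<integral>x. g x \<partial>M) = (\<integral>x. lower x \<partial>M) + e + K * measure M (A N)"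
  proof -
    have "integrable M (\<lambda>x. K * indicator (A N) x)"
      by (intro integrable_mult_right integrable_real_indicator) (simp_all add: less_top[symmetric])
    then show ?thesis unfolding g_def using integrable_lower by (simp add: prob_space)
  qed
  also have "\<dots> \<le> (\<integral>x. lower x \<partial>M) + 2 * e" using N K by (simp add: field_simps)
  finally have ig: "(\<integral>x. g x \<partial>M) \<le> (\<integral>x. lower x \<partial>M) + 2 * e" .
  have main: "(\<integral>x. a n x \<partial>M) \<le> real n * ((\<integral>x. lower x \<partial>M) + 2 * e) + K * real N" for n
  proof -
    have "(\<integral>x. a n x \<partial>M) \<le> (\<integral>x. (\<Sum>i<n. g ((T ^^ i) x)) + K * real N \<partial>M)"
    proof (rule integral_mono)
      fix x assume "x \<in> space M"
      from tiling[OF e this, of n N]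
      show "a n x \<le> (\<Sum>i<n. g ((T ^^ i) x)) + K * real N"
        unfolding g_def A_def K_def by simp
    qed (use gi' integrable_a in auto)
    also have "\<dots> = real n * (\<integral>x. g x \<partial>M) + K * real N"
      using gi' integral_iter[OF g] by (simp add: prob_space)
    also have "\<dots> \<le> real n * ((\<integral>x. lower x \<partial>M) + 2 * e) + K * real N"
      using ig by (intro add_right_mono mult_left_mono) auto
    finally show ?thesis .
  qed
  have "(\<lambda>n. K * real N / real n) \<longlonglongrightarrow> 0" by (rule lim_const_over_n)
  then have "\<forall>\<^sub>F n in sequentially. K * real N / real n < e"
    by (rule order_tendstoD) (use e in simp)
  then show ?thesis
    using eventually_gt_at_top[of 0]
  proof eventually_elim
    case (elim n)
    have "(\<integral>x. a n x \<partial>M) / real n \<le> (real n * ((\<integral>x. lower x \<partial>M) + 2 * e) + K * real N) / real n"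
      by (intro divide_right_mono main) simp
    also have "\<dots> = (\<integral>x. lower x \<partial>M) + 2 * e + K * real N / real n"
      using elim by (simp add: field_simps)
    finally show ?case using elim(1) e_def by linarith
  qed
qed

end

context mpt begin

text \<open>The negatives of the Birkhoff sums form an additive cocycle. The estimate for its
  \<open>lower\<close> becomes, after a change of sign, an upper bound for the limsup of the
  averages.\<close>

lemma birkhoff_limsup:
  fixes f :: "'a \<Rightarrow> real"
  assumes [measurable]: "f \<in> borel_measurable M" and bd: "\<And>x. x \<in> space M \<Longrightarrow> \<bar>f x\<bar> \<le> B"
  shows "(\<integral>x. - rliminf (\<lambda>n. - (\<Sum>i<n. f ((T ^^ i) x)) / real n) \<partial>M) \<le> (\<integral>x. f x \<partial>M)"
proof -
  define s where "s n x = - (\<Sum>i<n. f ((T ^^ i) x))" for n x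
  have split: "(\<Sum>i<m + k. f ((T ^^ i) x)) = (\<Sum>i<m. f ((T ^^ i) x)) + (\<Sum>i<k. f ((T ^^ i) ((T ^^ m) x)))"
    for m k x
    by (induction k) (simp_all add: funpow_add add.commute[of m])
  interpret S: subadditive_cocycle M T s B
  proof
    show "s n \<in> borel_measurable M" for n unfolding s_def by measurable
    show "s (m + n) x \<le> s m x + s n ((T ^^ m) x)" for m n x
      unfolding s_def split by simp
    show "\<bar>s n x\<bar> \<le> B * real n" if "x \<in> space M" for n x
    proof -
      have "\<bar>s n x\<bar> \<le> (\<Sum>i<n. \<bar>f ((T ^^ i) x)\<bar>)" unfolding s_def by simp
      also have "\<dots> \<le> (\<Sum>i<n. B)" by (intro sum_mono bd iter_space that)
      finally show ?thesis by (simp add: mult.commute)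
    qed
  qed
  have fi: "integrable M (\<lambda>x. f ((T ^^ i) x))" for i
    by (rule integrable_bounded[of _ B]) (auto intro: bd iter_space)
  have int_s: "(\<integral>x. s n x \<partial>M) = - real n * (\<integral>x. f x \<partial>M)" for n
    unfolding s_def using fi integral_iter[of f] by (simp add: sum_distrib_left)
  have low: "S.lower = (\<lambda>x. rliminf (\<lambda>n. - (\<Sum>i<n. f ((T ^^ i) x)) / real n))"
    by (simp add: S.lower_def s_def fun_eq_iff)
  have "- (\<integral>x. f x \<partial>M) \<le> (\<integral>x. S.lower x \<partial>M) + d" if "d > 0" for d
  proof -
    have "\<forall>\<^sub>F n in sequentially. - (\<integral>x. f x \<partial>M) \<le> (\<integral>x. S.lower x \<partial>M) + d"
      using S.integral_lower_ge[OF that] eventually_gt_at_top[of 0]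
      by eventually_elim (simp add: int_s)
    then show ?thesis by simp
  qed
  then have "- (\<integral>x. f x \<partial>M) \<le> (\<integral>x. S.lower x \<partial>M)" by (rule field_le_epsilon)
  then show ?thesis unfolding low by simp
qed

end

context subadditive_cocycle begin

lemma block_bound:
  assumes "x \<in> space M"
  shows "a (k * q) x \<le> (\<Sum>i<q. a k (((T ^^ k) ^^ i) x))"
proof (induction q)
  case 0 show ?case using a_bound[OF assms, of 0] by simp
next
  case (Suc q)
  have "a (k * q + k) x \<le> a (k * q) x + a k ((T ^^ (k * q)) x)" by (rule a_sub[OF assms])
  then show ?case using Suc by (simp add: funpow_mult algebra_simps)
qed

text \<open>Cutting n into n div k blocks of length k, subadditivity bounds a n by a Birkhoff sum of
  a k under \<open>T ^^ k\<close>, up to an error of at most C k. Then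
  \<open>birkhoff_limsup\<close> applies to \<open>T ^^ k\<close>, which preserves the measure as
  well.\<close>

lemma upper_integral_le:
  assumes k: "k > 0"
  shows "(\<integral>x. - rliminf (\<lambda>n. - a n x / real n) \<partial>M) \<le> (\<integral>x. a k x \<partial>M) / real k"
proof -
  interpret Tk: mpt M "T ^^ k" by (rule mpt_iter)
  define s where "s n x = (\<Sum>i<n. a k (((T ^^ k) ^^ i) x))" for n x
  have s_bound: "\<bar>s n x\<bar> \<le> C * real k * real n" if "x \<in> space M" for n x
  proof -
    have "\<bar>s n x\<bar> \<le> (\<Sum>i<n. \<bar>a k (((T ^^ k) ^^ i) x)\<bar>)" unfolding s_def by simp
    also have "\<dots> \<le> (\<Sum>i<n. C * real k)" by (intro sum_mono a_bound Tk.iter_space that)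
    finally show ?thesis by (simp add: mult.commute)
  qed
  have sq: "\<bar>- s n x / real n\<bar> \<le> C * real k" if "x \<in> space M" for n x
    using s_bound[OF that, of n] C_nonneg by (cases "n = 0") (simp_all add: abs_divide divide_le_eq)
  have qb: "\<bar>- a n x / real n\<bar> \<le> C" if "x \<in> space M" for n x
    using quotient_bound[OF that, of n] by simp
  have pt: "- rliminf (\<lambda>n. - a n x / real n) \<le> - rliminf (\<lambda>n. - s n x / real n) / real k"
    if x: "x \<in> space M" for x
  proof -
    have "rliminf (\<lambda>n. - s n x / real n) / real k \<le> rliminf (\<lambda>n. - a n x / real n)"
    proof (rule field_le_epsilon)
      fix e :: real assume e: "e > 0"
      define l where "l = rliminf (\<lambda>n. - s n x / real n) / real k"
      have "\<forall>\<^sub>F q in sequentially. k * l - k * e / 2 < - s q x / real q"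
        using e k by (intro rliminf_eventually[OF sq[OF x]]) (simp add: l_def)
      moreover have "filterlim (\<lambda>n. n div k) at_top sequentially"
        unfolding filterlim_at_top eventually_sequentially
      proof
        fix Z
        have "Z \<le> n div k" if "Z * k \<le> n" for n
          using div_le_mono[OF that, of k] k by simp
        then show "\<exists>N. \<forall>n\<ge>N. Z \<le> n div k" by blast
      qed
      ultimately have 1: "\<forall>\<^sub>F n in sequentially. k * l - k * e / 2 < - s (n div k) x / real (n div k)"
        by (rule eventually_compose_filterlim)
      have "(\<lambda>n. 2 * C * real k / real n) \<longlonglongrightarrow> 0" by (rule lim_const_over_n)
      then have 2: "\<forall>\<^sub>F n in sequentially. 2 * C * real k / real n < e/2"
        by (rule order_tendstoD) (use e in simp)
      have "\<forall>\<^sub>F n in sequentially. l - e \<le> - a n x / real n"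
        using 1 2 eventually_ge_at_top[of k]
      proof eventually_elim
        case (elim n)
        define q where "q = n div k"
        define r where "r = n mod k"
        have n: "n = k * q + r" by (simp add: q_def r_def)
        have r: "r < k" using k by (simp add: r_def)
        have q: "q > 0" using elim(3) k by (simp add: q_def div_greater_zero_iff)
        have n0: "n > 0" using elim k by simp
        have "a n x \<le> s q x + C * real r"
          using a_sub[OF x, of "k * q" r] block_bound[OF x, of k q] a_bound[OF iter_space[OF x, of "k * q"], of r] n
          unfolding s_def by (simp add: abs_le_iff)
        moreover have "s q x < - (k * l - k * e / 2) * real q"
          using elim(1) q unfolding q_def[symmetric] by (simp add: field_simps)
        moreover have "C * real r \<le> C * real k" using r C_nonneg by (intro mult_left_mono) auto
        ultimately have "a n x \<le> - (l - e / 2) * (real k * real q) + C * real k"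
          by (simp add: algebra_simps)
        also have "real k * real q = real n - real r" using n by simp
        also have "- (l - e / 2) * (real n - real r) = - (l - e / 2) * real n + (l - e/2) * real r"
          by (simp add: right_diff_distrib left_diff_distrib)
        finally have a1: "a n x \<le> - (l - e / 2) * real n + (l - e/2) * real r + C * real k" .
        \<comment> \<open>The incomplete last block shifts the main term by (l - e/2) r, which is at
          most C k; with the C k already present this is the 2 C k prepared above.\<close>
        have "l \<le> C"
          using abs_le_D1[OF rliminf_abs_le[where b = "\<lambda>n. - s n x / real n", OF sq[OF x]]] k
          by (simp add: l_def divide_le_eq)
        then have "(l - e/2) * real r \<le> C * real r" using e by (intro mult_right_mono) auto
        also have "\<dots> \<le> C * real k" using r C_nonneg by (intro mult_left_mono) auto
        finally have "(l - e/2) * real r \<le> C * real k" .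
        then have "a n x \<le> - (l - e/2) * real n + 2 * C * real k" using a1 by simp
        then have "a n x / real n \<le> (- (l - e/2) * real n + 2 * C * real k) / real n"
          by (rule divide_right_mono) simp
        also have "\<dots> = - (l - e/2) + 2 * C * real k / real n" using n0 by (simp add: field_simps)
        finally show ?case using elim(2) by simp
      qed
      then have "l - e \<le> rliminf (\<lambda>n. - a n x / real n)" by (rule rliminf_ge[OF qb[OF x]])
      then show "rliminf (\<lambda>n. - s n x / real n) / real k \<le> rliminf (\<lambda>n. - a n x / real n) + e"
        by (simp add: l_def)
    qed
    then show ?thesis by simp
  qed
  have s_meas[measurable]: "s n \<in> borel_measurable M" for n
    unfolding s_def using Tk.iter_measurable by measurable
  have i1: "integrable M (\<lambda>x. - rliminf (\<lambda>n. - a n x / real n))"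
    by (rule integrable_bounded[of _ C]) (use rliminf_abs_le[OF qb] in auto)
  have i2: "integrable M (\<lambda>x. - rliminf (\<lambda>n. - s n x / real n))"
    by (rule integrable_bounded[of _ "C * real k"]) (use rliminf_abs_le[OF sq] in auto)
  have "(\<integral>x. - rliminf (\<lambda>n. - a n x / real n) \<partial>M)
      \<le> (\<integral>x. - rliminf (\<lambda>n. - s n x / real n) / real k \<partial>M)"
    using i1 i2 pt by (intro integral_mono integrable_divide) auto
  also have "\<dots> = (\<integral>x. - rliminf (\<lambda>n. - s n x / real n) \<partial>M) / real k" by simp
  also have "\<dots> \<le> (\<integral>x. a k x \<partial>M) / real k"
    using Tk.birkhoff_limsup[of "a k" "C * real k"] a_bound unfolding s_def
    by (intro divide_right_mono) auto
  finally show ?thesis .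
qed

text \<open>The integral of the limsup is at most that of a n divided by n for every n > 0, and
  these numbers are eventually at most the integral of the liminf plus d. As liminf <= limsup
  pointwise, the two agree almost everywhere.\<close>

theorem AE_convergent: "AE x in M. convergent (\<lambda>n. a n x / real n)"
proof -
  define u where "u x = - rliminf (\<lambda>n. - a n x / real n)" for x
  have [measurable]: "u \<in> borel_measurable M" unfolding u_def by measurable
  have qb: "\<bar>- a n x / real n\<bar> \<le> C" if "x \<in> space M" for n x
    using quotient_bound[OF that, of n] by simp
  have ui: "integrable M u"
    unfolding u_def by (rule integrable_bounded[of _ C]) (use rliminf_abs_le[OF qb] in auto)
  have le: "lower x \<le> u x" if x: "x \<in> space M" for x
  proof (rule field_le_epsilon)
    fix e :: real assume e: "e > 0"
    have "\<forall>\<^sub>F n in sequentially. lower x - e/2 < a n x / real n"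
      unfolding lower_def using e by (intro rliminf_eventually[OF quotient_bound[OF x]]) simp
    moreover have "\<forall>\<^sub>F n in sequentially. - u x - e/2 < - a n x / real n"
      unfolding u_def using e by (intro rliminf_eventually[OF qb[OF x]]) simp
    ultimately have "\<forall>\<^sub>F n in sequentially. lower x \<le> u x + e"
      by eventually_elim simp
    then show "lower x \<le> u x + e" by simp
  qed
  have "(\<integral>x. u x \<partial>M) \<le> (\<integral>x. lower x \<partial>M)"
  proof (rule field_le_epsilon)
    fix d :: real assume "d > 0"
    have "\<forall>\<^sub>F n in sequentially. (\<integral>x. u x \<partial>M) \<le> (\<integral>x. lower x \<partial>M) + d"
      using integral_lower_ge[OF \<open>d > 0\<close>] eventually_gt_at_top[of 0]
    proof eventually_elim
      case (elim n)
      then show ?case using upper_integral_le[of n] unfolding u_def by linarith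
    qed
    then show "(\<integral>x. u x \<partial>M) \<le> (\<integral>x. lower x \<partial>M) + d" by simp
  qed
  then have "(\<integral>x. u x - lower x \<partial>M) \<le> 0" using ui integrable_lower by simp
  moreover have nn: "AE x in M. 0 \<le> u x - lower x" using le by auto
  moreover have "0 \<le> (\<integral>x. u x - lower x \<partial>M)" by (rule integral_nonneg_AE[OF nn])
  ultimately have "(\<integral>x. u x - lower x \<partial>M) = 0" by simp
  then have "AE x in M. u x - lower x = 0"
    using integral_nonneg_eq_0_iff_AE[OF _ nn] ui integrable_lower by simp
  then show ?thesis
  proof (rule AE_mp, intro AE_I2 impI)
    fix x assume "x \<in> space M" "u x - lower x = 0"
    then have "(\<lambda>n. a n x / real n) \<longlonglongrightarrow> rliminf (\<lambda>n. a n x / real n)"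
      by (intro rliminf_convergent[OF quotient_bound]) (auto simp: u_def lower_def)
    then show "convergent (\<lambda>n. a n x / real n)" by (rule convergentI)
  qed
qed

end

section \<open>Projectively contracting cocycles of plane matrices\<close>

definition wedge :: "real^2 \<Rightarrow> real^2 \<Rightarrow> real" where
  "wedge v w = v $ 1 * w $ 2 - v $ 2 * w $ 1"

lemma wedge_mult: "wedge (A *v v) (A *v w) = det A * wedge v w"
  by (simp add: wedge_def det_2 matrix_vector_mult_def sum_2 algebra_simps)

lemma wedge_scaleR: "wedge (a *\<^sub>R v) (b *\<^sub>R w) = a * b * wedge v w"
  by (simp add: wedge_def algebra_simps)

lemma norm2_sq: "(norm (v::real^2))\<^sup>2 = (v $ 1)\<^sup>2 + (v $ 2)\<^sup>2"
  by (simp add: norm_vec_def L2_set_def sum_2)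

lemma inner2: "v \<bullet> w = v $ 1 * w $ 1 + v $ 2 * w $ 2" for v w :: "real^2"
  by (simp add: inner_vec_def sum_2)

text \<open>Lagrange's identity. For unit vectors it reads sin^2 + cos^2 = 1, which makes the
  absolute value of \<open>wedge v w\<close> the sine of the angle.\<close>

lemma wedge_sq: "(wedge v w)\<^sup>2 + (v \<bullet> w)\<^sup>2 = (norm v)\<^sup>2 * (norm w)\<^sup>2"
  unfolding norm2_sq inner2 wedge_def by (simp add: power2_eq_square algebra_simps)

lemma wedge_le: "\<bar>wedge v w\<bar> \<le> norm v * norm w"
proof -
  have "(wedge v w)\<^sup>2 \<le> (norm v * norm w)\<^sup>2"
    using wedge_sq[of v w] zero_le_power2[of "v \<bullet> w"] unfolding power_mult_distrib by linarith
  then show ?thesis using abs_le_square_iff[of "wedge v w" "norm v * norm w"] by simp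
qed

text \<open>The chord is controlled by the sine only up to a right angle, hence the sign condition.
  With c = v \<bullet> w the squared claim is 2 - 2 c <= 4 (1 - c^2), that is (1 - c) (2 + 4 c) >=
  0.\<close>

lemma norm_diff_le_wedge:
  assumes "norm v = 1" "norm w = 1" "0 \<le> v \<bullet> w"
  shows "norm (v - w) \<le> 2 * \<bar>wedge v w\<bar>"
proof -
  define c where "c = v \<bullet> w"
  have w: "(wedge v w)\<^sup>2 = 1 - c\<^sup>2" using wedge_sq[of v w] assms by (simp add: c_def)
  have c: "0 \<le> c" "c \<le> 1" using assms norm_cauchy_schwarz[of v w] by (auto simp: c_def)
  have "(norm (v - w))\<^sup>2 = 2 - 2 * c"
    using assms by (simp add: power2_norm_eq_inner inner_diff inner_commute c_def norm_eq_1)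
  also have "\<dots> \<le> 4 * (1 - c\<^sup>2)"
  proof -
    have "4 * (1 - c\<^sup>2) - (2 - 2 * c) = (1 - c) * (2 + 4 * c)" by (simp add: power2_eq_square algebra_simps)
    moreover have "0 \<le> (1 - c) * (2 + 4 * c)" using c by simp
    ultimately show ?thesis by simp
  qed
  also have "\<dots> = (2 * \<bar>wedge v w\<bar>)\<^sup>2" using w by (simp add: power_mult_distrib)
  finally show ?thesis by (rule power2_le_imp_le) simp
qed

text \<open>Apply ln x <= x - 1 to the quotient of the norms. One factor R bounds the numerator, the
  other the inverse of the denominator.\<close>

lemma ln_norm_diff_le_one_sided:
  fixes A :: "real^2^2"
  assumes R: "\<And>v. norm v / R \<le> norm (A *v v)" "\<And>v. norm (A *v v) \<le> R * norm v" "R > 0"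
    and v: "norm v = 1" "norm w = 1"
  shows "ln (norm (A *v v)) - ln (norm (A *v w)) \<le> R\<^sup>2 * norm (v - w)"
proof -
  have "1 / R \<le> norm (A *v v)" "1 / R \<le> norm (A *v w)" using R(1)[of v] R(1)[of w] v by auto
  then have p: "0 < norm (A *v v)" "0 < norm (A *v w)" using R(3)
    by (metis less_le_trans zero_less_divide_1_iff)+
  have "ln (norm (A *v v)) - ln (norm (A *v w)) = ln (norm (A *v v) / norm (A *v w))"
    using p by (simp add: ln_div)
  also have "\<dots> \<le> norm (A *v v) / norm (A *v w) - 1"
    using p by (intro ln_le_minus_one) simp
  also have "\<dots> = (norm (A *v v) - norm (A *v w)) / norm (A *v w)"
    using p by (simp add: diff_divide_distrib)
  also have "\<dots> \<le> (R * norm (v - w)) / norm (A *v w)"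
  proof (intro divide_right_mono)
    have "norm (A *v v) - norm (A *v w) \<le> norm (A *v v - A *v w)" by (rule norm_triangle_ineq2)
    also have "\<dots> = norm (A *v (v - w))" by (simp add: matrix_vector_mult_diff_distrib)
    also have "\<dots> \<le> R * norm (v - w)" by (rule R)
    finally show "norm (A *v v) - norm (A *v w) \<le> R * norm (v - w)" .
  qed simp
  also have "\<dots> \<le> (R * norm (v - w)) / (1 / R)"
    using R(3) p \<open>1 / R \<le> norm (A *v w)\<close> by (intro divide_left_mono mult_pos_pos) auto
  finally show ?thesis using R(3) by (simp add: power2_eq_square mult_ac)
qed

text \<open>The stretching by A depends only on the line spanned by a vector, so after normalising,
  w may be reflected to make an angle of at most a right angle with v. Then the Lipschitz bound in
  the direction and the bound of the chord by the sine apply. The power s/2 is the form in which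
  sines are integrated in \<open>angle_integral\<close>.\<close>

lemma ln_norm_diff_le:
  fixes A :: "real^2^2"
  assumes R: "\<And>v. norm v / R \<le> norm (A *v v)" "\<And>v. norm (A *v v) \<le> R * norm v" "R > 0"
    and v: "v \<noteq> 0" "w \<noteq> 0" and s: "0 < s" "s \<le> 2"
  shows "\<bar>(ln (norm (A *v v)) - ln (norm v)) - (ln (norm (A *v w)) - ln (norm w))\<bar>
    \<le> 2 * R\<^sup>2 * (\<bar>wedge v w\<bar> / (norm v * norm w)) powr (s/2)"
proof -
  define v' where "v' = v /\<^sub>R norm v"
  define \<sigma> :: real where "\<sigma> = (if 0 \<le> v' \<bullet> w then 1 else - 1)"
  define w' where "w' = (\<sigma> / norm w) *\<^sub>R w"
  have n: "norm v' = 1" "norm w' = 1" using v by (auto simp: v'_def w'_def \<sigma>_def)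
  have pos: "u \<noteq> 0 \<Longrightarrow> 0 < norm (A *v u)" for u
    using R(1)[of u] R(3) by (smt (verit) zero_less_norm_iff divide_pos_pos)
  have i: "0 \<le> v' \<bullet> w'" using v by (auto simp: w'_def \<sigma>_def divide_le_0_iff zero_le_divide_iff)
  have lv: "ln (norm (A *v v')) = ln (norm (A *v v)) - ln (norm v)"
    using v pos[of v] by (simp add: v'_def matrix_vector_mult_scaleR ln_mult ln_inverse)
  have "norm (A *v w') = norm (A *v w) / norm w"
    by (simp add: w'_def matrix_vector_mult_scaleR \<sigma>_def)
  then have lw: "ln (norm (A *v w')) = ln (norm (A *v w)) - ln (norm w)"
    using v pos[of w] by (simp add: ln_div)
  define t where "t = \<bar>wedge v w\<bar> / (norm v * norm w)"
  have t1: "t \<le> 1" "0 \<le> t" using wedge_le[of v w] v by (auto simp: t_def divide_le_eq)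
  have t: "\<bar>wedge v' w'\<bar> = t"
  proof -
    have "\<bar>wedge v' w'\<bar> = \<bar>inverse (norm v) * (\<sigma> / norm w) * wedge v w\<bar>"
      unfolding v'_def w'_def wedge_scaleR ..
    also have "\<dots> = inverse (norm v) * (\<bar>\<sigma>\<bar> / norm w) * \<bar>wedge v w\<bar>"
      by (simp only: abs_mult abs_divide abs_inverse abs_norm_cancel)
    also have "\<bar>\<sigma>\<bar> = 1" by (simp add: \<sigma>_def)
    finally show ?thesis by (simp add: t_def divide_simps)
  qed
  \<comment> \<open>As t <= 1, lowering the exponent from 1 to s/2 can only increase the value; this
    is where s <= 2 enters.\<close>
  have "t \<le> t powr (s/2)"
    using t1 s powr_mono'[of "s/2" 1 t] by (cases "t = 0") auto
  have "norm (v' - w') \<le> 2 * t" using norm_diff_le_wedge[OF n i] t by simp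
  also have "\<dots> \<le> 2 * t powr (s/2)" using \<open>t \<le> t powr (s/2)\<close> by simp
  finally have "R\<^sup>2 * norm (v' - w') \<le> R\<^sup>2 * (2 * t powr (s/2))" by (rule mult_left_mono) simp
  then show ?thesis
    using ln_norm_diff_le_one_sided[OF R n] ln_norm_diff_le_one_sided[OF R n(2,1)]
    unfolding lv lw t_def[symmetric] by (simp add: norm_minus_commute abs_le_iff)
qed

lemma onorm_le_columns:
  "onorm ((*v) (A::real^2^2)) \<le> norm (A *v axis 1 1) + norm (A *v axis 2 1)"
proof (rule onorm_bound)
  fix v :: "real^2"
  have "v = v $ 1 *\<^sub>R axis 1 1 + v $ 2 *\<^sub>R axis 2 1"
    by (simp add: vec_eq_iff forall_2 axis_def)
  then have "A *v v = v $ 1 *\<^sub>R (A *v axis 1 1) + v $ 2 *\<^sub>R (A *v axis 2 1)"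
    by (metis matrix_vector_mult_scaleR matrix_vector_right_distrib)
  then have "norm (A *v v) \<le> \<bar>v $ 1\<bar> * norm (A *v axis 1 1) + \<bar>v $ 2\<bar> * norm (A *v axis 2 1)"
    by (metis norm_scaleR norm_triangle_ineq)
  also have "\<dots> \<le> norm v * norm (A *v axis 1 1) + norm v * norm (A *v axis 2 1)"
    by (intro add_mono mult_right_mono component_le_norm_cart) auto
  finally show "norm (A *v v) \<le> (norm (A *v axis 1 1) + norm (A *v axis 2 1)) * norm v"
    by (simp add: algebra_simps)
qed simp

lemma norm_le_onorm: "norm ((A::real^2^2) *v v) \<le> onorm ((*v) A) * norm v"
  by (rule onorm[OF matrix_vector_mul_bounded_linear])

lemma borel_measurable_matrix_vector [measurable (raw)]:
  fixes A :: "'a \<Rightarrow> real^2^2" and v :: "'a \<Rightarrow> real^2"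
  assumes [measurable]: "A \<in> borel_measurable M" "v \<in> borel_measurable M"
  shows "(\<lambda>x. A x *v v x) \<in> borel_measurable M"
proof -
  have "continuous_on UNIV (\<lambda>p :: (real^2^2) \<times> (real^2). fst p *v snd p)"
    unfolding matrix_vector_mult_def by (intro continuous_intros)
  then have "(\<lambda>p :: (real^2^2) \<times> (real^2). fst p *v snd p) \<in> borel_measurable borel"
    by (rule borel_measurable_continuous_onI)
  from measurable_compose[OF _ this, of "\<lambda>x. (A x, v x)" M] show ?thesis
    by (simp add: borel_prod[symmetric])
qed

lemma borel_measurable_matrix_mult [measurable (raw)]:
  fixes A B :: "'a \<Rightarrow> real^2^2"
  assumes [measurable]: "A \<in> borel_measurable M" "B \<in> borel_measurable M"
  shows "(\<lambda>x. A x ** B x) \<in> borel_measurable M"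
proof -
  have "continuous_on UNIV (\<lambda>p :: (real^2^2) \<times> (real^2^2). fst p ** snd p)"
    unfolding matrix_matrix_mult_def by (intro continuous_intros)
  then have "(\<lambda>p :: (real^2^2) \<times> (real^2^2). fst p ** snd p) \<in> borel_measurable borel"
    by (rule borel_measurable_continuous_onI)
  from measurable_compose[OF _ this, of "\<lambda>x. (A x, B x)" M] show ?thesis
    by (simp add: borel_prod[symmetric])
qed

lemma onorm_diff_le: "onorm ((*v) (A::real^2^2)) - onorm ((*v) B) \<le> 2 * norm (A - B)"
proof -
  have "onorm ((*v) A) = onorm (\<lambda>v. (A - B) *v v + B *v v)"
    by (simp add: matrix_vector_mult_diff_rdistrib)
  also have "\<dots> \<le> onorm ((*v) (A - B)) + onorm ((*v) B)"
    by (rule onorm_triangle) simp_all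
  also have "onorm ((*v) (A - B)) \<le> norm (A - B) * 2" by (rule onorm_matrix_le_norm)
  finally show ?thesis by simp
qed

lemma continuous_on_onorm: "continuous_on S (\<lambda>A::real^2^2. onorm ((*v) A))"
proof (rule continuous_onI)
  fix A :: "real^2^2" and e :: real assume "e > 0"
  moreover have "dist (onorm ((*v) B)) (onorm ((*v) A)) \<le> 2 * dist B A" for B :: "real^2^2"
    using onorm_diff_le[of A B] onorm_diff_le[of B A]
    by (simp add: dist_real_def dist_norm norm_minus_commute abs_le_iff)
  ultimately show "\<exists>d>0. \<forall>B\<in>S. dist B A < d \<longrightarrow> dist (onorm ((*v) B)) (onorm ((*v) A)) \<le> e"
    by (intro exI[of _ "e/2"]) (smt (verit) field_sum_of_halves half_gt_zero)
qed

lemma borel_measurable_onorm [measurable (raw)]: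
  fixes A :: "'a \<Rightarrow> real^2^2"
  assumes "A \<in> borel_measurable M"
  shows "(\<lambda>x. onorm ((*v) (A x))) \<in> borel_measurable M"
  using measurable_compose[OF assms borel_measurable_continuous_onI[OF continuous_on_onorm]] .

text \<open>The intended A y is the inverse of the derivative of Q at y, which carries tangent
  vectors at Q y back to y; \<open>moment\<close> is then the integrated bound for inverse branches.
  The product sg * b powr (s/2) is the mean contraction factor for sines raised to the power s/2,
  with sg coming from the moments and b from the determinants.\<close>

locale contracting_cocycle = mpt M Q for M :: "'a measure" and Q +
  fixes A :: "'a \<Rightarrow> real^2^2" and R s sg b :: real
  assumes A_measurable [measurable]: "A \<in> borel_measurable M"
    and R: "\<And>x v. x \<in> space M \<Longrightarrow> norm v / R \<le> norm (A x *v v)"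
      "\<And>x v. x \<in> space M \<Longrightarrow> norm (A x *v v) \<le> R * norm v" "R \<ge> 1"
    and s: "0 < s" "s \<le> 2"
    and sg: "0 \<le> sg" and b: "0 < b" "\<And>x. x \<in> space M \<Longrightarrow> \<bar>det (A x)\<bar> \<le> b"
    and rho: "sg * b powr (s/2) < 1"
    and moment: "\<And>\<xi>. \<xi> \<in> borel_measurable M \<Longrightarrow> (\<And>x. x \<in> space M \<Longrightarrow> \<xi> x \<noteq> 0) \<Longrightarrow>
      (\<integral>\<^sup>+y. ennreal (norm (A y *v \<xi> (Q y)) powr - s) \<partial>M) \<le> ennreal sg * (\<integral>\<^sup>+x. ennreal (norm (\<xi> x) powr - s) \<partial>M)"
begin

definition \<rho> where "\<rho> = sg * b powr (s/2)"

primrec B :: "nat \<Rightarrow> 'a \<Rightarrow> real^2^2" where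
  "B 0 y = mat 1"
| "B (Suc k) y = A y ** B k (Q y)"

text \<open>The pullback of the vector field v along k steps of Q.\<close>

definition V :: "('a \<Rightarrow> real^2) \<Rightarrow> nat \<Rightarrow> 'a \<Rightarrow> real^2" where
  "V v k y = B k y *v v ((Q ^^ k) y)"

lemma B_measurable [measurable]: "B k \<in> borel_measurable M"
proof (induction k)
  case (Suc k)
  then have [measurable]: "(\<lambda>y. B k (Q y)) \<in> borel_measurable M"
    by (rule measurable_compose[OF T_measurable])
  show ?case by simp measurable
qed simp

lemma V_measurable [measurable]: "v \<in> borel_measurable M \<Longrightarrow> V v k \<in> borel_measurable M"
  unfolding V_def using measurable_compose[OF iter_measurable[of k], of v borel] by measurable

lemma V_Suc: "V v (Suc k) y = A y *v V v k (Q y)"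
  unfolding V_def by (simp add: funpow_swap1 matrix_vector_mul_assoc)

lemma B_add: "B (j + k) y = B j y ** B k ((Q ^^ j) y)"
  by (induction j arbitrary: y) (simp_all add: matrix_mul_assoc funpow_swap1)

lemma Q_space: "x \<in> space M \<Longrightarrow> Q x \<in> space M"
  using iter_space[of x 1] by simp

lemma V_bounds:
  assumes "\<And>x. x \<in> space M \<Longrightarrow> norm (v x) = 1" "y \<in> space M"
  shows "1 / R ^ k \<le> norm (V v k y) \<and> norm (V v k y) \<le> R ^ k"
  using assms(2)
proof (induction k arbitrary: y)
  case 0 then show ?case using assms(1) by (simp add: V_def)
next
  case (Suc k)
  have IH: "1 / R ^ k \<le> norm (V v k (Q y))" "norm (V v k (Q y)) \<le> R ^ k"
    using Suc Q_space by auto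
  have "1 / R ^ k / R \<le> norm (V v k (Q y)) / R" using IH R(3) by (intro divide_right_mono) auto
  also have "\<dots> \<le> norm (A y *v V v k (Q y))" by (rule R(1)[OF Suc.prems])
  finally have 1: "1 / R ^ Suc k \<le> norm (V v (Suc k) y)" by (simp add: V_Suc mult.commute)
  have "norm (A y *v V v k (Q y)) \<le> R * norm (V v k (Q y))" by (rule R(2)[OF Suc.prems])
  also have "\<dots> \<le> R * R ^ k" using IH R(3) by (intro mult_left_mono) auto
  finally show ?case using 1 by (simp add: V_Suc)
qed

lemma V_nz:
  assumes "\<And>x. x \<in> space M \<Longrightarrow> norm (v x) = 1" "y \<in> space M"
  shows "V v k y \<noteq> 0"
proof -
  have "0 < 1 / R ^ k" using R(3) by simp
  then show ?thesis using V_bounds[of v y k, OF assms] by auto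
qed

text \<open>Each factor sg is one use of \<open>moment\<close>, with the field pulled back so far in
  the role of \<xi>. This is why \<open>moment\<close> has to admit fields that are not of unit
  length.\<close>

lemma V_moment:
  assumes [measurable]: "v \<in> borel_measurable M" and v: "\<And>x. x \<in> space M \<Longrightarrow> norm (v x) = 1"
  shows "(\<integral>\<^sup>+y. ennreal (norm (V v k y) powr - s) \<partial>M) \<le> ennreal (sg ^ k)"
proof (induction k)
  case 0
  have "(\<integral>\<^sup>+y. ennreal (norm (V v 0 y) powr - s) \<partial>M) = (\<integral>\<^sup>+y. 1 \<partial>M)"
    by (intro nn_integral_cong) (simp add: V_def v)
  then show ?case using emeasure_space_1 by simp
next
  case (Suc k)
  have "(\<integral>\<^sup>+y. ennreal (norm (V v (Suc k) y) powr - s) \<partial>M)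
      \<le> ennreal sg * (\<integral>\<^sup>+y. ennreal (norm (V v k y) powr - s) \<partial>M)"
    unfolding V_Suc using V_nz[of v, OF v] by (intro moment) auto
  also have "\<dots> \<le> ennreal sg * ennreal (sg ^ k)" by (intro mult_left_mono Suc) simp
  finally show ?case using sg by (simp add: ennreal_mult)
qed

lemma V_wedge:
  assumes v: "\<And>x. x \<in> space M \<Longrightarrow> norm (v x) = 1" "\<And>x. x \<in> space M \<Longrightarrow> norm (w x) = 1"
    and y: "y \<in> space M"
  shows "\<bar>wedge (V v k y) (V w k y)\<bar> \<le> b ^ k"
  using y
proof (induction k arbitrary: y)
  case 0
  then show ?case using wedge_le[of "v y" "w y"] v by (simp add: V_def)
next
  case (Suc k)
  have "\<bar>wedge (V v (Suc k) y) (V w (Suc k) y)\<bar> = \<bar>det (A y)\<bar> * \<bar>wedge (V v k (Q y)) (V w k (Q y))\<bar>"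
    by (simp add: V_Suc wedge_mult abs_mult)
  also have "\<dots> \<le> b * b ^ k"
    using Suc b Q_space by (intro mult_mono) auto
  finally show ?case by simp
qed

definition angle :: "('a \<Rightarrow> real^2) \<Rightarrow> ('a \<Rightarrow> real^2) \<Rightarrow> nat \<Rightarrow> 'a \<Rightarrow> real" where
  "angle v w k y = (\<bar>wedge (V v k y) (V w k y)\<bar> / (norm (V v k y) * norm (V w k y))) powr (s/2)"

lemma angle_measurable [measurable]:
  assumes [measurable]: "v \<in> borel_measurable M" "w \<in> borel_measurable M"
  shows "angle v w k \<in> borel_measurable M"
proof -
  have [measurable]: "(\<lambda>y. V v k y $ i) \<in> borel_measurable M" "(\<lambda>y. V w k y $ i) \<in> borel_measurable M" for i
    by (rule measurable_compose[OF _ borel_measurable_continuous_onI[OF continuous_on_component[OF continuous_on_id]]]; measurable)+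
  show ?thesis unfolding angle_def[abs_def] wedge_def by measurable
qed

text \<open>The area spanned by the two pullbacks is at most b^k, so the angle function is at most
  b^(k s/2) times the product of the two norms raised to the power - s/2. That product is at most
  the mean of the squares of its factors, which are integrands of moments of order s.\<close>

lemma angle_integral:
  assumes [measurable]: "v \<in> borel_measurable M" "w \<in> borel_measurable M"
    and v: "\<And>x. x \<in> space M \<Longrightarrow> norm (v x) = 1" "\<And>x. x \<in> space M \<Longrightarrow> norm (w x) = 1"
  shows "(\<integral>\<^sup>+y. ennreal (angle v w k y) \<partial>M) \<le> ennreal (\<rho> ^ k)"
proof -
  define c where "c = (b ^ k) powr (s/2)"
  have c: "c \<ge> 0" by (simp add: c_def)
  have "(\<integral>\<^sup>+y. ennreal (angle v w k y) \<partial>M)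
     \<le> (\<integral>\<^sup>+y. ennreal (c/2) * (ennreal (norm (V v k y) powr - s) + ennreal (norm (V w k y) powr - s)) \<partial>M)"
  proof (rule nn_integral_mono)
    fix y assume y: "y \<in> space M"
    define p where "p = norm (V v k y) powr - (s/2)"
    define q where "q = norm (V w k y) powr - (s/2)"
    have pos: "0 < norm (V v k y)" "0 < norm (V w k y)" using V_nz[of v y k, OF v(1) y] V_nz[of w y k, OF v(2) y] by auto
    have "angle v w k y \<le> (b ^ k / (norm (V v k y) * norm (V w k y))) powr (s/2)"
      unfolding angle_def using V_wedge[of v w y k, OF v y] s by (intro powr_mono2 divide_right_mono) auto
    also have "\<dots> = c * (p * q)"
      using pos b by (simp add: c_def p_def q_def powr_divide powr_mult powr_minus divide_simps)
    also have "\<dots> \<le> c * ((p\<^sup>2 + q\<^sup>2) / 2)"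
    proof (intro mult_left_mono c)
      show "p * q \<le> (p\<^sup>2 + q\<^sup>2) / 2" using sum_squares_bound[of p q] by simp
    qed
    also have "p\<^sup>2 = norm (V v k y) powr - s" by (simp add: p_def power2_eq_square powr_add[symmetric])
    also have "q\<^sup>2 = norm (V w k y) powr - s" by (simp add: q_def power2_eq_square powr_add[symmetric])
    finally have "ennreal (angle v w k y)
       \<le> ennreal (c * ((norm (V v k y) powr - s + norm (V w k y) powr - s) / 2))" by (rule ennreal_leI)
    also have "\<dots> = ennreal (c/2) * (ennreal (norm (V v k y) powr - s) + ennreal (norm (V w k y) powr - s))"
      using c by (simp add: ennreal_mult[symmetric] flip: ennreal_plus)
    finally show "ennreal (angle v w k y)
       \<le> ennreal (c/2) * (ennreal (norm (V v k y) powr - s) + ennreal (norm (V w k y) powr - s))" .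
  qed
  also have "\<dots> = ennreal (c/2) * ((\<integral>\<^sup>+y. ennreal (norm (V v k y) powr - s) \<partial>M)
       + (\<integral>\<^sup>+y. ennreal (norm (V w k y) powr - s) \<partial>M))"
    by (simp add: nn_integral_cmult nn_integral_add)
  also have "\<dots> \<le> ennreal (c/2) * (ennreal (sg ^ k) + ennreal (sg ^ k))"
    using v by (intro mult_left_mono add_mono V_moment) auto
  also have "\<dots> = ennreal (c * sg ^ k)"
    using sg c by (simp add: ennreal_mult[symmetric] flip: ennreal_plus)
  also have "c * sg ^ k = \<rho> ^ k"
    using b by (simp add: c_def \<rho>_def power_mult_distrib powr_power mult.commute flip: powr_realpow powr_powr)
      (simp add: powr_powr mult.commute)
  finally show ?thesis .
qed

lemma \<rho>_bounds: "0 \<le> \<rho>" "\<rho> < 1"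
  using sg rho by (auto simp: \<rho>_def)

text \<open>The sum of the geometric series of errors 2 R^2 \<rho>^i: a bound for the influence of
  the initial field that does not grow with the number of steps.\<close>

definition K1 where "K1 = 2 * R\<^sup>2 / (1 - \<rho>)"

text \<open>By \<open>ln_norm_diff_le\<close>, pulling back once more changes the difference of the
  logarithms by at most 2 R^2 times the angle reached after k steps. These quantities are evaluated
  at Q y instead of y, which the invariance of the measure makes immaterial.\<close>

lemma nn_integral_ln_diff:
  assumes [measurable]: "v \<in> borel_measurable M" "w \<in> borel_measurable M"
    and v: "\<And>x. x \<in> space M \<Longrightarrow> norm (v x) = 1" "\<And>x. x \<in> space M \<Longrightarrow> norm (w x) = 1"
  shows "(\<integral>\<^sup>+y. ennreal \<bar>ln (norm (V v k y)) - ln (norm (V w k y))\<bar> \<partial>M)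
    \<le> ennreal (2 * R\<^sup>2 * (\<Sum>i<k. \<rho> ^ i))"
proof (induction k)
  case 0
  have "(\<integral>\<^sup>+y. ennreal \<bar>ln (norm (V v 0 y)) - ln (norm (V w 0 y))\<bar> \<partial>M) = (\<integral>\<^sup>+y. 0 \<partial>M)"
    by (intro nn_integral_cong) (simp add: V_def v)
  then show ?case by simp
next
  case (Suc k)
  define D where "D y = ennreal \<bar>ln (norm (V v k y)) - ln (norm (V w k y))\<bar>" for y
  define E where "E y = ennreal (2 * R\<^sup>2) * ennreal (angle v w k y)" for y
  have [measurable]: "D \<in> borel_measurable M" "E \<in> borel_measurable M"
    unfolding D_def[abs_def] E_def[abs_def] by measurable
  have "(\<integral>\<^sup>+y. ennreal \<bar>ln (norm (V v (Suc k) y)) - ln (norm (V w (Suc k) y))\<bar> \<partial>M)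
     \<le> (\<integral>\<^sup>+y. D (Q y) + E (Q y) \<partial>M)"
  proof (rule nn_integral_mono)
    fix y assume y: "y \<in> space M"
    have "\<bar>ln (norm (V v (Suc k) y)) - ln (norm (V w (Suc k) y))\<bar>
      \<le> \<bar>ln (norm (V v k (Q y))) - ln (norm (V w k (Q y)))\<bar> + 2 * R\<^sup>2 * angle v w k (Q y)"
      using ln_norm_diff_le[OF R(1)[OF y] R(2)[OF y] _ V_nz[of v "Q y" k, OF v(1) Q_space[OF y]]
          V_nz[of w "Q y" k, OF v(2) Q_space[OF y]] s] R(3)
      unfolding V_Suc angle_def by linarith
    then have "ennreal \<bar>ln (norm (V v (Suc k) y)) - ln (norm (V w (Suc k) y))\<bar>
       \<le> ennreal (\<bar>ln (norm (V v k (Q y))) - ln (norm (V w k (Q y)))\<bar> + 2 * R\<^sup>2 * angle v w k (Q y))"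
      by (rule ennreal_leI)
    also have "\<dots> = D (Q y) + E (Q y)"
      by (simp add: D_def E_def angle_def ennreal_mult[symmetric] flip: ennreal_plus)
    finally show "ennreal \<bar>ln (norm (V v (Suc k) y)) - ln (norm (V w (Suc k) y))\<bar> \<le> D (Q y) + E (Q y)" .
  qed
  also have "\<dots> = (\<integral>\<^sup>+y. D y \<partial>M) + (\<integral>\<^sup>+y. E y \<partial>M)"
    using nn_integral_iter[of "\<lambda>y. D y + E y" 1] by (simp add: nn_integral_add)
  also have "\<dots> \<le> ennreal (2 * R\<^sup>2 * (\<Sum>i<k. \<rho> ^ i)) + ennreal (2 * R\<^sup>2) * ennreal (\<rho> ^ k)"
    unfolding E_def using Suc v by (intro add_mono) (auto simp: D_def nn_integral_cmult intro!: mult_left_mono angle_integral)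
  also have "\<dots> = ennreal (2 * R\<^sup>2 * (\<Sum>i<Suc k. \<rho> ^ i))"
    using \<rho>_bounds by (simp add: ennreal_mult[symmetric] sum_nonneg distrib_left flip: ennreal_plus)
  finally show ?case .
qed

lemma ln_V_bound:
  assumes "\<And>x. x \<in> space M \<Longrightarrow> norm (v x) = 1" "y \<in> space M"
  shows "\<bar>ln (norm (V v k y))\<bar> \<le> k * ln R"
proof -
  have p: "0 < R ^ k" using R(3) by simp
  have "ln (1 / R ^ k) \<le> ln (norm (V v k y))" "ln (norm (V v k y)) \<le> ln (R ^ k)"
    using V_bounds[of v y k, OF assms] p V_nz[of v y k, OF assms] by auto
  moreover have "ln (R ^ k) = k * ln R" using R(3) by (simp add: ln_realpow)
  moreover have "ln (1 / R ^ k) = - ln (R ^ k)" using R(3) p by (simp add: ln_div)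
  ultimately show ?thesis unfolding abs_le_iff by linarith
qed

lemma integral_ln_diff:
  assumes [measurable]: "v \<in> borel_measurable M" "w \<in> borel_measurable M"
    and v: "\<And>x. x \<in> space M \<Longrightarrow> norm (v x) = 1" "\<And>x. x \<in> space M \<Longrightarrow> norm (w x) = 1"
  shows "(\<integral>y. \<bar>ln (norm (V v k y)) - ln (norm (V w k y))\<bar> \<partial>M) \<le> K1"
proof -
  have "ennreal (\<integral>y. \<bar>ln (norm (V v k y)) - ln (norm (V w k y))\<bar> \<partial>M)
    = (\<integral>\<^sup>+y. ennreal \<bar>ln (norm (V v k y)) - ln (norm (V w k y))\<bar> \<partial>M)"
  proof (rule nn_integral_eq_integral[symmetric])
    show "integrable M (\<lambda>y. \<bar>ln (norm (V v k y)) - ln (norm (V w k y))\<bar>)"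
    proof (rule integrable_bounded[where B = "2 * (k * ln R)"])
      fix y assume "y \<in> space M"
      then show "\<bar>\<bar>ln (norm (V v k y)) - ln (norm (V w k y))\<bar>\<bar> \<le> 2 * (k * ln R)"
        using ln_V_bound[of v y k, OF v(1)] ln_V_bound[of w y k, OF v(2)] by linarith
    qed measurable
  qed simp
  also have "\<dots> \<le> ennreal (2 * R\<^sup>2 * (\<Sum>i<k. \<rho> ^ i))"
    by (rule nn_integral_ln_diff) (use v in auto)
  also have "\<dots> \<le> ennreal K1"
  proof -
    have "(\<Sum>i<k. \<rho> ^ i) = (1 - \<rho> ^ k) / (1 - \<rho>)" using \<rho>_bounds sum_gp_strict[of \<rho> k] by simp
    also have "\<dots> \<le> 1 / (1 - \<rho>)" using \<rho>_bounds by (intro divide_right_mono) auto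
    finally have "2 * R\<^sup>2 * (\<Sum>i<k. \<rho> ^ i) \<le> 2 * R\<^sup>2 * (1 / (1 - \<rho>))" by (rule mult_left_mono) simp
    then show ?thesis by (intro ennreal_leI) (simp add: K1_def)
  qed
  finally show ?thesis using \<rho>_bounds by (subst (asm) ennreal_le_iff) (auto simp: K1_def)
qed

definition L where "L k y = ln (onorm ((*v) (B k y)))"

definition \<beta> where "\<beta> k = (\<integral>y. L k y \<partial>M)"

lemma L_measurable [measurable]: "L k \<in> borel_measurable M"
  unfolding L_def[abs_def] by measurable

lemma L_ge:
  assumes "y \<in> space M" "u \<noteq> 0"
  shows "B k y *v u \<noteq> 0" "ln (norm (B k y *v u)) \<le> L k y + ln (norm u)" "0 < onorm ((*v) (B k y))"
proof -
  have "V (\<lambda>_. u /\<^sub>R norm u) k y \<noteq> 0"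
    by (rule V_nz) (use assms in simp_all)
  then have "inverse (norm u) *\<^sub>R (B k y *v u) \<noteq> 0" by (simp only: V_def matrix_vector_mult_scaleR not_False_eq_True)
  then show nz: "B k y *v u \<noteq> 0" by (metis scaleR_zero_right)
  have le: "norm (B k y *v u) \<le> onorm ((*v) (B k y)) * norm u" by (rule norm_le_onorm)
  have "0 < norm (B k y *v u)" using nz by simp
  also note le
  finally show pos: "0 < onorm ((*v) (B k y))"
    using assms(2) by (simp add: zero_less_mult_iff)
  have "ln (norm (B k y *v u)) \<le> ln (onorm ((*v) (B k y)) * norm u)"
    using nz by (intro ln_mono le) auto
  then show "ln (norm (B k y *v u)) \<le> L k y + ln (norm u)"
    using pos assms by (simp add: L_def ln_mult)
qed

text \<open>The operator norm is at most twice the larger column norm. The reference value r is free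
  because it will be the length of the pullback of another field, with which both columns are
  compared.\<close>

lemma L_le:
  assumes y: "y \<in> space M"
  shows "L k y \<le> ln 2 + ln r + \<bar>ln (norm (B k y *v axis 1 1)) - ln r\<bar> + \<bar>ln (norm (B k y *v axis 2 1)) - ln r\<bar>"
proof -
  define p where "p = norm (B k y *v axis 1 1)"
  define q where "q = norm (B k y *v axis 2 1)"
  have "B k y *v axis 1 1 \<noteq> 0" "B k y *v axis 2 1 \<noteq> 0"
    by (auto intro!: L_ge(1)[OF y, simplified] simp: axis_eq_0_iff)
  then have pq: "p > 0" "q > 0" by (auto simp: p_def q_def)
  have "onorm ((*v) (B k y)) \<le> 2 * max p q" using onorm_le_columns[of "B k y"] by (auto simp: p_def q_def)
  then have "L k y \<le> ln (2 * max p q)"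
    unfolding L_def using L_ge(3)[OF y, of "axis 1 1"] by (intro ln_mono) (auto simp: axis_eq_0_iff)
  also have "\<dots> = ln 2 + max (ln p) (ln q)" using pq by (subst ln_mult) (auto simp: max_def)
  finally show ?thesis unfolding p_def[symmetric] q_def[symmetric] by linarith
qed

lemma L_bound:
  assumes y: "y \<in> space M"
  shows "\<bar>L k y\<bar> \<le> ln 2 + 2 * k * ln R"
proof -
  have l: "\<bar>ln (norm (B k y *v axis i 1))\<bar> \<le> k * ln R" for i
    using ln_V_bound[of "\<lambda>_. axis i 1" y k] y by (simp add: V_def norm_axis_1)
  have "- (k * ln R) \<le> L k y"
    using L_ge(2)[OF y, of "axis 1 1" k] l[of 1] by (simp add: axis_eq_0_iff norm_axis_1)
  moreover have "L k y \<le> ln 2 + 2 * k * ln R"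
    using L_le[OF y, of k 1] l[of 1] l[of 2] by simp
  moreover have "0 \<le> k * ln R" "0 \<le> ln (2::real)" using R(3) by auto
  ultimately show ?thesis by linarith
qed

lemma L_integrable: "integrable M (L k)"
  by (rule integrable_bounded[OF _ L_bound]) simp_all

text \<open>Any unit field is stretched in the mean as much as the operator norm allows, up to a
  constant: the operator norm is detected by the two constant fields along the axes, and the
  logarithmic stretching of each differs from that of v by at most K1 in the mean.\<close>

lemma integral_ln_V_ge:
  assumes [measurable]: "v \<in> borel_measurable M" and v: "\<And>x. x \<in> space M \<Longrightarrow> norm (v x) = 1"
  shows "\<beta> k - (ln 2 + 2 * K1) \<le> (\<integral>y. ln (norm (V v k y)) \<partial>M)"
proof -
  define d where "d i y = \<bar>ln (norm (V (\<lambda>_. axis i 1) k y)) - ln (norm (V v k y))\<bar>" for i y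
  have di: "integrable M (d i)" for i
  proof (rule integrable_bounded[where B = "2 * (k * ln R)"])
    show "d i \<in> borel_measurable M" unfolding d_def[abs_def] by measurable
    show "\<bar>d i y\<bar> \<le> 2 * (k * ln R)" if "y \<in> space M" for y
      using ln_V_bound[of v y k, OF v that] ln_V_bound[of "\<lambda>_. axis i 1" y k, OF _ that]
      unfolding d_def by (simp add: norm_axis_1)
  qed
  have vi: "integrable M (\<lambda>y. ln (norm (V v k y)))"
    by (rule integrable_bounded[OF _ ln_V_bound[of v, OF v]]) measurable
  have "\<beta> k \<le> (\<integral>y. ln 2 + ln (norm (V v k y)) + d 1 y + d 2 y \<partial>M)"
    unfolding \<beta>_def using L_le[of _ k "norm (V v k _)"]
    by (intro integral_mono L_integrable Bochner_Integration.integrable_add di vi) (auto simp: d_def V_def)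
  also have "\<dots> = ln 2 + (\<integral>y. ln (norm (V v k y)) \<partial>M) + (\<integral>y. d 1 y \<partial>M) + (\<integral>y. d 2 y \<partial>M)"
    using di vi by (simp add: prob_space)
  also have "\<dots> \<le> ln 2 + (\<integral>y. ln (norm (V v k y)) \<partial>M) + K1 + K1"
    using v unfolding d_def by (intro add_mono integral_ln_diff order_refl) (auto simp: norm_axis_1)
  finally show ?thesis by simp
qed

text \<open>The inner block turns the first axis into the field u, and the outer block acts on the
  direction v of u, so the logarithms add up exactly. Both summands are bounded below by
  \<open>integral_ln_V_ge\<close>, which is needed for a general field because v varies with the
  point.\<close>

theorem \<beta>_superadditive: "\<beta> j + \<beta> k - 2 * (ln 2 + 2 * K1) \<le> \<beta> (j + k)"
proof -
  define u where "u = V (\<lambda>_. axis 1 1) k"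
  define v where "v x = u x /\<^sub>R norm (u x)" for x
  have [measurable]: "u \<in> borel_measurable M" "v \<in> borel_measurable M"
    unfolding u_def v_def[abs_def] by measurable
  have u: "u x \<noteq> 0" if "x \<in> space M" for x
    unfolding u_def using that by (intro V_nz) (auto simp: norm_axis_1)
  have v: "norm (v x) = 1" if "x \<in> space M" for x using u[OF that] by (simp add: v_def)
  have ui: "integrable M (\<lambda>y. ln (norm (u y)))"
    unfolding u_def by (rule integrable_bounded[OF _ ln_V_bound]) (auto simp: norm_axis_1)
  then have ui': "integrable M (\<lambda>y. ln (norm (u ((Q ^^ j) y))))"
    using integrable_distr[OF iter_measurable[of j], of "\<lambda>y. ln (norm (u y))"] iter_invariant[of j] by simp
  have vi: "integrable M (\<lambda>y. ln (norm (V v j y)))"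
    by (rule integrable_bounded[OF _ ln_V_bound[of v, OF v]]) measurable
  have "(\<beta> j - (ln 2 + 2 * K1)) + (\<beta> k - (ln 2 + 2 * K1))
      \<le> (\<integral>y. ln (norm (V v j y)) \<partial>M) + (\<integral>y. ln (norm (u y)) \<partial>M)"
    unfolding u_def using v by (intro add_mono integral_ln_V_ge) (auto simp: norm_axis_1)
  also have "(\<integral>y. ln (norm (u y)) \<partial>M) = (\<integral>y. ln (norm (u ((Q ^^ j) y))) \<partial>M)"
    using integral_iter[of "\<lambda>y. ln (norm (u y))" j] by simp
  also have "(\<integral>y. ln (norm (V v j y)) \<partial>M) + \<dots> = (\<integral>y. ln (norm (V v j y)) + ln (norm (u ((Q ^^ j) y))) \<partial>M)"
    using vi ui' by simp
  also have "\<dots> \<le> \<beta> (j + k)"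
    unfolding \<beta>_def
  proof (intro integral_mono L_integrable Bochner_Integration.integrable_add vi ui')
    fix y assume y: "y \<in> space M"
    have uy: "u ((Q ^^ j) y) \<noteq> 0" by (rule u[OF iter_space[OF y]])
    have "B (j + k) y *v axis 1 1 = B j y *v u ((Q ^^ j) y)"
      by (simp add: u_def V_def B_add matrix_vector_mul_assoc)
    also have "\<dots> = norm (u ((Q ^^ j) y)) *\<^sub>R V v j y"
      using uy by (simp add: V_def v_def matrix_vector_mult_scaleR[symmetric])
    finally have "norm (B (j + k) y *v axis 1 1) = norm (u ((Q ^^ j) y)) * norm (V v j y)" by simp
    moreover have "ln (norm (B (j + k) y *v axis 1 1)) \<le> L (j + k) y"
      using L_ge(2)[OF y, of "axis 1 1" "j + k"] by (simp add: axis_eq_0_iff norm_axis_1)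
    ultimately show "ln (norm (V v j y)) + ln (norm (u ((Q ^^ j) y))) \<le> L (j + k) y"
      using uy V_nz[of v y j, OF v y] by (simp add: ln_mult)
  qed
  finally show ?thesis by simp
qed

theorem \<beta>_subadditive: "\<beta> (j + k) \<le> \<beta> j + \<beta> k"
proof -
  have i: "integrable M (\<lambda>y. L k ((Q ^^ j) y))"
    using integrable_distr[OF iter_measurable[of j], of "L k"] iter_invariant[of j] L_integrable by simp
  have "\<beta> (j + k) \<le> (\<integral>y. L j y + L k ((Q ^^ j) y) \<partial>M)"
    unfolding \<beta>_def
  proof (intro integral_mono L_integrable Bochner_Integration.integrable_add i)
    fix y assume y: "y \<in> space M"
    have "onorm ((*v) (B (j + k) y)) = onorm ((*v) (B j y) \<circ> (*v) (B k ((Q ^^ j) y)))"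
      by (simp add: B_add o_def matrix_vector_mul_assoc)
    also have "\<dots> \<le> onorm ((*v) (B j y)) * onorm ((*v) (B k ((Q ^^ j) y)))"
      by (rule onorm_compose) simp_all
    finally have "L (j + k) y \<le> ln (onorm ((*v) (B j y)) * onorm ((*v) (B k ((Q ^^ j) y))))"
      unfolding L_def using L_ge(3)[OF y, of "axis 1 1"] by (intro ln_mono) (auto simp: axis_eq_0_iff)
    also have "\<dots> = L j y + L k ((Q ^^ j) y)"
      using L_ge(3)[OF y, of "axis 1 1" j] L_ge(3)[OF iter_space[OF y], of "axis 1 1" k j]
      by (simp add: L_def ln_mult axis_eq_0_iff)
    finally show "L (j + k) y \<le> L j y + L k ((Q ^^ j) y)" .
  qed
  also have "\<dots> = \<beta> j + \<beta> k"
    using L_integrable i integral_iter[of "L k" j] by (simp add: \<beta>_def)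
  finally show ?thesis .
qed

end

section \<open>The covering of the torus by the plane\<close>

definition int_lattice :: "(real^2) set" where "int_lattice = {m. \<forall>i. m $ i \<in> \<int>}"

lemma countable_int_lattice: "countable int_lattice"
proof -
  have "int_lattice \<subseteq> (\<lambda>(a, b). vector [real_of_int a, real_of_int b]) ` UNIV"
  proof
    fix m :: "real^2" assume "m \<in> int_lattice"
    then have "m $ 1 \<in> \<int>" "m $ 2 \<in> \<int>" by (auto simp: int_lattice_def)
    then obtain a b where "m $ 1 = real_of_int a" "m $ 2 = real_of_int b" by (auto elim!: Ints_cases)
    then have "m = (\<lambda>(a, b). vector [real_of_int a, real_of_int b]) (a, b)"
      by (simp add: vec_eq_iff forall_2)
    then show "m \<in> (\<lambda>(a, b). vector [real_of_int a, real_of_int b]) ` UNIV" by blast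
  qed
  then show ?thesis by (rule countable_subset) simp
qed

lemma tproj_eq_int_lattice: "tproj p = tproj q \<longleftrightarrow> p - q \<in> int_lattice"
  by (simp add: tproj_eq_iff int_lattice_def)

lemma int_lattice_uminus: "m \<in> int_lattice \<Longrightarrow> - m \<in> int_lattice"
  by (auto simp: int_lattice_def)

lemma tproj_int_lattice: "m \<in> int_lattice \<Longrightarrow> tproj (q + m) = tproj q"
  by (simp add: tproj_eq_int_lattice)

text \<open>Unfolding over the lattice and folding back shows that all fundamental domains see the same
  integral.\<close>

lemma nn_integral_fundamental_domain:
  fixes k :: "real^2 \<Rightarrow> ennreal"
  assumes [measurable]: "k \<in> borel_measurable borel" "D \<in> sets borel" "D' \<in> sets borel"
    and per: "\<And>q m. m \<in> int_lattice \<Longrightarrow> k (q + m) = k q"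
    and D: "\<And>q. \<exists>!m. m \<in> int_lattice \<and> q + m \<in> D" and D': "\<And>q. \<exists>!m. m \<in> int_lattice \<and> q + m \<in> D'"
  shows "(\<integral>\<^sup>+q. k q * indicator D q \<partial>lborel) = (\<integral>\<^sup>+q. k q * indicator D' q \<partial>lborel)"
proof -
  have one: "(\<integral>\<^sup>+m. indicator E (q + m) \<partial>count_space int_lattice) = (1::ennreal)"
    if E: "\<And>q. \<exists>!m. m \<in> int_lattice \<and> q + m \<in> E" for E :: "(real^2) set" and q
  proof -
    obtain m where m: "m \<in> int_lattice" "q + m \<in> E" "\<And>m'. m' \<in> int_lattice \<Longrightarrow> q + m' \<in> E \<Longrightarrow> m' = m"
      using E[of q] by blast
    have "(\<integral>\<^sup>+m. indicator E (q + m) \<partial>count_space int_lattice) = (\<Sum>m\<in>{m}. indicator E (q + m) :: ennreal)"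
      by (rule nn_integral_count_space') (use m(1,2) in \<open>auto simp: indicator_def dest: m(3)\<close>)
    then show ?thesis using m(2) by simp
  qed
  have one': "(\<integral>\<^sup>+m. indicator D' (q - m) \<partial>count_space int_lattice) = (1::ennreal)" for q
  proof -
    obtain n where n: "n \<in> int_lattice" "q + n \<in> D'" "\<And>m'. m' \<in> int_lattice \<Longrightarrow> q + m' \<in> D' \<Longrightarrow> m' = n"
      using D'[of q] by blast
    define m where "m = - n"
    have m: "m \<in> int_lattice" "q - m \<in> D'" using n(1,2) int_lattice_uminus by (simp_all add: m_def)
    have m3: "m' = m" if "m' \<in> int_lattice" "q - m' \<in> D'" for m'
      using n(3)[of "- m'"] that int_lattice_uminus unfolding m_def by (metis diff_conv_add_uminus minus_minus)
    have "(\<integral>\<^sup>+m. indicator D' (q - m) \<partial>count_space int_lattice) = (\<Sum>m\<in>{m}. indicator D' (q - m) :: ennreal)"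
      by (rule nn_integral_count_space') (use m(1,2) in \<open>auto simp: indicator_def dest: m3\<close>)
    then show ?thesis using m(2) by simp
  qed
  have shift: "(\<integral>\<^sup>+q. f (q + m) \<partial>lborel) = (\<integral>\<^sup>+q. f q \<partial>lborel)"
    if [measurable]: "f \<in> borel_measurable borel" for f :: "real^2 \<Rightarrow> ennreal" and m
  proof -
    have "(\<integral>\<^sup>+q. f q \<partial>lborel) = (\<integral>\<^sup>+q. f q \<partial>distr lborel borel ((+) m))"
      by (simp add: lborel_distr_plus)
    also have "\<dots> = (\<integral>\<^sup>+q. f (m + q) \<partial>lborel)"
      by (rule nn_integral_distr) simp_all
    finally show ?thesis by (simp add: add.commute)
  qed
  have "(\<integral>\<^sup>+q. k q * indicator D' q \<partial>lborel)
      = (\<integral>\<^sup>+q. (\<integral>\<^sup>+m. k q * indicator D' q * indicator D (q + m) \<partial>count_space int_lattice) \<partial>lborel)"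
    by (simp add: nn_integral_cmult one[OF D])
  also have "\<dots> = (\<integral>\<^sup>+m. (\<integral>\<^sup>+q. k q * indicator D' q * indicator D (q + m) \<partial>lborel) \<partial>count_space int_lattice)"
    by (intro nn_integral_count_space_nn_integral countable_int_lattice) measurable
  also have "\<dots> = (\<integral>\<^sup>+m. (\<integral>\<^sup>+q. k q * indicator D' (q - m) * indicator D q \<partial>lborel) \<partial>count_space int_lattice)"
  proof (rule nn_integral_cong)
    fix m assume "m \<in> space (count_space int_lattice)"
    then have m: "m \<in> int_lattice" by simp
    have "(\<integral>\<^sup>+q. k q * indicator D' (q - m) * indicator D q \<partial>lborel)
       = (\<integral>\<^sup>+q. k (q + m) * indicator D' ((q + m) - m) * indicator D (q + m) \<partial>lborel)"
      by (rule shift[symmetric]) measurable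
    then show "(\<integral>\<^sup>+q. k q * indicator D' q * indicator D (q + m) \<partial>lborel)
        = (\<integral>\<^sup>+q. k q * indicator D' (q - m) * indicator D q \<partial>lborel)"
      by (simp add: per[OF m])
  qed
  also have "\<dots> = (\<integral>\<^sup>+q. (\<integral>\<^sup>+m. k q * indicator D' (q - m) * indicator D q \<partial>count_space int_lattice) \<partial>lborel)"
    by (intro nn_integral_count_space_nn_integral[symmetric] countable_int_lattice) measurable
  also have "\<dots> = (\<integral>\<^sup>+q. k q * indicator D q \<partial>lborel)"
  proof (rule nn_integral_cong)
    fix q
    have "(\<integral>\<^sup>+m. k q * indicator D' (q - m) * indicator D q \<partial>count_space int_lattice)
       = (\<integral>\<^sup>+m. (k q * indicator D q) * indicator D' (q - m) \<partial>count_space int_lattice)"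
      by (simp add: mult_ac)
    then show "(\<integral>\<^sup>+m. k q * indicator D' (q - m) * indicator D q \<partial>count_space int_lattice) = k q * indicator D q"
      by (simp add: nn_integral_cmult one')
  qed
  finally show ?thesis ..
qed

text \<open>A half-open unit square is a fundamental domain wherever its corner lies. The freedom in
  the corner allows a small ball to be placed inside a single square.\<close>

definition cell :: "real^2 \<Rightarrow> (real^2) set" where
  "cell p = {q. \<forall>i. p $ i \<le> q $ i \<and> q $ i < p $ i + 1}"

lemma cell_borel [measurable]: "cell p \<in> sets borel"
  unfolding cell_def by measurable

lemma cell_unique: "\<exists>!m. m \<in> int_lattice \<and> q + m \<in> cell p"
proof (rule ex1I)
  let ?m = "(\<chi> i. - of_int \<lfloor>q $ i - p $ i\<rfloor>) :: real^2"
  have "p $ i \<le> q $ i - of_int \<lfloor>q $ i - p $ i\<rfloor> \<and> q $ i - of_int \<lfloor>q $ i - p $ i\<rfloor> < p $ i + 1" for i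
    using of_int_floor_le[of "q $ i - p $ i"] real_of_int_floor_add_one_gt[of "q $ i - p $ i"] by linarith
  then show "?m \<in> int_lattice \<and> q + ?m \<in> cell p"
    by (auto simp: int_lattice_def cell_def)
  fix m assume m: "m \<in> int_lattice \<and> q + m \<in> cell p"
  have "m $ i = - of_int \<lfloor>q $ i - p $ i\<rfloor>" for i
  proof -
    obtain z where z: "m $ i = of_int z" using m by (auto simp: int_lattice_def elim!: Ints_cases)
    have "p $ i \<le> q $ i + of_int z" "q $ i + of_int z < p $ i + 1"
      using m z by (auto simp: cell_def dest: spec[of _ i])
    then have "\<lfloor>q $ i - p $ i\<rfloor> = - z" by (intro floor_unique) auto
    then show ?thesis using z by simp
  qed
  then show "m = ?m" by (simp add: vec_eq_iff)
qed

lemma tproj_measurable [measurable]: "tproj \<in> borel_measurable borel"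
  by (rule borel_measurable_continuous_onI[OF continuous_on_tproj])

lemma nn_integral_haar:
  assumes [measurable]: "h \<in> borel_measurable borel"
  shows "(\<integral>\<^sup>+x. h x \<partial>haar) = (\<integral>\<^sup>+q. h (tproj q) * indicator (cell p) q \<partial>lborel)"
proof -
  have c0: "{p. \<forall>i. 0 \<le> p $ i \<and> p $ i < 1} = cell 0" by (simp add: cell_def)
  have "(\<integral>\<^sup>+x. h x \<partial>haar) = (\<integral>\<^sup>+q. h (tproj q) \<partial>restrict_space lborel (cell 0))"
    unfolding haar_def c0 by (intro nn_integral_distr measurable_restrict_space1) simp_all
  also have "\<dots> = (\<integral>\<^sup>+q. h (tproj q) * indicator (cell 0) q \<partial>lborel)"
    by (rule nn_integral_restrict_space) simp
  also have "\<dots> = (\<integral>\<^sup>+q. h (tproj q) * indicator (cell p) q \<partial>lborel)"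
    by (rule nn_integral_fundamental_domain) (simp_all add: cell_unique tproj_int_lattice)
  finally show ?thesis .
qed

lemma tproj_ball: "tproj ` ball p r = ball (tproj p) r"
proof (intro equalityI subsetI)
  fix x assume "x \<in> tproj ` ball p r"
  then obtain q where "x = tproj q" "norm (p - q) < r" by (auto simp: dist_norm)
  then show "x \<in> ball (tproj p) r" using dist_torus2_le[of p q] by simp
next
  fix x assume "x \<in> ball (tproj p) r"
  then have "dist (tproj p) x < r" by simp
  then obtain p' q where q: "tproj p' = tproj p" "tproj q = x" "norm (p' - q) < r"
    by (rule dist_torus2_lessE)
  have "tproj (q + (p - p')) = x" using tproj_translate(1)[of p p' q] q by simp
  moreover have "q + (p - p') \<in> ball p r" using q by (simp add: dist_norm algebra_simps norm_minus_commute)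
  ultimately show "x \<in> tproj ` ball p r" by blast
qed

lemma tproj_inj_on_ball:
  assumes "r \<le> 1/2"
  shows "inj_on tproj (ball p r)"
proof (rule inj_onI)
  fix q q' assume q: "q \<in> ball p r" "q' \<in> ball p r" "tproj q = tproj q'"
  have "norm (q - q') < 1"
    using q assms dist_triangle_less_add[of q p r q' r] by (simp add: dist_norm norm_minus_commute)
  then have "\<bar>q $ i - q' $ i\<bar> < 1" for i
    using component_le_norm_cart[of "q - q'" i] by simp
  moreover have "q $ i - q' $ i \<in> \<int>" for i using q(3) by (simp add: tproj_eq_iff)
  ultimately have "q $ i - q' $ i = 0" for i by (intro Ints_nonzero_abs_less1)
  then show "q = q'" by (simp add: vec_eq_iff)
qed

text \<open>A ball of radius at most 1/2 about p lies in the unit square centred at p. By uniqueness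
  of lattice translates in a cell, each point of the square that projects into the ball on the torus
  lies in the ball upstairs.\<close>

lemma nn_integral_haar_ball:
  assumes [measurable]: "h \<in> borel_measurable borel" and r: "r \<le> 1/2"
  shows "(\<integral>\<^sup>+x. h x * indicator (ball (tproj p) r) x \<partial>haar) = (\<integral>\<^sup>+q. h (tproj q) * indicator (ball p r) q \<partial>lborel)"
proof -
  define c :: "real^2" where "c = p - (\<chi> i. 1/2)"
  have sub: "ball p r \<subseteq> cell c"
  proof
    fix q assume "q \<in> ball p r"
    then have "norm (q - p) < 1/2" using r by (simp add: dist_norm norm_minus_commute)
    then have "\<bar>q $ i - p $ i\<bar> < 1/2" for i
      using component_le_norm_cart[of "q - p" i] by simp
    then have "\<bar>q $ i - p $ i\<bar> < 1/2" for i .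
    then have "c $ i \<le> q $ i \<and> q $ i < c $ i + 1" for i
      unfolding c_def by (simp, smt (verit) field_sum_of_halves)
    then show "q \<in> cell c" by (simp add: cell_def)
  qed
  have eq: "indicator (ball (tproj p) r) (tproj q) * indicator (cell c) q = (indicator (ball p r) q :: ennreal)" for q
  proof (cases "q \<in> cell c \<and> tproj q \<in> ball (tproj p) r")
    case True
    then obtain q' where q': "q' \<in> ball p r" "tproj q' = tproj q" unfolding tproj_ball[symmetric] by force
    have "q' - q \<in> int_lattice" using q' by (simp add: tproj_eq_int_lattice)
    moreover have "q + (q' - q) \<in> cell c" using q' sub by auto
    moreover have "0 \<in> int_lattice" "q + 0 \<in> cell c" using True by (auto simp: int_lattice_def)
    ultimately have "q' - q = 0" using cell_unique[of q c] by blast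
    then show ?thesis using True q' by (simp add: indicator_def)
  next
    case False
    moreover have "q \<notin> ball p r" if "tproj q \<notin> ball (tproj p) r"
      using that tproj_ball[of p r] by blast
    ultimately show ?thesis using sub by (auto simp: indicator_def)
  qed
  have [measurable]: "ball (tproj p) r \<in> sets borel" by simp
  have "(\<integral>\<^sup>+x. h x * indicator (ball (tproj p) r) x \<partial>haar)
     = (\<integral>\<^sup>+q. h (tproj q) * indicator (ball (tproj p) r) (tproj q) * indicator (cell c) q \<partial>lborel)"
    by (rule nn_integral_haar) measurable
  also have "\<dots> = (\<integral>\<^sup>+q. h (tproj q) * indicator (ball p r) q \<partial>lborel)"
    by (simp add: mult.assoc eq)
  finally show ?thesis .
qed

section \<open>Charts of the torus and derivatives of lifts\<close>

definition local_section :: "real^2 \<Rightarrow> torus2 \<Rightarrow> real^2" where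
  "local_section p x = (THE q. q \<in> ball p (1/2) \<and> tproj q = x)"

lemma local_section_eqI: "q \<in> ball p (1/2) \<Longrightarrow> tproj q = x \<Longrightarrow> local_section p x = q"
  unfolding local_section_def using tproj_inj_on_ball[of "1/2" p] by (auto simp: inj_on_def)

lemma local_section_in:
  assumes "x \<in> ball (tproj p) r" "r \<le> 1/2"
  shows "local_section p x \<in> ball p r" "tproj (local_section p x) = x"
proof -
  obtain q where q: "q \<in> ball p r" "tproj q = x" using assms unfolding tproj_ball[symmetric] by blast
  then have "q \<in> ball p (1/2)" using assms by auto
  then have "local_section p x = q" using q by (intro local_section_eqI)
  then show "local_section p x \<in> ball p r" "tproj (local_section p x) = x" using q by simp_all
qed

text \<open>Lattice translations in the source and in the target move the base point of a given lift
  to q and its value to w without changing the derivative.\<close>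

lemma has_tderiv_at:
  assumes "has_tderiv f A (tproj q)" and w: "tproj w = f (tproj q)"
  obtains F where "F q = w" "\<forall>\<^sub>F z in nhds q. tproj (F z) = f (tproj z)"
    "(F has_derivative (*v) A) (at q)"
proof -
  obtain G r where G: "tproj r = tproj q" "\<forall>\<^sub>F z in nhds r. tproj (G z) = f (tproj z)"
    "(G has_derivative (\<lambda>v. A *v v)) (at r)"
    using assms unfolding has_tderiv_def by blast
  have Gr: "tproj (G r) = f (tproj r)" using eventually_nhds_x_imp_x[OF G(2)] .
  define F where "F z = G (z + (r - q)) + (w - G r)" for z
  have m: "w - G r \<in> int_lattice" using Gr G(1) w by (simp add: tproj_eq_int_lattice[symmetric])
  have "((\<lambda>z. z + (r - q)) has_derivative (\<lambda>v. v)) (at q)" by (auto intro!: derivative_eq_intros)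
  moreover have "(G has_derivative (\<lambda>v. A *v v)) (at (q + (r - q)))" using G(3) by simp
  ultimately have "((\<lambda>z. G (z + (r - q))) has_derivative (\<lambda>v. A *v v)) (at q)"
    by (rule has_derivative_compose)
  then have F': "(F has_derivative (*v) A) (at q)"
    unfolding F_def[abs_def] by (auto intro!: derivative_eq_intros)
  have "filterlim (\<lambda>z. z + (r - q)) (nhds (q + (r - q))) (nhds q)"
    by (intro tendsto_add tendsto_const filterlim_ident)
  then have "filterlim (\<lambda>z. z + (r - q)) (nhds r) (nhds q)" by simp
  then have "\<forall>\<^sub>F z in nhds q. tproj (G (z + (r - q))) = f (tproj (z + (r - q)))"
    using G(2) by (rule eventually_compose_filterlim[rotated])
  moreover have "tproj (z + (r - q)) = tproj z" for z
    using tproj_translate(1)[of r q z] G(1) by simp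
  ultimately have "\<forall>\<^sub>F z in nhds q. tproj (F z) = f (tproj z)"
    by (simp add: F_def tproj_int_lattice[OF m])
  moreover have "F q = w" by (simp add: F_def)
  ultimately show ?thesis using F' that by blast
qed

text \<open>A lift whose value lies in the ball about p stays there nearby by continuity. On this
  ball \<open>tproj\<close> is injective, so the lift coincides with the chart expression of
  f.\<close>

lemma lift_has_derivative:
  assumes f: "has_tderiv f A (tproj q)" and x: "f (tproj q) \<in> ball (tproj p) (1/2)"
  shows "((\<lambda>z. local_section p (f (tproj z))) has_derivative (*v) A) (at q)"
proof -
  define w where "w = local_section p (f (tproj q))"
  have w: "w \<in> ball p (1/2)" "tproj w = f (tproj q)" using local_section_in[OF x] by (auto simp: w_def)
  obtain F where F: "F q = w" "\<forall>\<^sub>F z in nhds q. tproj (F z) = f (tproj z)"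
    "(F has_derivative (*v) A) (at q)"
    by (rule has_tderiv_at[OF f w(2)])
  have "(F \<longlongrightarrow> w) (at q)" using has_derivative_continuous[OF F(3)] F(1) by (simp add: continuous_at)
  then have "\<forall>\<^sub>F z in at q. F z \<in> ball p (1/2)"
    using w by (intro topological_tendstoD) auto
  moreover have "\<forall>\<^sub>F z in at q. tproj (F z) = f (tproj z)"
    using F(2) unfolding eventually_at_filter by eventually_elim simp
  ultimately have "\<forall>\<^sub>F z in at q. F z = local_section p (f (tproj z))"
    by eventually_elim (simp add: local_section_eqI)
  then show ?thesis
    by (rule has_derivative_transform_eventually[OF F(3)]) (use F(1) in \<open>auto simp: w_def\<close>)
qed

lemma has_tderiv_continuous:
  assumes "has_tderiv f A x"
  shows "isCont f x"
proof -
  obtain q where q: "tproj q = x" using tproj_surj by blast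
  obtain w where w: "tproj w = f x" using tproj_surj by blast
  have fA: "has_tderiv f A (tproj q)" and w': "tproj w = f (tproj q)" using assms q w by simp_all
  obtain F where F: "F q = w" "\<forall>\<^sub>F z in nhds q. tproj (F z) = f (tproj z)"
    "(F has_derivative (*v) A) (at q)"
    by (rule has_tderiv_at[OF fA w'])
  show ?thesis
    unfolding continuous_at_eps_delta
  proof (intro allI impI)
    fix e :: real assume e: "e > 0"
    have "(F \<longlongrightarrow> w) (nhds q)"
      using has_derivative_continuous[OF F(3)] F(1)
      unfolding continuous_at tendsto_at_iff_tendsto_nhds by simp
    then have "\<forall>\<^sub>F z in nhds q. dist (F z) w < e" using e by (rule tendstoD)
    then have "\<forall>\<^sub>F z in nhds q. dist (F z) w < e \<and> tproj (F z) = f (tproj z)"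
      using F(2) by eventually_elim simp
    then obtain d where d: "d > 0" "\<And>z. dist z q < d \<Longrightarrow> dist (F z) w < e \<and> tproj (F z) = f (tproj z)"
      unfolding eventually_nhds_metric by blast
    have "dist (f y) (f x) < e" if "dist y x < d" for y
    proof -
      have "y \<in> ball (tproj q) d" using that q by (simp add: dist_commute)
      then obtain z where z: "z \<in> ball q d" "y = tproj z" unfolding tproj_ball[symmetric] by blast
      then have "dist (F z) w < e \<and> tproj (F z) = f (tproj z)" by (intro d(2)) (simp add: dist_commute)
      then have "dist (F z) w < e" "tproj (F z) = f y" using z by simp_all
      then show ?thesis using dist_torus2_le[of "F z" w] w by (simp add: dist_norm)
    qed
    then show "\<exists>d>0. \<forall>x'. dist x' x < d \<longrightarrow> dist (f x') (f x) < e" using d(1) by blast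
  qed
qed

lemma matrix_of_mult: "matrix ((*v) (A::real^2^2)) = A"
  by (rule matrix_of_matrix_vector_mul)

section \<open>Area estimates for images under differentiable maps\<close>

lemma abs_det_integrable:
  fixes D :: "real^2 \<Rightarrow> real^2^2"
  assumes S: "S \<in> sets borel" "bounded S" and D: "continuous_on UNIV D"
  shows "(\<lambda>x. \<bar>det (D x)\<bar>) integrable_on S" "(\<lambda>x. \<bar>det (D x)\<bar>) absolutely_integrable_on S"
proof -
  obtain a b where ab: "S \<subseteq> cbox a b" using bounded_subset_cbox_symmetric[OF S(2)] by blast
  have "continuous_on UNIV (\<lambda>x. \<bar>det (D x)\<bar>)"
    unfolding det_2 by (intro continuous_intros D)
  then have "(\<lambda>x. \<bar>det (D x)\<bar>) absolutely_integrable_on cbox a b"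
    by (intro absolutely_integrable_continuous) (auto intro: continuous_on_subset)
  then show "(\<lambda>x. \<bar>det (D x)\<bar>) absolutely_integrable_on S"
    by (rule set_integrable_subset) (use S ab in auto)
  then show "(\<lambda>x. \<bar>det (D x)\<bar>) integrable_on S"
    using set_lebesgue_integral_eq_integral(1) by blast
qed

lemma bounded_borel_lmeasurable: "S \<in> sets borel \<Longrightarrow> bounded S \<Longrightarrow> S \<in> lmeasurable"
  by (intro bounded_set_imp_lmeasurable) auto

text \<open>Injectivity makes the area of the image equal to the integral of the Jacobian.\<close>

lemma measure_image_ge:
  fixes f :: "real^2 \<Rightarrow> real^2"
  assumes S: "S \<in> sets borel" "bounded S" and D: "continuous_on UNIV D"
    and f: "\<And>x. x \<in> S \<Longrightarrow> (f has_derivative (*v) (D x)) (at x)" "inj_on f S"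
    and c: "\<And>x. x \<in> S \<Longrightarrow> c \<le> \<bar>det (D x)\<bar>"
  shows "c * measure lebesgue S \<le> measure lebesgue (f ` S)" "f ` S \<in> lmeasurable"
proof -
  have Sl: "S \<in> sets lebesgue" using S by auto
  have f': "(f has_derivative (*v) (D x)) (at x within S)" if "x \<in> S" for x
    using f(1)[OF that] has_derivative_at_withinI by blast
  have int: "(\<lambda>x. \<bar>det (matrix ((*v) (D x)))\<bar>) integrable_on S"
    unfolding matrix_of_mult by (rule abs_det_integrable[OF S D])
  have "c * measure lebesgue S = integral S (\<lambda>x. c)"
    using lmeasure_integral[OF bounded_borel_lmeasurable[OF S]] by (simp flip: integral_mult_right)
  also have "\<dots> \<le> integral S (\<lambda>x. \<bar>det (D x)\<bar>)"
    using abs_det_integrable(1)[OF S D] c integrable_on_const[OF bounded_borel_lmeasurable[OF S]]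
    by (intro integral_le) auto
  also have "\<dots> = measure lebesgue (f ` S)"
    using measure_differentiable_image_eq[OF Sl f' f(2) int] by (simp add: matrix_of_mult)
  finally show "c * measure lebesgue S \<le> measure lebesgue (f ` S)" .
  show "f ` S \<in> lmeasurable" by (rule measurable_differentiable_image[OF Sl f' int])
qed

text \<open>Overlaps only reduce the area of the image, so the integral of the Jacobian still bounds
  it from above.\<close>

lemma measure_image_le:
  fixes f :: "real^2 \<Rightarrow> real^2"
  assumes S: "S \<in> sets borel" "bounded S" and D: "continuous_on UNIV D"
    and f: "\<And>x. x \<in> S \<Longrightarrow> (f has_derivative (*v) (D x)) (at x)"
    and c: "\<And>x. x \<in> S \<Longrightarrow> \<bar>det (D x)\<bar> \<le> c"
  shows "measure lebesgue (f ` S) \<le> c * measure lebesgue S" "f ` S \<in> lmeasurable"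
proof -
  have Sl: "S \<in> sets lebesgue" using S by auto
  have f': "(f has_derivative (*v) (D x)) (at x within S)" if "x \<in> S" for x
    using f(1)[OF that] has_derivative_at_withinI by blast
  have int: "(\<lambda>x. \<bar>det (matrix ((*v) (D x)))\<bar>) integrable_on S"
    unfolding matrix_of_mult by (rule abs_det_integrable[OF S D])
  have "measure lebesgue (f ` S) \<le> integral S (\<lambda>x. \<bar>det (D x)\<bar>)"
    using measure_differentiable_image[OF Sl f' int] by (simp add: matrix_of_mult)
  also have "\<dots> \<le> integral S (\<lambda>x. c)"
    using abs_det_integrable(1)[OF S D] c integrable_on_const[OF bounded_borel_lmeasurable[OF S]]
    by (intro integral_le) auto
  also have "\<dots> = c * measure lebesgue S"
    using lmeasure_integral[OF bounded_borel_lmeasurable[OF S]] by (simp flip: integral_mult_right)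
  finally show "measure lebesgue (f ` S) \<le> c * measure lebesgue S" .
  show "f ` S \<in> lmeasurable" by (rule measurable_differentiable_image[OF Sl f' int])
qed

section \<open>Local transfer of measure\<close>

text \<open>The adjugate. In dimension two it permutes the entries up to sign, so it is linear and
  preserves the Euclidean norm of the entries.\<close>

definition adj2 :: "real^2^2 \<Rightarrow> real^2^2" where
  "adj2 M = vector [vector [M$2$2, - M$1$2], vector [- M$2$1, M$1$1]]"

lemma adj2_components [simp]:
  "adj2 M $ 1 $ 1 = M$2$2" "adj2 M $ 1 $ 2 = - M$1$2" "adj2 M $ 2 $ 1 = - M$2$1" "adj2 M $ 2 $ 2 = M$1$1"
  by (simp_all add: adj2_def)

lemma matrix_inv_2:
  assumes "det (M::real^2^2) \<noteq> 0"
  shows "matrix_inv M = (1 / det M) *\<^sub>R adj2 M" "M ** matrix_inv M = mat 1" "matrix_inv M ** M = mat 1"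
proof -
  let ?N = "(1 / det M) *\<^sub>R adj2 M"
  have 1: "M ** ?N = mat 1" "?N ** M = mat 1"
    using assms by (simp_all add: matrix_matrix_mult_def mat_def vec_eq_iff forall_2 sum_2 det_2 divide_simps)
  then have "\<exists>N. M ** N = mat 1 \<and> N ** M = mat 1" by blast
  then have 2: "M ** matrix_inv M = mat 1 \<and> matrix_inv M ** M = mat 1"
    unfolding matrix_inv_def by (rule someI_ex)
  then show "M ** matrix_inv M = mat 1" "matrix_inv M ** M = mat 1" by auto
  have "matrix_inv M = matrix_inv M ** (M ** ?N)" using 1 by simp
  also have "\<dots> = ?N" using 2 by (simp only: matrix_mul_assoc matrix_mul_lid)
  finally show "matrix_inv M = ?N" .
qed

lemma norm_adj2: "norm (adj2 M) = norm M"
  by (simp add: norm_vec_def L2_set_def sum_2 algebra_simps)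

text \<open>\<open>matrix_inv\<close> is defined by choice, so its continuity is read off the
  explicit formula, which holds near M because the determinant stays non-zero there.\<close>

lemma isCont_matrix_inv:
  assumes "det (M::real^2^2) \<noteq> 0"
  shows "isCont matrix_inv M"
proof -
  have dc: "isCont det M" unfolding det_2 by (intro continuous_intros)
  have ac: "isCont adj2 M"
  proof -
    have "linear adj2"
      by (rule linearI) (simp_all add: vec_eq_iff forall_2)
    then show ?thesis by (rule linear_continuous_at[OF linear_linear[THEN iffD2]])
  qed
  have "isCont (\<lambda>M. (1 / det M) *\<^sub>R adj2 M) M" using assms dc ac by (intro continuous_intros) auto
  moreover have "\<forall>\<^sub>F N in nhds M. det N \<noteq> 0"
    using dc assms
    by (intro tendsto_imp_eventually_ne[of _ "det M"]) (simp_all add: isCont_def tendsto_at_iff_tendsto_nhds)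
  then have "\<forall>\<^sub>F N in nhds M. (1 / det N) *\<^sub>R adj2 N = matrix_inv N"
    by eventually_elim (simp add: matrix_inv_2)
  then have "isCont (\<lambda>M. (1 / det M) *\<^sub>R adj2 M) M = isCont matrix_inv M" by (rule isCont_cong)
  ultimately show ?thesis by simp
qed


section \<open>Continuously differentiable maps of the torus seen in charts\<close>

lemma C1_has_tderiv: "Q \<in> C1_maps \<Longrightarrow> has_tderiv Q (tderiv Q x) x"
  unfolding C1_maps_def C1_on_def using tderiv_eq by blast

lemma C1_tderiv_continuous: "Q \<in> C1_maps \<Longrightarrow> continuous_on S (tderiv Q)"
  unfolding C1_maps_def C1_on_def using continuous_on_subset by blast

lemma C1_continuous: "Q \<in> C1_maps \<Longrightarrow> continuous_on S Q"
  using has_tderiv_continuous[OF C1_has_tderiv] by (simp add: continuous_at_imp_continuous_on)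

lemma C1_measurable: "Q \<in> C1_maps \<Longrightarrow> Q \<in> borel_measurable borel" "Q \<in> C1_maps \<Longrightarrow> tderiv Q \<in> borel_measurable borel"
  by (auto intro: borel_measurable_continuous_onI C1_continuous C1_tderiv_continuous)

lemma borel_measurable_haar: "(f \<in> borel_measurable haar) = (f \<in> borel_measurable borel)"
  by (rule arg_cong[where f = "\<lambda>S. f \<in> S"], rule measurable_cong_sets) (simp_all add: sets_haar)

lemma lift_has_derivative_C1:
  assumes "Q \<in> C1_maps" "Q (tproj q) \<in> ball (tproj p) (1/2)"
  shows "((\<lambda>z. local_section p (Q (tproj z))) has_derivative (*v) (tderiv Q (tproj q))) (at q)"
  using lift_has_derivative[of Q "tderiv Q (tproj q)" q p] C1_has_tderiv[OF assms(1)] assms(2) by blast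

text \<open>In the chart, F - M is Lipschitz with constant 2 e on a convex ball, the factor 2 coming
  from \<open>onorm_matrix_le_norm\<close>, while M expands by at least 3 e. The difference e gives
  injectivity.\<close>

lemma lift_inj_on:
  assumes Q: "Q \<in> C1_maps" and im: "Q ` ball (tproj p) r \<subseteq> ball (tproj p0) (1/2)"
    and e: "0 < e" and M: "\<And>v. 3 * e * norm v \<le> norm (M *v v)"
    and close: "\<And>y. y \<in> ball (tproj p) r \<Longrightarrow> norm (tderiv Q y - M) \<le> e"
  shows "inj_on (\<lambda>z. local_section p0 (Q (tproj z))) (ball p r)"
proof (rule inj_onI)
  define F where "F z = local_section p0 (Q (tproj z))" for z
  fix q q' assume q: "q \<in> ball p r" "q' \<in> ball p r" and eq: "local_section p0 (Q (tproj q)) = local_section p0 (Q (tproj q'))"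
  define G where "G z = F z - M *v z" for z
  have tb: "tproj z \<in> ball (tproj p) r" if "z \<in> ball p r" for z
    using that unfolding tproj_ball[symmetric] by blast
  have der: "(G has_derivative (\<lambda>v. (tderiv Q (tproj z) - M) *v v)) (at z within ball p r)" if z: "z \<in> ball p r" for z
  proof -
    have "(F has_derivative (*v) (tderiv Q (tproj z))) (at z)"
      unfolding F_def by (rule lift_has_derivative_C1[OF Q]) (use im tb[OF z] in blast)
    then have "(F has_derivative (*v) (tderiv Q (tproj z))) (at z within ball p r)"
      by (rule has_derivative_at_withinI)
    moreover have "((*v) M has_derivative (*v) M) (at z within ball p r)"
      by (rule bounded_linear_imp_has_derivative) simp
    ultimately show ?thesis
      unfolding G_def[abs_def] matrix_vector_mult_diff_rdistrib by (rule has_derivative_diff)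
  qed
  have "norm (G q - G q') \<le> (2 * e) * norm (q - q')"
  proof (rule differentiable_bound[OF convex_ball der _ q])
    fix z assume "z \<in> ball p r"
    from close[OF tb[OF this]] show "onorm ((*v) (tderiv Q (tproj z) - M)) \<le> 2 * e"
      using onorm_matrix_le_norm[of "tderiv Q (tproj z) - M"] by linarith
  qed
  moreover have "norm (G q - G q') = norm (M *v (q - q'))"
    using eq unfolding G_def F_def by (simp add: matrix_vector_mult_diff_distrib norm_minus_commute)
  ultimately have "3 * e * norm (q - q') \<le> 2 * e * norm (q - q')" using M[of "q - q'"] by linarith
  then have "e * norm (q - q') \<le> 0" by simp
  then show "q = q'" using e by (simp add: mult_le_0_iff)
qed

lemma lift_continuous:
  assumes Q: "Q \<in> C1_maps" and im: "Q ` ball (tproj p) r \<subseteq> ball (tproj p0) (1/2)"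
  shows "continuous_on (ball p r) (\<lambda>z. local_section p0 (Q (tproj z)))"
proof (rule continuous_at_imp_continuous_on, rule ballI)
  fix z assume "z \<in> ball p r"
  then have "Q (tproj z) \<in> ball (tproj p0) (1/2)" using im tproj_ball[of p r] by blast
  then show "isCont (\<lambda>z. local_section p0 (Q (tproj z))) z"
    using has_derivative_continuous[OF lift_has_derivative_C1[OF Q]] by blast
qed

text \<open>One half of the change of variables. In charts, c times the push-forward of the area of
  the ball is at most the area, since Q is injective on the ball with Jacobian at least c. Comparing
  the derivative of Q with a fixed matrix M lets the same M and e serve all maps near a given
  one.\<close>

lemma transfer_local:
  assumes Q: "Q \<in> C1_maps" and im: "Q ` ball y r \<subseteq> ball x (1/2)" and r: "r \<le> 1/2"
    and e: "0 < e" and M: "\<And>v. 3 * e * norm v \<le> norm (M *v v)"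
    and close: "\<And>z. z \<in> ball y r \<Longrightarrow> norm (tderiv Q z - M) \<le> e"
    and c: "0 \<le> c" "\<And>z. z \<in> ball y r \<Longrightarrow> c \<le> \<bar>det (tderiv Q z)\<bar>"
    and h [measurable]: "h \<in> borel_measurable borel"
  shows "ennreal c * (\<integral>\<^sup>+z. h (Q z) * indicator (ball y r) z \<partial>haar) \<le> (\<integral>\<^sup>+x. h x \<partial>haar)"
proof -
  obtain p where y: "y = tproj p" using tproj_surj by metis
  obtain p0 where x: "x = tproj p0" using tproj_surj by metis
  define F where "F z = local_section p0 (Q (tproj z))" for z
  have im': "Q ` ball (tproj p) r \<subseteq> ball (tproj p0) (1/2)" using im x y by simp
  have tb: "tproj z \<in> ball y r" if "z \<in> ball p r" for z
    using that unfolding y tproj_ball[symmetric] by blast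
  have inj: "inj_on F (ball p r)"
    unfolding F_def by (rule lift_inj_on[OF Q im' e M]) (use close y in auto)
  have Fc: "continuous_on (ball p r) F" unfolding F_def by (rule lift_continuous[OF Q im'])
  have Qm [measurable]: "Q \<in> borel_measurable borel" by (rule C1_measurable[OF Q])
  have Dc: "continuous_on UNIV (\<lambda>z. tderiv Q (tproj z))"
    by (rule continuous_on_compose2[OF C1_tderiv_continuous[OF Q, of UNIV] continuous_on_tproj]) simp
  define R where "R = restrict_space lborel (ball p r)"
  have sR: "sets R = sets (restrict_space borel (ball p r))"
    unfolding R_def by (intro sets_restrict_space_cong) simp
  have Fm [measurable]: "F \<in> measurable R borel"
    using borel_measurable_continuous_on_restrict[OF Fc] measurable_cong_sets[OF sR refl] by blast
  have spR: "space R = ball p r" by (simp add: R_def space_restrict_space)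
  have le: "scale_measure (ennreal c) (distr R borel F) \<le> lborel"
  proof (subst le_measure, simp, intro ballI)
    fix W assume "W \<in> sets (scale_measure (ennreal c) (distr R borel F))"
    then have W [measurable]: "W \<in> sets borel" by simp
    define E where "E = F -` W \<inter> ball p r"
    have ER: "E \<in> sets R" unfolding E_def spR[symmetric] by (rule measurable_sets[OF Fm W])
    then have E: "E \<in> sets borel"
      unfolding sR sets_restrict_space by auto
    have Eb: "bounded E" by (rule bounded_subset[of "ball p r"]) (auto simp: E_def)
    have der: "(F has_derivative (*v) (tderiv Q (tproj z))) (at z)" if "z \<in> E" for z
      unfolding F_def
    proof (rule lift_has_derivative_C1[OF Q])
      have "tproj z \<in> ball y r" using that tb by (simp add: E_def)
      then show "Q (tproj z) \<in> ball (tproj p0) (1/2)" using im' y by blast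
    qed
    have m: "c * measure lebesgue E \<le> measure lebesgue (F ` E)" "F ` E \<in> lmeasurable"
      using measure_image_ge[OF E Eb Dc der, of c] inj_on_subset[OF inj, of E] c(2) tb
      by (auto simp: E_def)
    have El: "E \<in> lmeasurable" by (rule bounded_borel_lmeasurable[OF E Eb])
    have "emeasure (scale_measure (ennreal c) (distr R borel F)) W = ennreal c * emeasure R E"
      using spR by (simp add: emeasure_distr E_def)
    also have "emeasure R E = emeasure lborel E"
      unfolding R_def by (rule emeasure_restrict_space) (use E in \<open>auto simp: E_def\<close>)
    also have "\<dots> = ennreal (measure lebesgue E)"
      using El E emeasure_eq_measure2[OF El] by simp
    also have "ennreal c * \<dots> \<le> ennreal (measure lebesgue (F ` E))"
      using m c by (simp add: ennreal_mult[symmetric] ennreal_leI)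
    also have "\<dots> = emeasure lebesgue (F ` E)"
      using m(2) by (simp add: emeasure_eq_measure2)
    also have "\<dots> \<le> emeasure lebesgue W"
      by (intro emeasure_mono) (auto simp: E_def)
    finally show "emeasure (scale_measure (ennreal c) (distr R borel F)) W \<le> emeasure lborel W"
      by simp
  qed
  \<comment> \<open>The function h read in the chart about x and cut off to the ball where the chart
    is valid. The values of F lie in this ball, so nothing is lost.\<close>
  define k where "k z = h (tproj z) * indicator (ball p0 (1/2)) z" for z
  have [measurable]: "ball p0 (1/2) \<in> sets borel" by simp
  have k [measurable]: "k \<in> borel_measurable borel" unfolding k_def by measurable
  have [measurable]: "(\<lambda>z. h (Q z)) \<in> borel_measurable borel" by measurable
  have "(\<integral>\<^sup>+z. h (Q z) * indicator (ball y r) z \<partial>haar) = (\<integral>\<^sup>+z. h (Q (tproj z)) * indicator (ball p r) z \<partial>lborel)"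
    unfolding y by (rule nn_integral_haar_ball) (use r in auto)
  also have "\<dots> = (\<integral>\<^sup>+z. k (F z) * indicator (ball p r) z \<partial>lborel)"
  proof (rule nn_integral_cong)
    fix z
    show "h (Q (tproj z)) * indicator (ball p r) z = k (F z) * indicator (ball p r) z"
    proof (cases "z \<in> ball p r")
      case True
      then have "Q (tproj z) \<in> ball (tproj p0) (1/2)" using im' tb[OF True] y by blast
      from local_section_in[OF this] show ?thesis by (simp add: k_def F_def)
    qed simp
  qed
  also have "\<dots> = (\<integral>\<^sup>+z. k (F z) \<partial>R)"
    unfolding R_def by (rule nn_integral_restrict_space[symmetric]) simp
  also have "\<dots> = (\<integral>\<^sup>+z. k z \<partial>distr R borel F)"
    by (rule nn_integral_distr[symmetric]) measurable
  finally have "ennreal c * (\<integral>\<^sup>+z. h (Q z) * indicator (ball y r) z \<partial>haar)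
     = (\<integral>\<^sup>+z. k z \<partial>scale_measure (ennreal c) (distr R borel F))"
    by (simp add: nn_integral_scale_measure)
  also have "\<dots> \<le> (\<integral>\<^sup>+z. k z \<partial>lborel)"
    by (rule nn_integral_mono_measure[OF _ le]) simp
  also have "\<dots> = (\<integral>\<^sup>+z. h z * indicator (ball x (1/2)) z \<partial>haar)"
    unfolding k_def x by (rule nn_integral_haar_ball[symmetric]) auto
  also have "\<dots> \<le> (\<integral>\<^sup>+z. h z \<partial>haar)"
    by (intro nn_integral_mono) (simp add: indicator_def)
  finally show ?thesis .
qed

lemma emeasure_haar_ball:
  assumes "V \<in> sets borel" "r \<le> 1/2"
  shows "emeasure haar (V \<inter> ball (tproj p) r) = emeasure lborel (tproj -` V \<inter> ball p r)"
proof -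
  have [measurable]: "V \<in> sets borel" "ball (tproj p) r \<in> sets borel" using assms by auto
  have tV: "tproj -` V \<inter> ball p r \<in> sets borel"
    using measurable_sets[OF tproj_measurable assms(1)] by auto
  have "emeasure haar (V \<inter> ball (tproj p) r) = (\<integral>\<^sup>+x. indicator V x * indicator (ball (tproj p) r) x \<partial>haar)"
    by (simp add: indicator_inter_arith[symmetric] sets_haar)
  also have "\<dots> = (\<integral>\<^sup>+q. indicator V (tproj q) * indicator (ball p r) q \<partial>lborel)"
    by (rule nn_integral_haar_ball) (use assms in auto)
  also have "\<dots> = (\<integral>\<^sup>+q. indicator (tproj -` V \<inter> ball p r) q \<partial>lborel)"
    by (intro nn_integral_cong) (auto simp: indicator_def)
  also have "\<dots> = emeasure lborel (tproj -` V \<inter> ball p r)"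
    using tV by simp
  finally show ?thesis .
qed

text \<open>The opposite half. W is covered by the image of the part of the ball that Q sends into
  W, whatever overlaps occur, so the upper area estimate applies.\<close>

lemma image_local:
  assumes Q: "Q \<in> C1_maps" and im: "Q ` ball y r \<subseteq> ball x (1/2)" and r: "r \<le> 1/2"
    and c: "\<And>z. z \<in> ball y r \<Longrightarrow> \<bar>det (tderiv Q z)\<bar> \<le> c" "0 \<le> c"
    and W: "W \<in> sets borel" "W \<subseteq> Q ` ball y r"
  shows "emeasure haar W \<le> ennreal c * emeasure haar (ball y r \<inter> Q -` W)"
proof -
  obtain p where y: "y = tproj p" using tproj_surj by metis
  obtain p0 where x: "x = tproj p0" using tproj_surj by metis
  define F where "F z = local_section p0 (Q (tproj z))" for z
  have im': "Q ` ball (tproj p) r \<subseteq> ball (tproj p0) (1/2)" using im x y by simp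
  have tb: "tproj z \<in> ball y r" if "z \<in> ball p r" for z
    using that unfolding y tproj_ball[symmetric] by blast
  have Dc: "continuous_on UNIV (\<lambda>z. tderiv Q (tproj z))"
    by (rule continuous_on_compose2[OF C1_tderiv_continuous[OF Q, of UNIV] continuous_on_tproj]) simp
  have QW: "Q -` W \<in> sets borel"
    using measurable_sets[OF C1_measurable(1)[OF Q] W(1)] by simp
  define E where "E = tproj -` (Q -` W) \<inter> ball p r"
  have E: "E \<in> sets borel"
    unfolding E_def using measurable_sets[OF tproj_measurable QW] by auto
  have Eb: "bounded E" by (rule bounded_subset[of "ball p r"]) (auto simp: E_def)
  have El: "E \<in> lmeasurable" by (rule bounded_borel_lmeasurable[OF E Eb])
  have der: "(F has_derivative (*v) (tderiv Q (tproj z))) (at z)" if "z \<in> E" for z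
    unfolding F_def
  proof (rule lift_has_derivative_C1[OF Q])
    have "tproj z \<in> ball y r" using that tb by (simp add: E_def)
    then show "Q (tproj z) \<in> ball (tproj p0) (1/2)" using im' y by blast
  qed
  have m: "measure lebesgue (F ` E) \<le> c * measure lebesgue E" "F ` E \<in> lmeasurable"
    using measure_image_le[OF E Eb Dc der, of c] c tb by (auto simp: E_def)
  have sub: "tproj -` W \<inter> ball p0 (1/2) \<subseteq> F ` E"
  proof
    fix z assume z: "z \<in> tproj -` W \<inter> ball p0 (1/2)"
    then obtain y' where y': "y' \<in> ball y r" "tproj z = Q y'" using W by auto
    then obtain q where q: "q \<in> ball p r" "y' = tproj q" unfolding y tproj_ball[symmetric] by blast
    have "F q = z" unfolding F_def using z y' q by (intro local_section_eqI) auto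
    moreover have "q \<in> E" using q z y' by (simp add: E_def)
    ultimately show "z \<in> F ` E" by blast
  qed
  have "W \<inter> ball x (1/2) = W" using W im by auto
  then have "emeasure haar W = emeasure lborel (tproj -` W \<inter> ball p0 (1/2))"
    using emeasure_haar_ball[OF W(1), of "1/2" p0] x by simp
  also have "\<dots> = emeasure lebesgue (tproj -` W \<inter> ball p0 (1/2))"
    using measurable_sets[OF tproj_measurable W(1)] by simp
  also have "\<dots> \<le> emeasure lebesgue (F ` E)"
    using m(2) by (intro emeasure_mono sub) auto
  also have "\<dots> = ennreal (measure lebesgue (F ` E))" using m(2) by (simp add: emeasure_eq_measure2)
  also have "\<dots> \<le> ennreal c * ennreal (measure lebesgue E)"
    using m(1) c by (simp add: ennreal_mult[symmetric] ennreal_leI)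
  also have "ennreal (measure lebesgue E) = emeasure lborel E"
    using El E emeasure_eq_measure2[OF El] by simp
  also have "\<dots> = emeasure haar (ball y r \<inter> Q -` W)"
    using emeasure_haar_ball[OF QW r, of p] y by (simp add: E_def Int_commute)
  finally show ?thesis .
qed

section \<open>Moments of the random walk by inverse branches\<close>

lemma matrix_lower_bound:
  assumes "det (M::real^2^2) \<noteq> 0"
  obtains k where "k > 0" "\<And>v. k * norm v \<le> norm (M *v v)"
proof -
  define N where "N = onorm ((*v) (matrix_inv M)) + 1"
  have N: "N > 0" using onorm_pos_le[of "(*v) (matrix_inv M)"] by (simp add: N_def add_nonneg_pos)
  have "norm v \<le> N * norm (M *v v)" for v
  proof -
    have "v = matrix_inv M *v (M *v v)" using assms by (simp add: matrix_vector_mul_assoc matrix_inv_2(3))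
    then have "norm v \<le> onorm ((*v) (matrix_inv M)) * norm (M *v v)" by (metis norm_le_onorm)
    also have "\<dots> \<le> N * norm (M *v v)" by (intro mult_right_mono) (auto simp: N_def)
    finally show ?thesis .
  qed
  then have "1 / N * norm v \<le> norm (M *v v)" for v using N by (simp add: divide_le_eq mult.commute)
  then show ?thesis using that[of "1 / N"] N by auto
qed

lemma continuous_matrix_inv_tderiv:
  assumes Q: "Q \<in> C1_maps" and nz: "\<And>x. det (tderiv Q x) \<noteq> 0"
  shows "continuous_on UNIV (\<lambda>x. matrix_inv (tderiv Q x))"
proof (rule continuous_at_imp_continuous_on, rule ballI)
  fix x
  show "isCont (\<lambda>x. matrix_inv (tderiv Q x)) x"
  proof (rule isCont_o2[where f = "tderiv Q" and g = matrix_inv])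
    show "isCont (tderiv Q) x"
      using C1_tderiv_continuous[OF Q, of UNIV] by (simp add: continuous_on_eq_continuous_at)
    show "isCont matrix_inv (tderiv Q x)" by (rule isCont_matrix_inv[OF nz])
  qed
qed

lemmas borel_measurable_matrix_inv = borel_measurable_continuous_onI[OF continuous_matrix_inv_tderiv]

lemma isCont_nhds: "isCont f x \<Longrightarrow> (f \<longlongrightarrow> f x) (nhds x)"
  by (simp add: isCont_def tendsto_at_iff_tendsto_nhds)

text \<open>A form of the assumptions on endomorphisms that passes to iterates, as
  \<open>torus_map_iter\<close> shows: the local inverses are replaced by openness and non-vanishing
  determinants.\<close>

locale torus_map =
  fixes P :: "torus2 \<Rightarrow> torus2"
  assumes C1: "P \<in> C1_maps" and det_nz: "\<And>x. det (tderiv P x) \<noteq> 0"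
    and open_map: "\<And>U. open U \<Longrightarrow> open (P ` U)"
    and haar_inv: "distr haar haar P = haar"
begin

text \<open>The bound 1/4 leaves room for another 1/4 when P is replaced by a nearby map; the image
  of the ball then still fits into a chart of radius 1/2.\<close>

lemma chart_radius:
  assumes e: "e > 0"
  obtains r where "0 < r" "r \<le> 1/2" "\<And>z. z \<in> ball y r \<Longrightarrow> norm (tderiv P z - tderiv P y) < e"
    "\<And>z. z \<in> ball y r \<Longrightarrow> dist (P y) (P z) < 1/4"
proof -
  have "isCont (tderiv P) y" "isCont P y"
    using C1_tderiv_continuous[OF C1, of UNIV] C1_continuous[OF C1, of UNIV]
    by (auto simp: continuous_on_eq_continuous_at)
  then obtain r1 r2 where r: "r1 > 0" "\<And>z. dist z y < r1 \<Longrightarrow> dist (tderiv P z) (tderiv P y) < e"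
    "r2 > 0" "\<And>z. dist z y < r2 \<Longrightarrow> dist (P z) (P y) < 1/4"
    unfolding continuous_at_eps_delta using e by (metis zero_less_divide_iff zero_less_numeral zero_less_one)
  show ?thesis
    using r by (intro that[of "min (min r1 r2) (1/2)"]) (auto simp: dist_norm dist_commute)
qed

lemma locally_injective:
  obtains r where "0 < r" "inj_on P (ball y r)"
proof -
  obtain k where k: "k > 0" "\<And>v. k * norm v \<le> norm (tderiv P y *v v)"
    using matrix_lower_bound[OF det_nz[of y]] by blast
  obtain r where r: "0 < r" "r \<le> 1/2" "\<And>z. z \<in> ball y r \<Longrightarrow> norm (tderiv P z - tderiv P y) < k/3"
    "\<And>z. z \<in> ball y r \<Longrightarrow> dist (P y) (P z) < 1/4"
    using chart_radius[of "k/3" y] k(1) by auto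
  obtain p where y: "y = tproj p" using tproj_surj by metis
  obtain p0 where p0: "P y = tproj p0" using tproj_surj by metis
  have im: "P ` ball (tproj p) r \<subseteq> ball (tproj p0) (1/2)"
    using r(4) unfolding y[symmetric] p0[symmetric] by fastforce
  have "inj_on (\<lambda>z. local_section p0 (P (tproj z))) (ball p r)"
    by (rule lift_inj_on[OF C1 im, of "k/3" "tderiv P y"]) (use k r y in \<open>auto intro: less_imp_le\<close>)
  then have "inj_on P (ball y r)"
    unfolding y tproj_ball[symmetric] by (auto simp: inj_on_def)
  then show ?thesis using that r by blast
qed

text \<open>An infinite fibre would accumulate somewhere on the compact torus, against local
  injectivity.\<close>

lemma finite_fibre: "finite (P -` {x})"
proof (rule ccontr)
  assume "infinite (P -` {x})"
  then obtain y where y: "y islimpt P -` {x}"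
    using compact_torus2 unfolding compact_eq_Bolzano_Weierstrass by blast
  obtain r where r: "0 < r" "inj_on P (ball y r)" using locally_injective by blast
  have "infinite (P -` {x} \<inter> ball y r)" using y r(1) unfolding islimpt_eq_infinite_ball by blast
  moreover have "P -` {x} \<inter> ball y r \<subseteq> {z}" if "z \<in> P -` {x} \<inter> ball y r" for z
    using that r(2) by (auto simp: inj_on_def)
  ultimately show False by (metis finite.emptyI finite.insertI finite_subset ex_in_conv)
qed

lemma separated_fibre:
  obtains r where "r > 0" "disjoint_family_on (\<lambda>y. ball y r) (P -` {x})"
proof -
  obtain d where d: "d > 0" "\<And>y z. y \<in> P -` {x} \<Longrightarrow> z \<in> P -` {x} \<Longrightarrow> y \<noteq> z \<Longrightarrow> d \<le> dist y z"
  proof -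
    \<comment> \<open>Inserting 1 keeps the set of distances non-empty when the fibre has at most
      one point.\<close>
    define D where "D = insert 1 ((\<lambda>(y, z). dist y z) ` {p \<in> (P -` {x}) \<times> (P -` {x}). fst p \<noteq> snd p})"
    have fin: "finite D" unfolding D_def using finite_fibre[of x] by simp
    have ne: "D \<noteq> {}" by (simp add: D_def)
    have "\<forall>a\<in>D. 0 < a" by (auto simp: D_def)
    then have "Min D > 0" using Min_gr_iff[OF fin ne] by blast
    moreover have "Min D \<le> dist y z" if "y \<in> P -` {x}" "z \<in> P -` {x}" "y \<noteq> z" for y z
    proof (rule Min_le[OF fin])
      have "(\<lambda>(y, z). dist y z) (y, z) \<in> D"
        unfolding D_def using that by (intro insertI2 imageI) simp
      then show "dist y z \<in> D" by simp
    qed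
    ultimately show ?thesis using that[of "Min D"] by metis
  qed
  have "disjoint_family_on (\<lambda>y. ball y (d/2)) (P -` {x})"
    unfolding disjoint_family_on_def
  proof (intro ballI impI, rule ccontr)
    fix y z assume yz: "y \<in> P -` {x}" "z \<in> P -` {x}" "y \<noteq> z" "ball y (d/2) \<inter> ball z (d/2) \<noteq> {}"
    then obtain w where "dist y w < d/2" "dist z w < d/2" by auto
    then have "dist y z < d" using dist_triangle_less_add[of y w "d/2" z "d/2"] by (simp add: dist_commute)
    then show False using d(2)[OF yz(1-3)] by simp
  qed
  then show ?thesis using that[of "d/2"] d by simp
qed

lemma P_measurable: "P \<in> measurable haar haar" "P \<in> borel_measurable borel"
  using C1_measurable(1)[OF C1] by (simp_all add: measurable_cong_sets[OF sets_haar sets_haar])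

lemma emeasure_vimage:
  assumes "W \<in> sets borel"
  shows "emeasure haar (P -` W) = emeasure haar W"
  using emeasure_distr[OF P_measurable(1), of W] assms by (simp add: haar_inv sets_haar space_haar)

lemma emeasure_haar_ball_pos: "0 < r \<Longrightarrow> 0 < emeasure haar (ball x r)"
proof -
  assume r: "0 < r"
  obtain p where x: "x = tproj p" using tproj_surj by metis
  define s where "s = min r (1/2)"
  have "emeasure haar (ball x s) = emeasure lborel (ball p s)"
    using emeasure_haar_ball[of UNIV s p] x by (simp add: s_def)
  moreover have "emeasure lborel (ball p s) \<noteq> 0"
  proof
    assume "emeasure lborel (ball p s) = 0"
    then have "ball p s \<in> null_sets lborel" by (simp add: null_sets_def)
    then have "negligible (ball p s)" by (simp add: negligible_iff_null_sets null_sets_completionI)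
    then show False using r open_not_negligible[of "ball p s"] by (auto simp: s_def min_def split: if_splits)
  qed
  ultimately have "0 < emeasure haar (ball x s)" by (simp add: zero_less_iff_neq_zero)
  also have "\<dots> \<le> emeasure haar (ball x r)" by (intro emeasure_mono) (auto simp: s_def sets_haar)
  finally show ?thesis .
qed

text \<open>A small ball W about x has the same measure as its preimage. The preimage contains
  disjoint pieces near the points y of the fibre, and the piece at y has at least the measure of W
  divided by l |det|, the determinant being taken at y. The factor l > 1 absorbs the variation of
  the determinant and tends to 1 at the end. An inequality suffices, since the sum of the weights
  will always carry a non-negative coefficient in an upper bound.\<close>

lemma sum_weights_le_1: "(\<Sum>y\<in>P -` {x}. 1 / \<bar>det (tderiv P y)\<bar>) \<le> 1"
proof -
  have "(\<Sum>y\<in>P -` {x}. 1 / \<bar>det (tderiv P y)\<bar>) \<le> l" if l: "l > 1" for l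
  proof -
    define Y where "Y = P -` {x}"
    have Y: "finite Y" unfolding Y_def by (rule finite_fibre)
    obtain r0 where r0: "r0 > 0" "disjoint_family_on (\<lambda>y. ball y r0) Y"
      using separated_fibre[of x] unfolding Y_def by blast
    have "\<exists>r. 0 < r \<and> r \<le> 1/2 \<and> (\<forall>z\<in>ball y r. \<bar>det (tderiv P z)\<bar> \<le> l * \<bar>det (tderiv P y)\<bar> \<and> dist (P y) (P z) < 1/4)" for y
    proof -
      obtain r1 where r1: "0 < r1" "r1 \<le> 1/2" "\<And>z. z \<in> ball y r1 \<Longrightarrow> dist (P y) (P z) < 1/4"
        using chart_radius[of 1 y] by (metis zero_less_one)
      have "continuous_on UNIV (\<lambda>z. \<bar>det (tderiv P z)\<bar>)"
        unfolding det_2 by (intro continuous_intros C1_tderiv_continuous[OF C1])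
      then have "isCont (\<lambda>z. \<bar>det (tderiv P z)\<bar>) y" by (simp add: continuous_on_eq_continuous_at)
      then have "((\<lambda>z. \<bar>det (tderiv P z)\<bar>) \<longlongrightarrow> \<bar>det (tderiv P y)\<bar>) (nhds y)"
        by (rule isCont_nhds)
      moreover have "\<bar>det (tderiv P y)\<bar> < l * \<bar>det (tderiv P y)\<bar>" using l det_nz[of y] by simp
      ultimately have "\<forall>\<^sub>F z in nhds y. \<bar>det (tderiv P z)\<bar> < l * \<bar>det (tderiv P y)\<bar>"
        by (rule order_tendstoD)
      then obtain r2 where "r2 > 0" "\<And>z. dist z y < r2 \<Longrightarrow> \<bar>det (tderiv P z)\<bar> < l * \<bar>det (tderiv P y)\<bar>"
        unfolding eventually_nhds_metric by blast
      then show ?thesis using r1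
        by (intro exI[of _ "min r1 r2"]) (auto simp: dist_commute less_imp_le)
    qed
    then obtain r where r: "\<And>y. 0 < r y" "\<And>y. r y \<le> 1/2"
      "\<And>y z. z \<in> ball y (r y) \<Longrightarrow> \<bar>det (tderiv P z)\<bar> \<le> l * \<bar>det (tderiv P y)\<bar>"
      "\<And>y z. z \<in> ball y (r y) \<Longrightarrow> dist (P y) (P z) < 1/4"
      by metis
    define \<rho> where "\<rho> y = min r0 (r y)" for y
    have \<rho>: "\<rho> y > 0" "\<rho> y \<le> 1/2" "ball y (\<rho> y) \<subseteq> ball y (r y)" "ball y (\<rho> y) \<subseteq> ball y r0" for y
      using r0 r(1,2)[of y] by (auto simp: \<rho>_def)
    \<comment> \<open>The fibre is finite and P is open, so one ball about x lies in the images of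
      all the pieces.\<close>
    have "open (\<Inter>y\<in>Y. P ` ball y (\<rho> y))"
      using Y by (intro open_INT ballI open_map) auto
    moreover have "x \<in> (\<Inter>y\<in>Y. P ` ball y (\<rho> y))"
      using \<rho>(1) by (force simp: Y_def)
    ultimately obtain k where k: "k > 0" "ball x k \<subseteq> (\<Inter>y\<in>Y. P ` ball y (\<rho> y))"
      using openE by blast
    define W where "W = ball x k"
    have W: "W \<in> sets borel" by (simp add: W_def)
    have PW: "P -` W \<in> sets borel" using measurable_sets[OF P_measurable(2) W] by simp
    define m where "m = measure haar W"
    interpret H: prob_space haar by standard (simp add: space_haar emeasure_haar_UNIV)
    have em: "emeasure haar W = ennreal m" unfolding m_def by (rule H.emeasure_eq_measure)
    then have m: "m > 0" using emeasure_haar_ball_pos[OF k(1), of x] by (simp add: W_def)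
    have loc: "m / (l * \<bar>det (tderiv P y)\<bar>) \<le> measure haar (ball y (\<rho> y) \<inter> P -` W)" if y: "y \<in> Y" for y
    proof -
      have d: "0 < l * \<bar>det (tderiv P y)\<bar>" using l det_nz[of y] by simp
      have im: "P ` ball y (\<rho> y) \<subseteq> ball x (1/2)"
      proof
        fix w assume "w \<in> P ` ball y (\<rho> y)"
        then obtain z where "z \<in> ball y (r y)" "w = P z" using \<rho>(3)[of y] by blast
        then show "w \<in> ball x (1/2)" using r(4)[of z y] y by (simp add: Y_def)
      qed
      have "emeasure haar W \<le> ennreal (l * \<bar>det (tderiv P y)\<bar>) * emeasure haar (ball y (\<rho> y) \<inter> P -` W)"
      proof (rule image_local[OF C1 im \<rho>(2) _ _ W])
        show "\<bar>det (tderiv P z)\<bar> \<le> l * \<bar>det (tderiv P y)\<bar>" if "z \<in> ball y (\<rho> y)" for z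
          using r(3)[of z y] \<rho>(3)[of y] that by blast
        show "0 \<le> l * \<bar>det (tderiv P y)\<bar>" using d by simp
        show "W \<subseteq> P ` ball y (\<rho> y)" using k(2) y by (auto simp: W_def)
      qed
      then have "m \<le> l * \<bar>det (tderiv P y)\<bar> * measure haar (ball y (\<rho> y) \<inter> P -` W)"
        unfolding em H.emeasure_eq_measure using d m by (simp add: ennreal_mult[symmetric] m_def)
      then show ?thesis using d by (simp add: divide_le_eq mult.commute)
    qed
    have "(\<Sum>y\<in>Y. m / (l * \<bar>det (tderiv P y)\<bar>)) \<le> (\<Sum>y\<in>Y. measure haar (ball y (\<rho> y) \<inter> P -` W))"
      by (intro sum_mono loc)
    also have "\<dots> = measure haar (\<Union>y\<in>Y. ball y (\<rho> y) \<inter> P -` W)"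
    proof (rule H.finite_measure_finite_Union[symmetric, OF Y])
      show "(\<lambda>y. ball y (\<rho> y) \<inter> P -` W) ` Y \<subseteq> sets haar" using PW by (auto simp: sets_haar)
      show "disjoint_family_on (\<lambda>y. ball y (\<rho> y) \<inter> P -` W) Y"
        using r0(2) \<rho>(4) unfolding disjoint_family_on_def by blast
    qed
    also have "\<dots> \<le> measure haar (P -` W)" using PW by (intro H.finite_measure_mono) (auto simp: sets_haar)
    also have "\<dots> = m" using emeasure_vimage[OF W] by (simp add: m_def measure_def)
    finally have "m / l * (\<Sum>y\<in>Y. 1 / \<bar>det (tderiv P y)\<bar>) \<le> m"
      by (simp add: sum_distrib_left)
    then have "(\<Sum>y\<in>Y. 1 / \<bar>det (tderiv P y)\<bar>) \<le> l" using m l by (simp add: field_simps)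
    then show ?thesis by (simp add: Y_def)
  qed
  then show ?thesis by (rule dense_ge)
qed

end

text \<open>Pointwise closeness, measured with the Euclidean norm of matrices, which spares suprema
  and operator norms in the estimates. \<open>C1_dist_near\<close> links it to the metric.\<close>

definition C1_near :: "real \<Rightarrow> (torus2 \<Rightarrow> torus2) \<Rightarrow> (torus2 \<Rightarrow> torus2) \<Rightarrow> bool" where
  "C1_near e P Q \<longleftrightarrow> (\<forall>x. dist (P x) (Q x) < e \<and> norm (tderiv P x - tderiv Q x) < e)"

lemma C1_near_mono: "C1_near d P Q \<Longrightarrow> d \<le> e \<Longrightarrow> C1_near e P Q"
  unfolding C1_near_def by (meson less_le_trans)

text \<open>The integrated form of a negative moment bound for the random walk by inverse branches. It makes
  no mention of preimages, so it iterates by substitution.\<close>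

definition moment_contraction :: "(torus2 \<Rightarrow> torus2) \<Rightarrow> real \<Rightarrow> real \<Rightarrow> bool" where
  "moment_contraction Q s S \<longleftrightarrow> (\<forall>\<xi> \<in> borel_measurable borel. (\<forall>x. \<xi> x \<noteq> (0::real^2)) \<longrightarrow>
    (\<integral>\<^sup>+y. ennreal (norm (matrix_inv (tderiv Q y) *v \<xi> (Q y)) powr - s) \<partial>haar)
      \<le> ennreal S * (\<integral>\<^sup>+x. ennreal (norm (\<xi> x) powr - s) \<partial>haar))"

text \<open>A strict inequality for a finite sum leaves room \<eta> in every factor. In
  \<open>moment_local\<close> this room pays for replacing P by Q and v0 by nearby vectors.\<close>

lemma fibre_sum_perturb:
  fixes a b :: "'a \<Rightarrow> real"
  assumes "finite Y" "(\<Sum>y\<in>Y. a y * b y) < S"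
  obtains \<eta> where "\<eta> > 0" "(\<Sum>y\<in>Y. (a y + \<eta>) * (b y + \<eta>)) < S"
proof -
  have "((\<lambda>\<eta>. \<Sum>y\<in>Y. (a y + \<eta>) * (b y + \<eta>)) \<longlongrightarrow> (\<Sum>y\<in>Y. (a y + 0) * (b y + 0))) (at_right 0)"
    by (intro tendsto_intros)
  then have "\<forall>\<^sub>F \<eta> in at_right 0. (\<Sum>y\<in>Y. (a y + \<eta>) * (b y + \<eta>)) < S"
    using assms(2) by (intro order_tendstoD) auto
  moreover have "\<forall>\<^sub>F \<eta>::real in at_right 0. \<eta> > 0" by (simp add: eventually_at_right_less)
  ultimately have "\<forall>\<^sub>F \<eta> in at_right 0. \<eta> > 0 \<and> (\<Sum>y\<in>Y. (a y + \<eta>) * (b y + \<eta>)) < S"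
    by eventually_elim simp
  then show ?thesis using that eventually_happens[of _ "at_right (0::real)"] by auto
qed

lemma powr_norm_inv_continuous:
  assumes "det (M::real^2^2) \<noteq> 0" "v \<noteq> 0" "\<eta> > 0"
  obtains e where "e > 0" "\<And>N w. norm (N - M) < e \<Longrightarrow> dist w v < e \<Longrightarrow>
      det N \<noteq> 0 \<and> 1 / \<bar>det N\<bar> \<le> 1 / \<bar>det M\<bar> + \<eta> \<and> norm (matrix_inv N *v w) powr - s \<le> norm (matrix_inv M *v v) powr - s + \<eta>"
proof -
  define g where "g p = norm (matrix_inv (fst p) *v snd p) powr - s" for p :: "(real^2^2) \<times> (real^2)"
  have nz: "matrix_inv M *v v \<noteq> 0"
  proof
    assume "matrix_inv M *v v = 0"
    then have "M *v (matrix_inv M *v v) = 0" by simp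
    then show False using assms by (simp add: matrix_vector_mul_assoc matrix_inv_2(2))
  qed
  have sn: "(snd \<longlongrightarrow> v) (nhds (M, v))" using tendsto_snd[OF filterlim_ident, of "(M, v)"] by simp
  have fs: "(fst \<longlongrightarrow> M) (nhds (M, v))" using tendsto_fst[OF filterlim_ident, of "(M, v)"] by simp
  have mi: "((\<lambda>p. matrix_inv (fst p)) \<longlongrightarrow> matrix_inv M) (nhds (M, v))"
  proof -
    have "(matrix_inv \<longlongrightarrow> matrix_inv M) (nhds M)"
      by (rule isCont_nhds[OF isCont_matrix_inv[OF assms(1)]])
    then show ?thesis using fs by (rule filterlim_compose)
  qed
  have "((\<lambda>p. matrix_inv (fst p) *v snd p) \<longlongrightarrow> matrix_inv M *v v) (nhds (M, v))"
    unfolding matrix_vector_mult_def by (intro tendsto_vec_lambda tendsto_sum tendsto_mult tendsto_vec_nth mi sn)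
  then have "(g \<longlongrightarrow> g (M, v)) (nhds (M, v))"
    unfolding g_def using nz by (intro tendsto_powr tendsto_norm tendsto_const) auto
  then have 1: "\<forall>\<^sub>F p in nhds (M, v). g p < g (M, v) + \<eta>"
    by (rule order_tendstoD) (use assms in simp)
  have dt: "((\<lambda>p. det (fst p)) \<longlongrightarrow> det M) (nhds (M, v))"
    unfolding det_2 by (intro tendsto_intros fs)
  then have 2: "\<forall>\<^sub>F p in nhds (M, v). det (fst p) \<noteq> 0"
    using assms by (intro tendsto_imp_eventually_ne)
  have "((\<lambda>p. 1 / \<bar>det (fst p)\<bar>) \<longlongrightarrow> 1 / \<bar>det M\<bar>) (nhds (M, v))"
    using dt assms by (intro tendsto_intros) auto
  then have 3: "\<forall>\<^sub>F p in nhds (M, v). 1 / \<bar>det (fst p)\<bar> < 1 / \<bar>det M\<bar> + \<eta>"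
    by (rule order_tendstoD) (use assms in simp)
  have "\<forall>\<^sub>F p in nhds (M, v). det (fst p) \<noteq> 0 \<and> 1 / \<bar>det (fst p)\<bar> < 1 / \<bar>det M\<bar> + \<eta> \<and> g p < g (M, v) + \<eta>"
    using 1 2 3 by eventually_elim simp
  then obtain d where d: "d > 0" "\<And>p. dist p (M, v) < d \<Longrightarrow>
      det (fst p) \<noteq> 0 \<and> 1 / \<bar>det (fst p)\<bar> < 1 / \<bar>det M\<bar> + \<eta> \<and> g p < g (M, v) + \<eta>"
    unfolding eventually_nhds_metric by blast
  show ?thesis
  proof (rule that[of "d/2"])
    fix N :: "real^2^2" and w :: "real^2" assume "norm (N - M) < d/2" "dist w v < d/2"
    then have "dist (N, w) (M, v) < d"
      using sqrt_sum_squares_le_sum[of "dist N M" "dist w v"]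
      unfolding dist_Pair_Pair by (simp add: dist_norm[symmetric])
    from d(2)[OF this] show "det N \<noteq> 0 \<and> 1 / \<bar>det N\<bar> \<le> 1 / \<bar>det M\<bar> + \<eta> \<and>
        norm (matrix_inv N *v w) powr - s \<le> norm (matrix_inv M *v v) powr - s + \<eta>"
      by (simp add: g_def less_imp_le)
  qed (use d in simp)
qed

context torus_map begin

text \<open>The fibrewise moment E |A v|^(-s) of the random walk by inverse branches started at
  x.\<close>

definition moment :: "real \<Rightarrow> torus2 \<Rightarrow> real^2 \<Rightarrow> real" where
  "moment s x v = (\<Sum>y\<in>P -` {x}. norm (matrix_inv (tderiv P y) *v v) powr - s / \<bar>det (tderiv P y)\<bar>)"

text \<open>When h lives where x is near x0 and v x is near v0, every point that Q sends into the
  support of h lies in a chart about a point of the fibre of P over x0. On each chart both factors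
  of the moment grow by at most \<eta>, and \<open>transfer_local\<close> bounds the integral. Only
  the fibre of P is ever summed over.\<close>

lemma moment_local:
  assumes v0: "v0 \<noteq> 0" and S: "moment s x0 v0 < S"
  shows "\<exists>r>0. \<exists>d>0. \<forall>Q. Q \<in> C1_maps \<longrightarrow> C1_near d P Q \<longrightarrow> (\<forall>x. det (tderiv Q x) \<noteq> 0) \<longrightarrow>
    (\<forall>h v. h \<in> borel_measurable borel \<longrightarrow> v \<in> borel_measurable borel \<longrightarrow>
      (\<forall>x. h x \<noteq> 0 \<longrightarrow> dist x x0 < r \<and> dist (v x) v0 < r) \<longrightarrow>
      (\<integral>\<^sup>+y. h (Q y) * ennreal (norm (matrix_inv (tderiv Q y) *v v (Q y)) powr - s) \<partial>haar)
        \<le> ennreal S * (\<integral>\<^sup>+x. h x \<partial>haar))"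
proof -
  define Y where "Y = P -` {x0}"
  have Y: "finite Y" unfolding Y_def by (rule finite_fibre)
  define M where "M y = tderiv P y" for y
  define a where "a y = norm (matrix_inv (M y) *v v0) powr - s" for y
  define b where "b y = 1 / \<bar>det (M y)\<bar>" for y
  have "(\<Sum>y\<in>Y. a y * b y) < S" using S by (simp add: moment_def Y_def a_def b_def M_def)
  then obtain \<eta> where \<eta>: "\<eta> > 0" "(\<Sum>y\<in>Y. (a y + \<eta>) * (b y + \<eta>)) < S"
    using fibre_sum_perturb[OF Y] by blast
  have ab: "0 \<le> a y" "0 \<le> b y" for y by (auto simp: a_def b_def)
  have "\<exists>e>0. (\<forall>N w. norm (N - M y) < e \<longrightarrow> dist w v0 < e \<longrightarrow>
      1 / \<bar>det N\<bar> \<le> b y + \<eta> \<and> norm (matrix_inv N *v w) powr - s \<le> a y + \<eta>) \<and>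
      (\<forall>v. 3 * e * norm v \<le> norm (M y *v v))" for y
  proof -
    obtain e1 where e1: "e1 > 0" "\<And>N w. norm (N - M y) < e1 \<Longrightarrow> dist w v0 < e1 \<Longrightarrow>
      det N \<noteq> 0 \<and> 1 / \<bar>det N\<bar> \<le> 1 / \<bar>det (M y)\<bar> + \<eta> \<and> norm (matrix_inv N *v w) powr - s \<le> norm (matrix_inv (M y) *v v0) powr - s + \<eta>"
      using powr_norm_inv_continuous[OF det_nz[of y, folded M_def] v0 \<eta>(1)] by metis
    obtain k where k: "k > 0" "\<And>v. k * norm v \<le> norm (M y *v v)"
      using matrix_lower_bound[OF det_nz[of y, folded M_def]] by metis
    have "3 * min e1 (k/3) * norm v \<le> norm (M y *v v)" for v
    proof -
      have "3 * min e1 (k/3) * norm v \<le> k * norm v" by (intro mult_right_mono) auto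
      then show ?thesis using k(2)[of v] by linarith
    qed
    then show ?thesis
      using e1 k(1) by (intro exI[of _ "min e1 (k/3)"]) (auto simp: a_def b_def)
  qed
  then obtain e where e: "\<And>y. e y > 0"
    "\<And>y N w. norm (N - M y) < e y \<Longrightarrow> dist w v0 < e y \<Longrightarrow> 1 / \<bar>det N\<bar> \<le> b y + \<eta>"
    "\<And>y N w. norm (N - M y) < e y \<Longrightarrow> dist w v0 < e y \<Longrightarrow> norm (matrix_inv N *v w) powr - s \<le> a y + \<eta>"
    "\<And>y v. 3 * e y * norm v \<le> norm (M y *v v)"
    by metis
  have "\<exists>r. 0 < r \<and> r \<le> 1/2 \<and> (\<forall>z\<in>ball y r. norm (tderiv P z - M y) < e y / 2 \<and> dist (P y) (P z) < 1/4)" for y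
    using chart_radius[of "e y / 2" y] e(1)[of y] unfolding M_def by (metis half_gt_zero)
  then obtain \<rho> where \<rho>: "\<And>y. 0 < \<rho> y" "\<And>y. \<rho> y \<le> 1/2" "\<And>y z. z \<in> ball y (\<rho> y) \<Longrightarrow> norm (tderiv P z - M y) < e y / 2"
    "\<And>y z. z \<in> ball y (\<rho> y) \<Longrightarrow> dist (P y) (P z) < 1/4"
    by metis
  \<comment> \<open>By compactness P keeps a positive distance 2 k from x0 outside the charts. One
    half is reserved for the size of the support of h, the other for the distance between P and
    Q.\<close>
  obtain k where k: "k > 0" "\<And>y. dist (P y) x0 < 2 * k \<Longrightarrow> y \<in> (\<Union>y\<in>Y. ball y (\<rho> y))"
  proof -
    define K where "K = UNIV - (\<Union>y\<in>Y. ball y (\<rho> y))"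
    show ?thesis
    proof (cases "K = {}")
      case True
      then have "y \<in> (\<Union>y\<in>Y. ball y (\<rho> y))" for y unfolding K_def by blast
      then show ?thesis using that[of 1] by simp
    next
      case False
      have "compact (UNIV \<inter> K)"
        by (intro compact_Int_closed compact_torus2) (auto simp: K_def intro!: closed_Diff)
      then have "compact K" by simp
      moreover have "continuous_on K (\<lambda>y. dist (P y) x0)"
        by (intro continuous_intros C1_continuous[OF C1])
      ultimately obtain y0 where y0: "y0 \<in> K" "\<And>y. y \<in> K \<Longrightarrow> dist (P y0) x0 \<le> dist (P y) x0"
        using continuous_attains_inf[of K] False by blast
      have "P y0 \<noteq> x0"
      proof
        assume "P y0 = x0"
        then have "y0 \<in> (\<Union>y\<in>Y. ball y (\<rho> y))"
          using \<rho>(1)[of y0] by (intro UN_I[of y0]) (auto simp: Y_def)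
        then show False using y0(1) by (simp add: K_def)
      qed
      then show ?thesis
      proof (intro that[of "dist (P y0) x0 / 2"])
        fix y assume "dist (P y) x0 < 2 * (dist (P y0) x0 / 2)"
        then have "y \<notin> K" using y0(2)[of y] by auto
        then show "y \<in> (\<Union>y\<in>Y. ball y (\<rho> y))" by (simp add: K_def)
      qed simp
    qed
  qed
  define e0 where "e0 = Min (insert 1 (e ` Y))"
  have e0: "e0 > 0" "\<And>y. y \<in> Y \<Longrightarrow> e0 \<le> e y"
    using Y e(1) by (auto simp: e0_def)
  define r where "r = min k e0"
  \<comment> \<open>The three bounds keep the derivative of Q within e y of M y, the points with Q z
    near x0 inside the charts, and the image of each chart inside the ball of radius 1/2.\<close>
  define d where "d = min (min (e0/2) k) (1/4)"
  have rd: "r > 0" "d > 0" using k e0 by (auto simp: r_def d_def)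
  show ?thesis
  proof (rule exI[of _ r], intro conjI rd(1), rule exI[of _ d], intro conjI rd(2) allI impI)
    fix Q and h :: "torus2 \<Rightarrow> ennreal" and v
    assume Q: "Q \<in> C1_maps" and C1_near: "C1_near d P Q" and nz: "\<forall>x. det (tderiv Q x) \<noteq> 0"
      and h [measurable]: "h \<in> borel_measurable borel" and v [measurable]: "v \<in> borel_measurable borel"
      and supp: "\<forall>x. h x \<noteq> 0 \<longrightarrow> dist x x0 < r \<and> dist (v x) v0 < r"
    have dist_PQ: "dist (P y) (Q y) < d" "norm (tderiv P y - tderiv Q y) < d" for y
      using C1_near by (auto simp: C1_near_def)
    have [measurable]: "Q \<in> borel_measurable borel" by (rule C1_measurable[OF Q])
    have DQ: "norm (tderiv Q z - M y) < e y" if "y \<in> Y" "z \<in> ball y (\<rho> y)" for y z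
    proof -
      have "norm (tderiv Q z - M y) \<le> norm (tderiv P z - tderiv Q z) + norm (tderiv P z - M y)"
        using norm_triangle_ineq4[of "tderiv P z - M y" "tderiv P z - tderiv Q z"] by (simp add: algebra_simps)
      also have "\<dots> < d + e y / 2" using dist_PQ(2)[of z] \<rho>(3)[OF that(2)] by simp
      also have "\<dots> \<le> e y" using e0(2)[OF that(1)] by (simp add: d_def min_def)
      finally show ?thesis .
    qed
    have loc: "(\<integral>\<^sup>+z. h (Q z) * indicator (ball y (\<rho> y)) z \<partial>haar) \<le> ennreal (b y + \<eta>) * (\<integral>\<^sup>+x. h x \<partial>haar)"
      if y: "y \<in> Y" for y
    proof -
      \<comment> \<open>The reciprocal of the enlarged weight is a lower bound for the Jacobian of Q
        on the chart.\<close>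
      define c where "c = 1 / (b y + \<eta>)"
      have bp: "0 < b y + \<eta>" using ab(2)[of y] \<eta>(1) by simp
      have c: "c > 0" using bp by (simp add: c_def)
      have im: "Q ` ball y (\<rho> y) \<subseteq> ball x0 (1/2)"
      proof
        fix w assume "w \<in> Q ` ball y (\<rho> y)"
        then obtain z where z: "z \<in> ball y (\<rho> y)" "w = Q z" by blast
        have "dist (P y) (P z) < 1/4" by (rule \<rho>(4)[OF z(1)])
        moreover have "dist (P z) w < 1/4" using dist_PQ(1)[of z] z by (simp add: d_def)
        ultimately show "w \<in> ball x0 (1/2)"
          using dist_triangle[of "P y" w "P z"] y by (simp add: Y_def)
      qed
      have "ennreal c * (\<integral>\<^sup>+z. h (Q z) * indicator (ball y (\<rho> y)) z \<partial>haar) \<le> (\<integral>\<^sup>+x. h x \<partial>haar)"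
      proof (rule transfer_local[OF Q im \<rho>(2) e(1)[of y] e(4)])
        fix z assume z: "z \<in> ball y (\<rho> y)"
        show "norm (tderiv Q z - M y) \<le> e y" using DQ[OF y z] by simp
        have "1 / \<bar>det (tderiv Q z)\<bar> \<le> b y + \<eta>" using e(2)[OF DQ[OF y z], of v0] e(1)[of y] by simp
        then show "c \<le> \<bar>det (tderiv Q z)\<bar>" using bp nz by (simp add: c_def field_simps)
      qed (use c in auto)
      then have "ennreal (b y + \<eta>) * (ennreal c * (\<integral>\<^sup>+z. h (Q z) * indicator (ball y (\<rho> y)) z \<partial>haar))
          \<le> ennreal (b y + \<eta>) * (\<integral>\<^sup>+x. h x \<partial>haar)" by (rule mult_left_mono) simp
      moreover have "ennreal (b y + \<eta>) * ennreal c = 1"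
        using bp by (simp add: c_def ennreal_mult[symmetric])
      ultimately show ?thesis by (simp add: mult.assoc[symmetric])
    qed
    have [measurable]: "ball y t \<in> sets borel" for y :: torus2 and t by simp
    have "(\<integral>\<^sup>+y. h (Q y) * ennreal (norm (matrix_inv (tderiv Q y) *v v (Q y)) powr - s) \<partial>haar)
      \<le> (\<integral>\<^sup>+z. (\<Sum>y\<in>Y. ennreal (a y + \<eta>) * (h (Q z) * indicator (ball y (\<rho> y)) z)) \<partial>haar)"
    proof (rule nn_integral_mono)
      fix z
      show "h (Q z) * ennreal (norm (matrix_inv (tderiv Q z) *v v (Q z)) powr - s)
        \<le> (\<Sum>y\<in>Y. ennreal (a y + \<eta>) * (h (Q z) * indicator (ball y (\<rho> y)) z))"
      proof (cases "h (Q z) = 0")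
        case False
        then have s1: "dist (Q z) x0 < r" "dist (v (Q z)) v0 < r" using supp by auto
        have "dist (P z) x0 < 2 * k"
          using dist_triangle[of "P z" x0 "Q z"] dist_PQ(1)[of z] s1(1) by (simp add: r_def d_def)
        then obtain y where y: "y \<in> Y" "z \<in> ball y (\<rho> y)" using k(2) by blast
        have "dist (v (Q z)) v0 < e y" using s1(2) e0(2)[OF y(1)] by (simp add: r_def)
        then have "norm (matrix_inv (tderiv Q z) *v v (Q z)) powr - s \<le> a y + \<eta>"
          by (rule e(3)[OF DQ[OF y]])
        then have "h (Q z) * ennreal (norm (matrix_inv (tderiv Q z) *v v (Q z)) powr - s)
          \<le> h (Q z) * ennreal (a y + \<eta>)" by (intro mult_left_mono ennreal_leI) auto
        also have "\<dots> = ennreal (a y + \<eta>) * (h (Q z) * indicator (ball y (\<rho> y)) z)"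
          using y by (simp add: mult.commute)
        also have "\<dots> \<le> (\<Sum>y\<in>Y. ennreal (a y + \<eta>) * (h (Q z) * indicator (ball y (\<rho> y)) z))"
          by (rule member_le_sum[OF y(1) _ Y]) simp
        finally show ?thesis .
      qed simp
    qed
    also have "\<dots> = (\<Sum>y\<in>Y. ennreal (a y + \<eta>) * (\<integral>\<^sup>+z. h (Q z) * indicator (ball y (\<rho> y)) z \<partial>haar))"
    proof -
      have [measurable]: "(\<lambda>z. h (Q z) * indicator (ball y (\<rho> y)) z) \<in> borel_measurable haar" for y
        unfolding borel_measurable_haar by measurable
      show ?thesis by (simp add: nn_integral_sum nn_integral_cmult)
    qed
    also have "\<dots> \<le> (\<Sum>y\<in>Y. ennreal (a y + \<eta>) * (ennreal (b y + \<eta>) * (\<integral>\<^sup>+x. h x \<partial>haar)))"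
      by (intro sum_mono mult_left_mono loc) auto
    also have "\<dots> = ennreal (\<Sum>y\<in>Y. (a y + \<eta>) * (b y + \<eta>)) * (\<integral>\<^sup>+x. h x \<partial>haar)"
      using ab \<eta>(1) by (simp add: sum_distrib_right ennreal_mult mult.assoc flip: sum_ennreal)
    also have "\<dots> \<le> ennreal S * (\<integral>\<^sup>+x. h x \<partial>haar)"
      using \<eta>(2) by (intro mult_right_mono ennreal_leI) auto
    finally show "(\<integral>\<^sup>+y. h (Q y) * ennreal (norm (matrix_inv (tderiv Q y) *v v (Q y)) powr - s) \<partial>haar)
        \<le> ennreal S * (\<integral>\<^sup>+x. h x \<partial>haar)" .
  qed
qed


text \<open>The unit tangent bundle is compact, so finitely many boxes from
  \<open>moment_local\<close> suffice, with the least of their distances. By homogeneity \<xi>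
  splits into its direction v and its length; the power - s of the length becomes the weight h, cut
  into pieces according to the box that contains (x, v x).\<close>

lemma moment_global:
  assumes S: "\<And>x v. norm v = 1 \<Longrightarrow> moment s x v < S"
  shows "\<exists>d>0. \<forall>Q. Q \<in> C1_maps \<longrightarrow> C1_near d P Q \<longrightarrow> (\<forall>x. det (tderiv Q x) \<noteq> 0) \<longrightarrow>
    moment_contraction Q s S"
proof -
  define good where "good Q x0 v0 r \<longleftrightarrow> (\<forall>h v. h \<in> borel_measurable borel \<longrightarrow> v \<in> borel_measurable borel \<longrightarrow>
      (\<forall>x. h x \<noteq> 0 \<longrightarrow> dist x x0 < r \<and> dist (v x) v0 < r) \<longrightarrow>
      (\<integral>\<^sup>+y. h (Q y) * ennreal (norm (matrix_inv (tderiv Q y) *v v (Q y)) powr - s) \<partial>haar)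
        \<le> ennreal S * (\<integral>\<^sup>+x. h x \<partial>haar))" for Q x0 v0 r
  have "\<exists>r>0. \<exists>d>0. \<forall>Q. Q \<in> C1_maps \<longrightarrow> C1_near d P Q \<longrightarrow> (\<forall>x. det (tderiv Q x) \<noteq> 0) \<longrightarrow> good Q x0 v0 r"
    if "norm v0 = 1" for x0 v0
    unfolding good_def using that S[OF that] by (intro moment_local) auto
  then have "\<exists>q. norm (snd p) = 1 \<longrightarrow> fst q > 0 \<and> snd q > 0 \<and> (\<forall>Q. Q \<in> C1_maps \<longrightarrow> C1_near (snd q) P Q \<longrightarrow>
      (\<forall>x. det (tderiv Q x) \<noteq> 0) \<longrightarrow> good Q (fst p) (snd p) (fst q))" for p
    by (metis fst_conv snd_conv)
  then obtain q where q: "\<And>p. norm (snd p) = 1 \<longrightarrow> fst (q p) > 0 \<and> snd (q p) > 0 \<and>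
      (\<forall>Q. Q \<in> C1_maps \<longrightarrow> C1_near (snd (q p)) P Q \<longrightarrow> (\<forall>x. det (tderiv Q x) \<noteq> 0) \<longrightarrow>
        good Q (fst p) (snd p) (fst (q p)))"
    by metis
  define r where "r x0 v0 = fst (q (x0, v0))" for x0 v0
  define d where "d x0 v0 = snd (q (x0, v0))" for x0 v0
  have rd: "\<And>x0 v0. norm v0 = 1 \<Longrightarrow> r x0 v0 > 0" "\<And>x0 v0. norm v0 = 1 \<Longrightarrow> d x0 v0 > 0"
    "\<And>x0 v0 Q. norm v0 = 1 \<Longrightarrow> Q \<in> C1_maps \<Longrightarrow> C1_near (d x0 v0) P Q \<Longrightarrow> \<forall>x. det (tderiv Q x) \<noteq> 0 \<Longrightarrow> good Q x0 v0 (r x0 v0)"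
    using q[of "(_, _)"] unfolding r_def d_def by auto
  define U where "U p = ball (fst p) (r (fst p) (snd p)) \<times> ball (snd p) (r (fst p) (snd p))" for p
  have "compact ((UNIV :: torus2 set) \<times> sphere (0 :: real^2) 1)"
    by (intro compact_Times compact_torus2 compact_sphere)
  moreover have "open (U p)" for p unfolding U_def by (intro open_Times open_ball)
  moreover have "UNIV \<times> sphere 0 1 \<subseteq> (\<Union>p\<in>UNIV \<times> sphere 0 1. U p)"
  proof
    fix p :: "torus2 \<times> (real^2)" assume p: "p \<in> UNIV \<times> sphere 0 1"
    then have "p \<in> U p" using rd(1) by (cases p) (auto simp: U_def)
    then show "p \<in> (\<Union>p\<in>UNIV \<times> sphere 0 1. U p)" using p by blast
  qed
  ultimately obtain C where C: "C \<subseteq> UNIV \<times> sphere 0 1" "finite C" "UNIV \<times> sphere 0 1 \<subseteq> (\<Union>p\<in>C. U p)"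
    by (metis compactE_image)
  define d0 where "d0 = Min (insert 1 ((\<lambda>p. d (fst p) (snd p)) ` C))"
  have d0: "d0 > 0" "\<And>p. p \<in> C \<Longrightarrow> d0 \<le> d (fst p) (snd p)"
    using C(1,2) rd(2) by (auto simp: d0_def)
  obtain c and n :: nat where c: "C = c ` {..<n}"
    using C(2) by (metis finite_imp_nat_seg_image_inj_on lessThan_def)
  show ?thesis
    unfolding moment_contraction_def
  proof (intro exI[of _ d0] conjI d0(1) allI ballI impI)
    fix Q and \<xi> :: "torus2 \<Rightarrow> real^2" assume Q: "Q \<in> C1_maps" and C1_near: "C1_near d0 P Q" and nz: "\<forall>x. det (tderiv Q x) \<noteq> 0"
      and \<xi> [measurable]: "\<xi> \<in> borel_measurable borel" and \<xi>nz: "\<forall>x. \<xi> x \<noteq> (0::real^2)"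
    have [measurable]: "Q \<in> borel_measurable borel" by (rule C1_measurable[OF Q])
    have [measurable]: "(\<lambda>x. matrix_inv (tderiv Q x)) \<in> borel_measurable borel"
      by (rule borel_measurable_matrix_inv[OF Q]) (use nz in blast)
    define v where "v x = \<xi> x /\<^sub>R norm (\<xi> x)" for x
    have v [measurable]: "v \<in> borel_measurable borel" unfolding v_def[abs_def] by measurable
    have nv: "norm (v x) = 1" for x using \<xi>nz by (simp add: v_def)
    define A where "A i = {x. dist x (fst (c i)) < r (fst (c i)) (snd (c i)) \<and> dist (v x) (snd (c i)) < r (fst (c i)) (snd (c i))}" for i
    have [measurable]: "(\<lambda>x. dist x x0) \<in> borel_measurable borel" for x0 :: torus2
      by (intro borel_measurable_continuous_onI continuous_intros)
    have [measurable]: "A i \<in> sets borel" for i unfolding A_def by measurable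
    \<comment> \<open>Disjoint pieces count every point once, so the integrals add up without a
      factor from overlaps.\<close>
    define D where "D = disjointed A"
    have [measurable]: "D i \<in> sets borel" for i unfolding D_def disjointed_def by measurable
    have UD: "(\<Union>i<n. D i) = UNIV"
    proof -
      have "x \<in> (\<Union>i<n. A i)" for x
      proof -
        have "(x, v x) \<in> UNIV \<times> sphere 0 1" using nv by simp
        then obtain p where "p \<in> C" "(x, v x) \<in> U p" using C(3) by blast
        then obtain i where "i < n" "(x, v x) \<in> U (c i)" unfolding c by blast
        then show ?thesis by (auto simp: U_def A_def dist_commute)
      qed
      then show ?thesis unfolding D_def using finite_UN_disjointed_eq[of A n] by (auto simp: atLeast0LessThan)
    qed
    have dD: "disjoint_family D" unfolding D_def by (rule disjoint_family_disjointed)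
    define g where "g x = ennreal (norm (\<xi> x) powr - s)" for x
    have [measurable]: "g \<in> borel_measurable borel" unfolding g_def[abs_def] by measurable
    have split: "g x = (\<Sum>i<n. g x * indicator (D i) x)" for x
    proof -
      obtain i where i: "i < n" "x \<in> D i" using UD by blast
      have "(\<Sum>j<n. g x * indicator (D j) x) = (\<Sum>j\<in>{i}. g x * indicator (D j) x)"
        using i dD by (intro sum.mono_neutral_right) (auto simp: disjoint_family_on_def indicator_def)
      then show ?thesis using i by simp
    qed
    have loc: "(\<integral>\<^sup>+y. g (Q y) * indicator (D i) (Q y) * ennreal (norm (matrix_inv (tderiv Q y) *v v (Q y)) powr - s) \<partial>haar)
        \<le> ennreal S * (\<integral>\<^sup>+x. g x * indicator (D i) x \<partial>haar)" if i: "i < n" for i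
    proof -
      have ci: "c i \<in> C" using i c by blast
      then have "norm (snd (c i)) = 1" using C(1) by auto
      moreover have "C1_near (d (fst (c i)) (snd (c i))) P Q"
        by (rule C1_near_mono[OF C1_near d0(2)[OF ci]])
      ultimately have gd: "good Q (fst (c i)) (snd (c i)) (r (fst (c i)) (snd (c i)))" using rd(3) Q nz by blast
      have "D i \<subseteq> A i" unfolding D_def by (rule disjointed_subset)
      then have "\<forall>x. g x * indicator (D i) x \<noteq> 0 \<longrightarrow> dist x (fst (c i)) < r (fst (c i)) (snd (c i)) \<and>
           dist (v x) (snd (c i)) < r (fst (c i)) (snd (c i))"
        by (auto simp: A_def indicator_def split: if_splits)
      moreover have "(\<lambda>x. g x * indicator (D i) x) \<in> borel_measurable borel" by measurable
      ultimately show ?thesis using gd[unfolded good_def, rule_format, of "\<lambda>x. g x * indicator (D i) x" v] v by simp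
    qed
    have [measurable]: "(\<lambda>y. g (Q y) * indicator (D i) (Q y) * ennreal (norm (matrix_inv (tderiv Q y) *v v (Q y)) powr - s)) \<in> borel_measurable haar"
      "(\<lambda>x. g x * indicator (D i) x) \<in> borel_measurable haar" for i
      unfolding borel_measurable_haar by measurable
    have "(\<integral>\<^sup>+y. ennreal (norm (matrix_inv (tderiv Q y) *v \<xi> (Q y)) powr - s) \<partial>haar)
      = (\<integral>\<^sup>+y. g (Q y) * ennreal (norm (matrix_inv (tderiv Q y) *v v (Q y)) powr - s) \<partial>haar)"
    proof (rule nn_integral_cong)
      fix y
      have "\<xi> (Q y) = norm (\<xi> (Q y)) *\<^sub>R v (Q y)" using \<xi>nz by (simp add: v_def)
      then have "matrix_inv (tderiv Q y) *v \<xi> (Q y) = norm (\<xi> (Q y)) *\<^sub>R (matrix_inv (tderiv Q y) *v v (Q y))"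
        by (metis matrix_vector_mult_scaleR)
      then have "norm (matrix_inv (tderiv Q y) *v \<xi> (Q y)) powr - s
          = norm (\<xi> (Q y)) powr - s * norm (matrix_inv (tderiv Q y) *v v (Q y)) powr - s"
        by (simp add: powr_mult)
      then show "ennreal (norm (matrix_inv (tderiv Q y) *v \<xi> (Q y)) powr - s)
          = g (Q y) * ennreal (norm (matrix_inv (tderiv Q y) *v v (Q y)) powr - s)"
        by (simp add: g_def ennreal_mult)
    qed
    also have "\<dots> = (\<integral>\<^sup>+y. (\<Sum>i<n. g (Q y) * indicator (D i) (Q y) * ennreal (norm (matrix_inv (tderiv Q y) *v v (Q y)) powr - s)) \<partial>haar)"
      by (intro nn_integral_cong) (simp only: sum_distrib_right[symmetric] split[symmetric])
    also have "\<dots> = (\<Sum>i<n. (\<integral>\<^sup>+y. g (Q y) * indicator (D i) (Q y) * ennreal (norm (matrix_inv (tderiv Q y) *v v (Q y)) powr - s) \<partial>haar))"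
      by (rule nn_integral_sum) measurable
    also have "\<dots> \<le> (\<Sum>i<n. ennreal S * (\<integral>\<^sup>+x. g x * indicator (D i) x \<partial>haar))"
      by (intro sum_mono loc) simp
    also have "\<dots> = ennreal S * (\<integral>\<^sup>+x. (\<Sum>i<n. g x * indicator (D i) x) \<partial>haar)"
      by (subst nn_integral_sum) (auto simp: sum_distrib_left)
    also have "\<dots> = ennreal S * (\<integral>\<^sup>+x. g x \<partial>haar)" by (simp only: split[symmetric])
    finally show "(\<integral>\<^sup>+y. ennreal (norm (matrix_inv (tderiv Q y) *v \<xi> (Q y)) powr - s) \<partial>haar)
        \<le> ennreal S * (\<integral>\<^sup>+x. ennreal (norm (\<xi> x) powr - s) \<partial>haar)" by (simp add: g_def)
  qed
qed

end

section \<open>Composition and the \<open>C\<^sup>1\<close> topology\<close>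

text \<open>\<open>has_tderiv_at\<close> allows the lift of f to be taken at the value of the lift
  of g, so that the two lifts compose.\<close>

lemma has_tderiv_compose:
  assumes f: "has_tderiv f A (g x)" and g: "has_tderiv g B x"
  shows "has_tderiv (f \<circ> g) (A ** B) x"
proof -
  obtain p where p: "tproj p = x" using tproj_surj by blast
  obtain w where w: "tproj w = g x" using tproj_surj by blast
  have g': "has_tderiv g B (tproj p)" and wg: "tproj w = g (tproj p)" using g p w by simp_all
  obtain G where G: "G p = w" "\<forall>\<^sub>F z in nhds p. tproj (G z) = g (tproj z)" "(G has_derivative (*v) B) (at p)"
    by (rule has_tderiv_at[OF g' wg])
  obtain u where u: "tproj u = f (tproj w)" using tproj_surj by blast
  have f': "has_tderiv f A (tproj w)" using f w by simp
  obtain F where F: "F w = u" "\<forall>\<^sub>F z in nhds w. tproj (F z) = f (tproj z)" "(F has_derivative (*v) A) (at w)"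
    by (rule has_tderiv_at[OF f' u])
  have Gc: "filterlim G (nhds w) (nhds p)"
    using isCont_nhds[OF has_derivative_continuous[OF G(3)]] G(1) by simp
  have "\<forall>\<^sub>F z in nhds p. tproj (F (G z)) = f (tproj (G z))"
    by (rule eventually_compose_filterlim[OF F(2) Gc])
  then have 1: "\<forall>\<^sub>F z in nhds p. tproj ((F \<circ> G) z) = (f \<circ> g) (tproj z)"
    using G(2) by eventually_elim simp
  have "(F has_derivative (*v) A) (at (G p))" using F(3) G(1) by simp
  from diff_chain_at[OF G(3) this] have "((F \<circ> G) has_derivative (\<lambda>v. (A ** B) *v v)) (at p)"
    by (simp add: o_def matrix_vector_mul_assoc)
  then show ?thesis using 1 p unfolding has_tderiv_def by blast
qed

lemma has_tderiv_ident: "has_tderiv (\<lambda>x. x) (mat 1) x"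
proof -
  obtain p where "tproj p = x" using tproj_surj by blast
  moreover have "((\<lambda>z::real^2. z) has_derivative (\<lambda>v. mat 1 *v v)) (at p)"
  proof -
    have eq: "(*v) (mat 1) = (\<lambda>v::real^2. v)" by (simp add: fun_eq_iff)
    show ?thesis unfolding eq by (rule has_derivative_ident)
  qed
  ultimately show ?thesis unfolding has_tderiv_def
    by (intro exI[of _ "\<lambda>z. z"] exI[of _ p] conjI always_eventually allI refl)
qed

lemma has_tderiv_cong:
  assumes f: "has_tderiv f A x" and U: "open U" "x \<in> U" "\<And>y. y \<in> U \<Longrightarrow> f y = g y"
  shows "has_tderiv g A x"
proof -
  obtain F p where F: "tproj p = x" "\<forall>\<^sub>F q in nhds p. tproj (F q) = f (tproj q)"
    "(F has_derivative (\<lambda>v. A *v v)) (at p)"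
    using f unfolding has_tderiv_def by blast
  have "open (tproj -` U)" using U(1) open_torus2_iff by blast
  then have "\<forall>\<^sub>F q in nhds p. q \<in> tproj -` U"
    using U(2) F(1) by (intro eventually_nhds_in_open) auto
  then have "\<forall>\<^sub>F q in nhds p. tproj (F q) = g (tproj q)"
    using F(2) by eventually_elim (use U(3) in auto)
  then show ?thesis using F unfolding has_tderiv_def by blast
qed

lemma bounded_bilinear_matrix_mult: "bounded_bilinear ((**) :: real^2^2 \<Rightarrow> real^2^2 \<Rightarrow> real^2^2)"
proof -
  have "bilinear ((**) :: real^2^2 \<Rightarrow> real^2^2 \<Rightarrow> real^2^2)"
    unfolding bilinear_def
    by (auto intro!: linearI simp: vec_eq_iff matrix_matrix_mult_def sum_2 algebra_simps)
  then show ?thesis by (simp add: bilinear_conv_bounded_bilinear)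
qed

lemma tderiv_compose:
  assumes "f \<in> C1_maps" "g \<in> C1_maps"
  shows "tderiv (f \<circ> g) x = tderiv f (g x) ** tderiv g x"
  by (intro tderiv_eq has_tderiv_compose C1_has_tderiv assms)

lemma C1_maps_compose:
  assumes "f \<in> C1_maps" "g \<in> C1_maps"
  shows "f \<circ> g \<in> C1_maps"
proof -
  have "tderiv (f \<circ> g) = (\<lambda>x. tderiv f (g x) ** tderiv g x)"
    using tderiv_compose[OF assms] by (simp add: fun_eq_iff)
  moreover have "continuous_on UNIV (\<lambda>x. tderiv f (g x) ** tderiv g x)"
  proof (rule bounded_bilinear.continuous_on[OF bounded_bilinear_matrix_mult])
    show "continuous_on UNIV (\<lambda>x. tderiv f (g x))"
      by (rule continuous_on_compose2[OF C1_tderiv_continuous[OF assms(1), of UNIV] C1_continuous[OF assms(2)]]) simp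
    show "continuous_on UNIV (tderiv g)" by (rule C1_tderiv_continuous[OF assms(2)])
  qed
  ultimately show ?thesis
    unfolding C1_maps_def C1_on_def
    using has_tderiv_compose[OF C1_has_tderiv[OF assms(1)] C1_has_tderiv[OF assms(2)]] by auto
qed

lemma tderiv_id: "tderiv id x = mat 1"
  by (rule tderiv_eq) (use has_tderiv_ident in \<open>simp add: id_def\<close>)

lemma C1_maps_id: "id \<in> C1_maps"
proof -
  have "tderiv id = (\<lambda>x. mat 1)" by (simp add: fun_eq_iff tderiv_id)
  then show ?thesis
    unfolding C1_maps_def C1_on_def using has_tderiv_ident by (auto simp: id_def)
qed

lemma C1_maps_iter: "f \<in> C1_maps \<Longrightarrow> f ^^ n \<in> C1_maps"
  by (induction n) (auto intro: C1_maps_compose C1_maps_id)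

lemma tderiv_iter_add:
  assumes "f \<in> C1_maps"
  shows "tderiv (f ^^ (m + n)) x = tderiv (f ^^ n) ((f ^^ m) x) ** tderiv (f ^^ m) x"
  using tderiv_compose[OF C1_maps_iter[OF assms, of n] C1_maps_iter[OF assms, of m], of x]
  by (simp add: funpow_add[symmetric] add.commute)

text \<open>The local inverse is differentiable too, and the chain rule for g \<circ> f, which is
  the identity near x, makes the derivative of f invertible.\<close>

lemma local_diffeo_det:
  assumes "C1_local_diffeo f"
  shows "det (tderiv f x) \<noteq> 0"
proof -
  obtain U g where U: "x \<in> U" "open U" "open (f ` U)" "homeomorphism U (f ` U) f g" "C1_on U f" "C1_on (f ` U) g"
    using assms unfolding C1_local_diffeo_def by meson
  have f: "has_tderiv f (tderiv f x) x" by (rule C1_has_tderiv[OF C1_local_diffeo_imp_C1[OF assms]])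
  obtain B where B: "has_tderiv g B (f x)" using U(1,6) unfolding C1_on_def by blast
  have "has_tderiv (\<lambda>y. y) (B ** tderiv f x) x"
    by (rule has_tderiv_cong[OF has_tderiv_compose[OF B f] U(2,1)])
      (use U(4) in \<open>auto simp: homeomorphism_def\<close>)
  then have "B ** tderiv f x = mat 1" using has_tderiv_unique has_tderiv_ident by blast
  then have "det B * det (tderiv f x) = 1" by (metis det_mul det_I)
  then show ?thesis by auto
qed

lemma local_diffeo_open:
  assumes "C1_local_diffeo f" "open W"
  shows "open (f ` W)"
proof (subst open_subopen, rule ballI)
  fix z assume "z \<in> f ` W"
  then obtain x where x: "x \<in> W" "z = f x" by blast
  obtain U g where U: "x \<in> U" "open U" "open (f ` U)" "homeomorphism U (f ` U) f g"
    using assms(1) unfolding C1_local_diffeo_def by meson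
  have g: "continuous_on (f ` U) g" "\<And>y. y \<in> U \<Longrightarrow> g (f y) = y"
    using U(4) by (auto simp: homeomorphism_def)
  have "open (g -` (W \<inter> U) \<inter> f ` U)"
    using g(1) U(3) open_Int[OF assms(2) U(2)] continuous_on_open_vimage by blast
  moreover have "g -` (W \<inter> U) \<inter> f ` U = f ` (W \<inter> U)"
    using g(2) by (auto simp: image_iff)
  ultimately show "\<exists>T. open T \<and> z \<in> T \<and> T \<subseteq> f ` W"
    using x U(1) by (intro exI[of _ "f ` (W \<inter> U)"]) auto
qed

lemma End1_torus_map:
  assumes "f \<in> End1"
  shows "torus_map f"
proof -
  have f: "C1_local_diffeo f" "distr haar haar f = haar" using assms by (auto simp: End1_def)
  show ?thesis
    by (rule torus_map.intro) (use f in \<open>simp_all add: C1_local_diffeo_imp_C1 local_diffeo_det local_diffeo_open\<close>)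
qed

lemma torus_map_iter:
  assumes "torus_map f"
  shows "torus_map (f ^^ n)"
proof (induction n)
  case 0
  show ?case
    by (rule torus_map.intro) (simp_all add: C1_maps_id[unfolded id_def] tderiv_id[unfolded id_def] id_def distr_id)
next
  case (Suc n)
  interpret f: torus_map f by fact
  interpret fn: torus_map "f ^^ n" by fact
  have "distr (distr haar haar (f ^^ n)) haar f = distr haar haar (f \<circ> f ^^ n)"
    by (rule distr_distr[OF f.P_measurable(1) fn.P_measurable(1)])
  then have "distr haar haar (f \<circ> f ^^ n) = haar" by (simp add: f.haar_inv fn.haar_inv)
  moreover have "open ((f \<circ> f ^^ n) ` U)" if "open U" for U
    unfolding image_comp[symmetric] by (intro f.open_map fn.open_map that)
  moreover have "det (tderiv (f \<circ> f ^^ n) x) \<noteq> 0" for x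
    unfolding tderiv_compose[OF f.C1 fn.C1] det_mul using f.det_nz fn.det_nz by simp
  ultimately show ?case
    unfolding funpow.simps by (intro torus_map.intro C1_maps_compose[OF f.C1 fn.C1])
qed

lemma prob_space_haar: "prob_space haar"
  by standard (simp add: space_haar emeasure_haar_UNIV)

lemma torus_map_mpt:
  assumes "torus_map f"
  shows "mpt haar f"
proof -
  interpret torus_map f by fact
  show ?thesis
    by (intro mpt.intro mpt_axioms.intro prob_space_haar P_measurable(1) haar_inv)
qed

text \<open>The difference of the derivatives is split as (A - A') B + A' (B - B'). As P is
  evaluated at Q x but P' at Q' x, the values and the first difference also need the uniform
  continuity of P and of its derivative on the compact torus.\<close>

lemma C1_near_compose:
  assumes P: "P \<in> C1_maps" and Q: "Q \<in> C1_maps" and e: "e > 0"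
  shows "\<exists>d>0. \<forall>P' Q'. C1_near d P P' \<longrightarrow> C1_near d Q Q' \<longrightarrow> P' \<in> C1_maps \<longrightarrow> Q' \<in> C1_maps \<longrightarrow> C1_near e (P \<circ> Q) (P' \<circ> Q')"
proof -
  obtain K where K: "K > 0" "\<And>A B. norm ((A::real^2^2) ** (B::real^2^2)) \<le> norm A * norm B * K"
    using bounded_bilinear.pos_bounded[OF bounded_bilinear_matrix_mult] by metis
  have bi_bounded: "\<exists>C>0. \<forall>x. norm (tderiv f x) \<le> C" if "f \<in> C1_maps" for f
  proof -
    have "compact (range (tderiv f))"
      by (rule compact_continuous_image[OF C1_tderiv_continuous[OF that] compact_torus2])
    then have "bounded (range (tderiv f))" by (rule compact_imp_bounded)
    then show ?thesis unfolding bounded_pos by auto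
  qed
  obtain a where a: "a > 0" "\<And>x. norm (tderiv P x) \<le> a" using bi_bounded[OF P] by blast
  obtain b where b: "b > 0" "\<And>x. norm (tderiv Q x) \<le> b" using bi_bounded[OF Q] by blast
  \<comment> \<open>The derivatives will differ by at most 2 \<eta> b K + (a + 2) \<eta> K, where 2
    \<eta> bounds A - A' and, thanks to \<eta> <= 1, a + 2 bounds A'. The denominator 4 K (a + b +
    2) majorises the coefficient of \<eta>.\<close>
  define \<eta> where "\<eta> = min 1 (e / (4 * K * (a + b + 2)))"
  have \<eta>: "\<eta> > 0" "\<eta> \<le> 1" using e K(1) a(1) b(1) by (auto simp: \<eta>_def)
  have \<eta>e: "4 * K * (a + b + 2) * \<eta> \<le> e"
  proof -
    have "\<eta> \<le> e / (4 * K * (a + b + 2))" by (simp add: \<eta>_def)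
    moreover have "0 < 4 * K * (a + b + 2)" using K a b by simp
    ultimately show ?thesis by (simp add: le_divide_eq mult.commute)
  qed
  have uc: "uniformly_continuous_on UNIV P" "uniformly_continuous_on UNIV (tderiv P)"
    by (intro compact_uniformly_continuous compact_torus2 C1_continuous C1_tderiv_continuous P)+
  obtain d1 where d1: "d1 > 0" "\<And>x y. dist y x < d1 \<Longrightarrow> dist (P y) (P x) < e/2"
    using uc(1) e unfolding uniformly_continuous_on_def by (metis UNIV_I half_gt_zero)
  obtain d2 where d2: "d2 > 0" "\<And>x y. dist y x < d2 \<Longrightarrow> dist (tderiv P y) (tderiv P x) < \<eta>"
    using uc(2) \<eta>(1) unfolding uniformly_continuous_on_def by (metis UNIV_I)
  define d where "d = min (min d1 d2) (min (e/2) \<eta>)"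
  show ?thesis
  proof (intro exI[of _ d] conjI allI impI)
    show "d > 0" using d1 d2 e \<eta> by (simp add: d_def)
    fix P' Q' assume nP: "C1_near d P P'" and nQ: "C1_near d Q Q'" and C: "P' \<in> C1_maps" "Q' \<in> C1_maps"
    show "C1_near e (P \<circ> Q) (P' \<circ> Q')"
      unfolding C1_near_def
    proof (intro allI conjI)
      fix x
      have q: "dist (Q x) (Q' x) < d1" "dist (Q x) (Q' x) < d2" "norm (tderiv Q x - tderiv Q' x) < \<eta>"
        using nQ by (auto simp: C1_near_def d_def)
      have p: "dist (P (Q' x)) (P' (Q' x)) < e/2" "norm (tderiv P (Q' x) - tderiv P' (Q' x)) < \<eta>"
        using nP by (auto simp: C1_near_def d_def)
      show "dist ((P \<circ> Q) x) ((P' \<circ> Q') x) < e"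
        using dist_triangle[of "P (Q x)" "P' (Q' x)" "P (Q' x)"] d1(2)[OF q(1)] p(1) by simp
      define A where "A = tderiv P (Q x)"
      define A' where "A' = tderiv P' (Q' x)"
      define B where "B = tderiv Q x"
      define B' where "B' = tderiv Q' x"
      have "norm (A - A') \<le> norm (A - tderiv P (Q' x)) + norm (tderiv P (Q' x) - A')"
        using norm_triangle_ineq[of "A - tderiv P (Q' x)" "tderiv P (Q' x) - A'"] by simp
      also have "\<dots> < 2 * \<eta>" using d2(2)[OF q(2)] p(2) by (simp add: A_def A'_def dist_norm)
      finally have AA: "norm (A - A') < 2 * \<eta>" .
      have nA': "norm A' \<le> a + 2"
        using a(2)[of "Q x"] AA \<eta>(2) norm_triangle_ineq2[of A' A] by (simp add: A_def norm_minus_commute)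
      have "norm (tderiv (P \<circ> Q) x - tderiv (P' \<circ> Q') x) = norm ((A - A') ** B + A' ** (B - B'))"
        unfolding tderiv_compose[OF P Q] tderiv_compose[OF C] A_def A'_def B_def B'_def
        by (simp add: bounded_bilinear.diff_left[OF bounded_bilinear_matrix_mult] bounded_bilinear.diff_right[OF bounded_bilinear_matrix_mult])
      also have "\<dots> \<le> norm (A - A') * norm B * K + norm A' * norm (B - B') * K"
        by (rule order_trans[OF norm_triangle_ineq add_mono[OF K(2) K(2)]])
      also have "\<dots> \<le> (2 * \<eta>) * b * K + (a + 2) * \<eta> * K"
        using AA nA' q(3) b(2)[of x] K(1) \<eta>(1) a(1) b(1) unfolding B_def B'_def
        by (intro add_mono mult_right_mono mult_mono) auto
      also have "\<dots> < 4 * K * (a + b + 2) * \<eta>"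
      proof -
        have "0 < 3 * K * a * \<eta> + 6 * K * \<eta> + 2 * K * b * \<eta>"
          using K(1) a(1) b(1) \<eta>(1) by (intro add_pos_pos mult_pos_pos) auto
        then show ?thesis by (simp add: algebra_simps)
      qed
      finally show "norm (tderiv (P \<circ> Q) x - tderiv (P' \<circ> Q') x) < e" using \<eta>e by linarith
    qed
  qed
qed

lemma C1_near_iter:
  assumes f: "f \<in> C1_maps" and e: "e > 0"
  shows "\<exists>d>0. \<forall>g. C1_near d f g \<longrightarrow> g \<in> C1_maps \<longrightarrow> C1_near e (f ^^ n) (g ^^ n)"
  using e
proof (induction n arbitrary: e)
  case 0
  then show ?case by (intro exI[of _ 1]) (simp add: C1_near_def)
next
  case (Suc n)
  obtain d1 where d1: "d1 > 0" "\<And>P' Q'. C1_near d1 f P' \<Longrightarrow> C1_near d1 (f ^^ n) Q' \<Longrightarrow> P' \<in> C1_maps \<Longrightarrow> Q' \<in> C1_maps \<Longrightarrow>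
      C1_near e (f \<circ> f ^^ n) (P' \<circ> Q')"
    using C1_near_compose[OF f C1_maps_iter[OF f, of n] Suc.prems] by blast
  obtain d2 where d2: "d2 > 0" "\<And>g. C1_near d2 f g \<Longrightarrow> g \<in> C1_maps \<Longrightarrow> C1_near d1 (f ^^ n) (g ^^ n)"
    using Suc.IH[OF d1(1)] by blast
  show ?case
  proof (intro exI[of _ "min d1 d2"] conjI allI impI)
    fix g assume "C1_near (min d1 d2) f g" and g: "g \<in> C1_maps"
    then have "C1_near d1 f g" "C1_near d2 f g" by (auto intro: C1_near_mono)
    then show "C1_near e (f ^^ Suc n) (g ^^ Suc n)"
      using d1(2)[OF _ d2(2)[OF _ g] g C1_maps_iter[OF g]] by simp
  qed (use d1 d2 in simp)
qed

lemma norm_le_4_onorm: "norm (A::real^2^2) \<le> 4 * onorm ((*v) A)"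
proof -
  have c: "\<bar>A $ i $ j\<bar> \<le> onorm ((*v) A)" for i j
  proof -
    have "A $ i $ j = (A *v axis j 1) $ i" by (simp add: matrix_vector_mult_basis column_def)
    then have "\<bar>A $ i $ j\<bar> \<le> norm (A *v axis j 1)" by (metis component_le_norm_cart)
    also have "\<dots> \<le> onorm ((*v) A) * norm (axis j (1::real))" by (rule norm_le_onorm)
    finally show ?thesis by simp
  qed
  have "norm A \<le> (\<Sum>i\<in>UNIV. norm (A $ i))" unfolding norm_vec_def[of A] by (rule L2_set_le_sum) simp
  also have "\<dots> \<le> (\<Sum>i\<in>(UNIV::2 set). 2 * onorm ((*v) A))"
  proof (rule sum_mono)
    fix i :: 2
    have "norm (A $ i) \<le> (\<Sum>j\<in>UNIV. \<bar>A $ i $ j\<bar>)" by (rule norm_le_l1_cart)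
    also have "\<dots> \<le> (\<Sum>j\<in>(UNIV::2 set). onorm ((*v) A))" by (intro sum_mono c)
    finally show "norm (A $ i) \<le> 2 * onorm ((*v) A)" by simp
  qed
  finally show ?thesis by simp
qed

text \<open>The metric uses operator norms; the factor 4 is that of
  \<open>norm_le_4_onorm\<close>.\<close>

lemma C1_dist_near:
  assumes f: "f \<in> C1_maps" and g: "g \<in> C1_maps" and d: "C1_dist f g < e / 4"
  shows "C1_near e f g"
  unfolding C1_near_def
proof (intro allI conjI)
  fix x
  have 1: "dist (f x) (g x) \<le> (SUP x. dist (f x) (g x))"
    by (rule cSUP_upper[OF UNIV_I bdd_above_dist_torus2])
  have 2: "onorm (\<lambda>v. (tderiv f x - tderiv g x) *v v) \<le> (SUP x. onorm (\<lambda>v. (tderiv f x - tderiv g x) *v v))"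
    by (rule cSUP_upper[OF UNIV_I bdd_above_onorm_tderiv[OF f g]])
  have 3: "0 \<le> dist (f x) (g x)" "0 \<le> onorm (\<lambda>v. (tderiv f x - tderiv g x) *v v)"
    by (simp_all add: onorm_pos_le)
  have "C1_dist f g = (SUP x. dist (f x) (g x)) + (SUP x. onorm (\<lambda>v. (tderiv f x - tderiv g x) *v v))"
    using f g by (simp add: C1_dist_def)
  then have 4: "dist (f x) (g x) < e / 4" "onorm ((*v) (tderiv f x - tderiv g x)) < e / 4"
    using 1 2 3 d by linarith+
  show "dist (f x) (g x) < e" using 4(1) 3(1) by linarith
  show "norm (tderiv f x - tderiv g x) < e"
    using norm_le_4_onorm[of "tderiv f x - tderiv g x"] 4(2) by linarith
qed

section \<open>Lyapunov exponents of maps with bounded derivative\<close>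

text \<open>With reciprocal constants on the two sides the condition passes to the inverse with the
  same R, and to products with the product of the constants.\<close>

definition bi_bounded :: "real \<Rightarrow> real^2^2 \<Rightarrow> bool" where
  "bi_bounded R M \<longleftrightarrow> (\<forall>v. norm v / R \<le> norm (M *v v) \<and> norm (M *v v) \<le> R * norm v)"

lemma bi_boundedD: "bi_bounded R M \<Longrightarrow> norm v / R \<le> norm (M *v v)" "bi_bounded R M \<Longrightarrow> norm (M *v v) \<le> R * norm v"
  by (auto simp: bi_bounded_def)

lemma bi_bounded_det:
  assumes "bi_bounded R M" "R \<ge> 1"
  shows "det M \<noteq> 0"
proof -
  have "inj ((*v) M)"
  proof (rule injI)
    fix v w assume "M *v v = M *v w"
    then have "M *v (v - w) = 0" by (simp add: matrix_vector_mult_diff_distrib)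
    then have "norm (v - w) / R \<le> 0" using bi_boundedD(1)[OF assms(1), of "v - w"] by simp
    then show "v = w" using assms(2) by (simp add: divide_le_0_iff)
  qed
  then obtain B where "B ** M = mat 1" using matrix_left_invertible_injective by blast
  then have "det B * det M = 1" by (metis det_mul det_I)
  then show ?thesis by auto
qed

lemma bi_bounded_mult:
  assumes "bi_bounded R M" "bi_bounded R' M'" "R \<ge> 1" "R' \<ge> 1"
  shows "bi_bounded (R * R') (M ** M')"
  unfolding bi_bounded_def
proof (intro allI conjI)
  fix v :: "real^2"
  have "norm v / (R * R') = (norm v / R') / R" by simp
  also have "\<dots> \<le> norm (M' *v v) / R" using assms bi_boundedD(1)[OF assms(2)] by (intro divide_right_mono) auto
  also have "\<dots> \<le> norm (M *v (M' *v v))" by (rule bi_boundedD(1)[OF assms(1)])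
  finally show "norm v / (R * R') \<le> norm (M ** M' *v v)" by (simp add: matrix_vector_mul_assoc)
  have "norm (M *v (M' *v v)) \<le> R * norm (M' *v v)" by (rule bi_boundedD(2)[OF assms(1)])
  also have "\<dots> \<le> R * (R' * norm v)" using assms bi_boundedD(2)[OF assms(2)] by (intro mult_left_mono) auto
  finally show "norm (M ** M' *v v) \<le> R * R' * norm v" by (simp add: matrix_vector_mul_assoc mult.assoc)
qed

lemma bi_bounded_inv:
  assumes "bi_bounded R M" "R \<ge> 1"
  shows "bi_bounded R (matrix_inv M)"
  unfolding bi_bounded_def
proof (intro allI conjI)
  fix v
  define w where "w = matrix_inv M *v v"
  have v: "v = M *v w" using bi_bounded_det[OF assms] by (simp add: w_def matrix_vector_mul_assoc matrix_inv_2(2))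
  show "norm v / R \<le> norm (matrix_inv M *v v)"
    using bi_boundedD(2)[OF assms(1), of w] assms(2) unfolding w_def[symmetric] v[symmetric]
    by (simp add: divide_le_eq mult.commute)
  show "norm (matrix_inv M *v v) \<le> R * norm v"
    using bi_boundedD(1)[OF assms(1), of w] assms(2) unfolding w_def[symmetric] v[symmetric]
    by (simp add: divide_le_eq mult.commute)
qed

lemma bi_bounded_ln:
  assumes "bi_bounded R M" "R \<ge> 1" "norm v = 1"
  shows "norm (M *v v) > 0" "\<bar>ln (norm (M *v v))\<bar> \<le> ln R"
proof -
  have 1: "1 / R \<le> norm (M *v v)" "norm (M *v v) \<le> R" using bi_boundedD[OF assms(1), of v] assms(3) by auto
  have "0 < 1 / R" using assms(2) by simp
  then show p: "norm (M *v v) > 0" using 1(1) by (rule less_le_trans)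
  have "ln (1 / R) \<le> ln (norm (M *v v))" using 1(1) \<open>0 < 1 / R\<close> p by (intro ln_mono)
  moreover have "ln (norm (M *v v)) \<le> ln R" using 1(2) p by (intro ln_mono)
  moreover have "ln (1 / R) = - ln R" using assms(2) by (simp add: ln_div)
  ultimately show "\<bar>ln (norm (M *v v))\<bar> \<le> ln R" by simp
qed

lemma bi_bounded_onorm:
  assumes "bi_bounded R M" "R \<ge> 1"
  shows "1 / R \<le> onorm ((*v) M)" "onorm ((*v) M) \<le> R" "0 < onorm ((*v) M)" "\<bar>ln (onorm ((*v) M))\<bar> \<le> ln R"
proof -
  show 1: "1 / R \<le> onorm ((*v) M)"
    using bi_boundedD(1)[OF assms(1), of "axis 1 1"] norm_le_onorm[of M "axis 1 1"] by simp
  show 2: "onorm ((*v) M) \<le> R"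
    using bi_boundedD(2)[OF assms(1)] by (intro onorm_le)
  have R: "0 < 1 / R" using assms(2) by simp
  then show p: "0 < onorm ((*v) M)" using 1 by (rule less_le_trans)
  have "ln (1 / R) \<le> ln (onorm ((*v) M))" using 1 R p by (intro ln_mono)
  moreover have "ln (onorm ((*v) M)) \<le> ln R" using 2 p by (intro ln_mono)
  moreover have "ln (1 / R) = - ln R" using assms(2) by (simp add: ln_div)
  ultimately show "\<bar>ln (onorm ((*v) M))\<bar> \<le> ln R" by simp
qed

text \<open>The determinant is the area spanned by the images of the axes, which gives the upper
  bound. The lower bound is the upper bound for the inverse matrix.\<close>

lemma bi_bounded_det_bounds:
  assumes "bi_bounded R M" "R \<ge> 1"
  shows "1 / R\<^sup>2 \<le> \<bar>det M\<bar>" "\<bar>det M\<bar> \<le> R\<^sup>2" "\<bar>ln \<bar>det M\<bar>\<bar> \<le> 2 * ln R"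
proof -
  have up: "\<bar>det N\<bar> \<le> R\<^sup>2" if N: "bi_bounded R N" for N
  proof -
    have "\<bar>det N\<bar> = \<bar>wedge (N *v axis 1 1) (N *v axis 2 1)\<bar>"
      by (simp add: wedge_mult) (simp add: wedge_def axis_def)
    also have "\<dots> \<le> norm (N *v axis 1 1) * norm (N *v axis 2 1)" by (rule wedge_le)
    also have "\<dots> \<le> R * R"
      using bi_boundedD(2)[OF N, of "axis 1 1"] bi_boundedD(2)[OF N, of "axis 2 1"] assms(2) by (intro mult_mono) auto
    finally show ?thesis by (simp add: power2_eq_square)
  qed
  show 2: "\<bar>det M\<bar> \<le> R\<^sup>2" by (rule up[OF assms(1)])
  have d: "det M \<noteq> 0" by (rule bi_bounded_det[OF assms])
  have "det (matrix_inv M) * det M = 1" using matrix_inv_2(3)[OF d] by (metis det_mul det_I)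
  then have "\<bar>det (matrix_inv M)\<bar> * \<bar>det M\<bar> = 1" by (metis abs_mult abs_one)
  moreover have "\<bar>det (matrix_inv M)\<bar> * \<bar>det M\<bar> \<le> R\<^sup>2 * \<bar>det M\<bar>"
    by (intro mult_right_mono up bi_bounded_inv assms) simp
  ultimately have "1 \<le> R\<^sup>2 * \<bar>det M\<bar>" by simp
  then show 1: "1 / R\<^sup>2 \<le> \<bar>det M\<bar>" using assms(2) by (simp add: divide_le_eq mult.commute)
  have "ln (1 / R\<^sup>2) \<le> ln \<bar>det M\<bar>" using 1 assms(2) d by (intro ln_mono) auto
  moreover have "ln \<bar>det M\<bar> \<le> ln (R\<^sup>2)" using 2 d by (intro ln_mono) auto
  moreover have "ln (R\<^sup>2) = 2 * ln R" using assms(2) by (simp add: ln_realpow)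
  moreover have "ln (1 / R\<^sup>2) = - (2 * ln R)" using assms(2) by (simp add: ln_div ln_realpow)
  ultimately show "\<bar>ln \<bar>det M\<bar>\<bar> \<le> 2 * ln R" by simp
qed

lemma conorm_bdd: "bdd_below ((\<lambda>v. norm (M *v v)) ` sphere 0 1)"
  by (rule bdd_belowI[of _ 0]) auto

lemma conorm_le: "norm v = 1 \<Longrightarrow> conorm M \<le> norm (M *v v)"
  unfolding conorm_def by (intro cINF_lower conorm_bdd) auto

lemma conorm_ge: "(\<And>v. norm v = 1 \<Longrightarrow> c \<le> norm (M *v v)) \<Longrightarrow> c \<le> conorm M"
  unfolding conorm_def by (intro cINF_greatest) auto

lemma conorm_bounds:
  assumes "bi_bounded R M" "R \<ge> 1"
  shows "1 / R \<le> conorm M" "0 < conorm M"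
proof -
  show 1: "1 / R \<le> conorm M" using bi_boundedD(1)[OF assms(1)] by (intro conorm_ge) metis
  show "0 < conorm M" using less_le_trans[OF _ 1] assms(2) by simp
qed

lemma onorm_matrix_inv:
  assumes "bi_bounded R M" "R \<ge> 1"
  shows "onorm ((*v) (matrix_inv M)) = 1 / conorm M"
proof (rule antisym)
  have d: "det M \<noteq> 0" by (rule bi_bounded_det[OF assms])
  have c: "conorm M > 0" by (rule conorm_bounds[OF assms])
  show "onorm ((*v) (matrix_inv M)) \<le> 1 / conorm M"
  proof (rule onorm_le)
    fix u
    define w where "w = matrix_inv M *v u"
    have u: "u = M *v w" using d by (simp add: w_def matrix_vector_mul_assoc matrix_inv_2(2))
    have "conorm M * norm w \<le> norm u"
    proof (cases "w = 0")
      case False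
      have "conorm M \<le> norm (M *v (w /\<^sub>R norm w))" using False by (intro conorm_le) simp
      also have "\<dots> = norm u / norm w"
        unfolding u by (simp only: matrix_vector_mult_scaleR norm_scaleR) (simp add: divide_inverse mult.commute)
      finally show ?thesis using False by (simp add: le_divide_eq)
    qed simp
    then show "norm (matrix_inv M *v u) \<le> 1 / conorm M * norm u"
      using c by (simp add: w_def[symmetric] le_divide_eq mult.commute)
  qed
  have p: "0 < onorm ((*v) (matrix_inv M))" by (rule bi_bounded_onorm[OF bi_bounded_inv[OF assms] assms(2)])
  have "1 / onorm ((*v) (matrix_inv M)) \<le> conorm M"
  proof (rule conorm_ge)
    fix v :: "real^2" assume v: "norm v = 1"
    have "v = matrix_inv M *v (M *v v)" using d by (simp add: matrix_vector_mul_assoc matrix_inv_2(3))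
    then have "1 \<le> onorm ((*v) (matrix_inv M)) * norm (M *v v)"
      using norm_le_onorm[of "matrix_inv M" "M *v v"] v by simp
    then show "1 / onorm ((*v) (matrix_inv M)) \<le> norm (M *v v)"
      using p by (simp add: divide_le_eq mult.commute)
  qed
  then show "1 / conorm M \<le> onorm ((*v) (matrix_inv M))"
    using p c by (simp add: divide_le_eq mult.commute)
qed

lemma ln_conorm:
  assumes "bi_bounded R M" "R \<ge> 1"
  shows "ln (conorm M) = - ln (onorm ((*v) (matrix_inv M)))"
  using conorm_bounds(2)[OF assms] unfolding onorm_matrix_inv[OF assms] by (simp add: ln_div)

lemma conorm_diff: "\<bar>conorm M - conorm M'\<bar> \<le> 2 * norm (M - M')"
proof -
  have "conorm M - 2 * norm (M - M') \<le> conorm M'" for M M'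
  proof (rule conorm_ge)
    fix v :: "real^2" assume v: "norm v = 1"
    have "norm (M *v v) - norm (M' *v v) \<le> norm ((M - M') *v v)"
      unfolding matrix_vector_mult_diff_rdistrib by (rule norm_triangle_ineq2)
    also have "\<dots> \<le> 2 * norm (M - M')"
      using norm_le_onorm[of "M - M'" v] onorm_matrix_le_norm[of "M - M'"] v by simp
    finally show "conorm M - 2 * norm (M - M') \<le> norm (M' *v v)"
      using conorm_le[OF v, of M] by linarith
  qed
  from this[of M M'] this[of M' M] show ?thesis by (simp add: norm_minus_commute abs_le_iff)
qed

lemma ln_diff_abs:
  assumes "k > 0" "k \<le> a" "k \<le> (b::real)"
  shows "\<bar>ln a - ln b\<bar> \<le> \<bar>a - b\<bar> / k"
proof -
  have *: "ln x - ln y \<le> \<bar>x - y\<bar> / k" if "k \<le> x" "k \<le> y" for x y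
  proof -
    have p: "x > 0" "y > 0" using that assms(1) by auto
    have "ln x - ln y = ln (x / y)" using p by (simp add: ln_div)
    also have "\<dots> \<le> x / y - 1" using p by (intro ln_le_minus_one) simp
    also have "\<dots> = (x - y) / y" using p by (simp add: diff_divide_distrib)
    also have "\<dots> \<le> \<bar>x - y\<bar> / y" using p by (intro divide_right_mono) auto
    also have "\<dots> \<le> \<bar>x - y\<bar> / k" using p that assms(1) by (intro divide_left_mono) auto
    finally show ?thesis .
  qed
  from *[OF assms(2,3)] *[OF assms(3,2)] show ?thesis by (simp add: abs_le_iff abs_minus_commute)
qed

lemma matrix_inv_mult:
  assumes "det (A::real^2^2) \<noteq> 0" "det B \<noteq> 0"
  shows "matrix_inv (A ** B) = matrix_inv B ** matrix_inv A"
proof -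
  have d: "det (A ** B) \<noteq> 0" using assms by (simp add: det_mul)
  have "(A ** B) ** (matrix_inv B ** matrix_inv A) = mat 1"
    using assms by (metis matrix_inv_2(2) matrix_mul_assoc matrix_mul_rid)
  then have "matrix_inv (A ** B) ** ((A ** B) ** (matrix_inv B ** matrix_inv A)) = matrix_inv (A ** B)" by simp
  then show ?thesis using matrix_inv_2(3)[OF d] by (metis matrix_mul_assoc matrix_mul_lid)
qed

text \<open>In dimension two \<open>M\<close> and \<open>det M \<cdot> M\<^sup>-\<^sup>1\<close> have the same entries up to sign and order.\<close>

lemma ln_onorm_inv:
  assumes "bi_bounded R M" "R \<ge> 1"
  shows "\<bar>ln (onorm ((*v) M)) - (ln \<bar>det M\<bar> + ln (onorm ((*v) (matrix_inv M))))\<bar> \<le> ln 8"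
proof -
  have d: "det M \<noteq> 0" by (rule bi_bounded_det[OF assms])
  define a where "a = onorm ((*v) M)"
  define b where "b = onorm ((*v) (matrix_inv M))"
  have p: "a > 0" "b > 0"
    unfolding a_def b_def by (rule bi_bounded_onorm[OF assms] bi_bounded_onorm[OF bi_bounded_inv[OF assms] assms(2)])+
  have n: "norm M = \<bar>det M\<bar> * norm (matrix_inv M)"
    unfolding matrix_inv_2(1)[OF d] using d by (simp add: norm_adj2)
  have "a \<le> 2 * norm M" unfolding a_def using onorm_matrix_le_norm[of M] by simp
  also have "\<dots> \<le> \<bar>det M\<bar> * (8 * b)"
    unfolding n b_def using mult_left_mono[OF norm_le_4_onorm[of "matrix_inv M"], of "\<bar>det M\<bar>"] by simp
  finally have 1: "a \<le> 8 * (\<bar>det M\<bar> * b)" by (simp add: mult_ac)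
  have "\<bar>det M\<bar> * b \<le> \<bar>det M\<bar> * (2 * norm (matrix_inv M))"
    unfolding b_def using onorm_matrix_le_norm[of "matrix_inv M"] by (intro mult_left_mono) simp_all
  also have "\<dots> = 2 * norm M" unfolding n by simp
  also have "\<dots> \<le> 8 * a" unfolding a_def using norm_le_4_onorm[of M] by simp
  finally have 2: "\<bar>det M\<bar> * b \<le> 8 * a" .
  have "ln a \<le> ln (8 * (\<bar>det M\<bar> * b))" using 1 p by (intro ln_mono) auto
  also have "\<dots> = ln 8 + (ln \<bar>det M\<bar> + ln b)" using p d by (simp add: ln_mult)
  finally have 3: "ln a \<le> ln 8 + (ln \<bar>det M\<bar> + ln b)" .
  have "ln (\<bar>det M\<bar> * b) \<le> ln (8 * a)" using 2 p d by (intro ln_mono) auto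
  then have "ln \<bar>det M\<bar> + ln b \<le> ln 8 + ln a" using p d by (simp add: ln_mult)
  then show ?thesis using 3 unfolding a_def[symmetric] b_def[symmetric] by (simp add: abs_le_iff)
qed

text \<open>One R has to serve a whole neighbourhood of f, because the error constants computed from
  it must not depend on g.\<close>

lemma uniform_bounds:
  assumes f: "f \<in> C1_maps" and nz: "\<And>x. det (tderiv f x) \<noteq> 0"
  shows "\<exists>R\<ge>1. \<exists>d>0. \<forall>g. C1_near d f g \<longrightarrow> (\<forall>x. bi_bounded R (tderiv g x))"
proof -
  have bdd: "\<exists>C>0. \<forall>x. norm (F x) \<le> C" if "continuous_on UNIV F" for F :: "torus2 \<Rightarrow> real^2^2"
  proof -
    have "bounded (range F)" by (intro compact_imp_bounded compact_continuous_image that compact_torus2)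
    then show ?thesis unfolding bounded_pos by auto
  qed
  obtain b where b: "b > 0" "\<And>x. norm (tderiv f x) \<le> b" using bdd[OF C1_tderiv_continuous[OF f]] by blast
  obtain a where a: "a > 0" "\<And>x. norm (matrix_inv (tderiv f x)) \<le> a"
    using bdd[OF continuous_matrix_inv_tderiv[OF f nz]] by blast
  \<comment> \<open>A perturbation smaller than d changes the length of the image of v by at most 2
    d |v| <= |v| / (4 a), half of the lower bound |v| / (2 a) that holds for f.\<close>
  define d where "d = min (1/2) (1 / (8 * a))"
  define R where "R = max 1 (max (4 * a) (2 * b + 1))"
  have d: "d > 0" using a by (simp add: d_def)
  have R: "R \<ge> 1" "R \<ge> 4 * a" "R \<ge> 2 * b + 1" by (auto simp: R_def)
  have "bi_bounded R (tderiv g x)" if g: "C1_near d f g" for g x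
    unfolding bi_bounded_def
  proof (intro allI conjI)
    fix v
    define M where "M = tderiv f x"
    define M' where "M' = tderiv g x"
    have c: "norm (M - M') < d" using g by (simp add: C1_near_def M_def M'_def)
    have diff: "norm ((M - M') *v v) \<le> 2 * d * norm v"
    proof -
      have "norm ((M - M') *v v) \<le> onorm ((*v) (M - M')) * norm v" by (rule norm_le_onorm)
      also have "\<dots> \<le> 2 * d * norm v" using onorm_matrix_le_norm[of "M - M'"] c by (intro mult_right_mono) auto
      finally show ?thesis .
    qed
    have "v = matrix_inv M *v (M *v v)" using nz by (simp add: M_def matrix_vector_mul_assoc matrix_inv_2(3))
    then have "norm v \<le> onorm ((*v) (matrix_inv M)) * norm (M *v v)" by (metis norm_le_onorm)
    also have "\<dots> \<le> 2 * a * norm (M *v v)"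
      using onorm_matrix_le_norm[of "matrix_inv M"] a(2)[of x] unfolding M_def by (intro mult_right_mono) auto
    finally have low: "norm v / (2 * a) \<le> norm (M *v v)" using a(1) by (simp add: divide_le_eq mult.commute)
    have "norm (M *v v) \<le> onorm ((*v) M) * norm v" by (rule norm_le_onorm)
    also have "\<dots> \<le> 2 * b * norm v"
      using onorm_matrix_le_norm[of M] b(2)[of x] unfolding M_def by (intro mult_right_mono) auto
    finally have up: "norm (M *v v) \<le> 2 * b * norm v" .
    have e: "(M - M') *v v = M *v v - M' *v v" by (rule matrix_vector_mult_diff_rdistrib)
    have "norm v / R \<le> norm v / (4 * a)" using R(2) a(1) by (intro divide_left_mono) auto
    also have "\<dots> = norm v / (2 * a) - 2 * (1 / (8 * a)) * norm v" using a(1) by (simp add: field_simps)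
    also have "\<dots> \<le> norm v / (2 * a) - 2 * d * norm v"
      by (intro diff_left_mono mult_right_mono) (auto simp: d_def)
    also have "\<dots> \<le> norm (M *v v) - norm ((M - M') *v v)" using low diff by linarith
    also have "\<dots> \<le> norm (M' *v v)"
      using norm_triangle_ineq2[of "M *v v" "(M - M') *v v"] by (simp add: e)
    finally show "norm v / R \<le> norm (tderiv g x *v v)" by (simp add: M'_def)
    have "norm (M' *v v) \<le> norm (M *v v) + norm ((M - M') *v v)"
      using norm_triangle_ineq4[of "M *v v" "(M - M') *v v"] by (simp add: e)
    also have "\<dots> \<le> 2 * b * norm v + 2 * d * norm v" using up diff by linarith
    also have "\<dots> = (2 * b + 2 * d) * norm v" by (simp add: algebra_simps)
    also have "\<dots> \<le> R * norm v" using R(3) by (intro mult_right_mono) (auto simp: d_def)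
    finally show "norm (tderiv g x *v v) \<le> R * norm v" by (simp add: M'_def)
  qed
  then show ?thesis using R(1) d by blast
qed

context mpt begin

text \<open>Dominated convergence. The function given by \<open>lim\<close> is measurable
  everywhere, and its unspecified values sit on a null set.\<close>

lemma integral_lim_AE:
  assumes [measurable]: "\<And>n. s n \<in> borel_measurable M" and bd: "\<And>n x. x \<in> space M \<Longrightarrow> \<bar>s n x\<bar> \<le> (C::real)"
    and conv: "AE x in M. convergent (\<lambda>n. s n x)"
  shows "(\<lambda>n. \<integral>x. s n x \<partial>M) \<longlonglongrightarrow> (\<integral>x. lim (\<lambda>n. s n x) \<partial>M)"
proof (rule integral_dominated_convergence[where w = "\<lambda>_. C"])
  show "AE x in M. (\<lambda>n. s n x) \<longlonglongrightarrow> lim (\<lambda>n. s n x)"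
    using conv by eventually_elim (simp add: convergent_LIMSEQ_iff)
  show "(\<lambda>x. lim (\<lambda>n. s n x)) \<in> borel_measurable M" by (rule borel_measurable_lim_metric) measurable
  show "AE x in M. norm (s n x) \<le> C" for n using bd by auto
qed auto

end

locale bounded_torus_map = torus_map P for P +
  fixes R :: real
  assumes R: "R \<ge> 1" and bi_bounded: "\<And>x. bi_bounded R (tderiv P x)"
begin

lemma R_pow: "1 \<le> R ^ n" using R by (rule one_le_power)

lemma bi_bounded_iter: "bi_bounded (R ^ n) (tderiv (P ^^ n) x)"
proof (induction n arbitrary: x)
  case 0
  show ?case using tderiv_id by (simp add: bi_bounded_def id_def)
next
  case (Suc n)
  have "tderiv (P ^^ Suc n) x = tderiv P ((P ^^ n) x) ** tderiv (P ^^ n) x"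
    using tderiv_compose[OF C1 C1_maps_iter[OF C1]] by simp
  then show ?case using bi_bounded_mult[OF bi_bounded[of "(P ^^ n) x"] Suc[of x] R R_pow] by (simp only: power_Suc)
qed

sublocale mpt haar P by (rule torus_map_mpt) unfold_locales

text \<open>Minus the logarithm of the conorm of the derivative, by \<open>ln_conorm\<close>; with
  this sign the cocycle is subadditive, like \<open>lo\<close>.\<close>

definition li :: "nat \<Rightarrow> torus2 \<Rightarrow> real" where
  "li n x = ln (onorm ((*v) (matrix_inv (tderiv (P ^^ n) x))))"

definition lo :: "nat \<Rightarrow> torus2 \<Rightarrow> real" where
  "lo n x = ln (onorm ((*v) (tderiv (P ^^ n) x)))"

definition ld :: "nat \<Rightarrow> torus2 \<Rightarrow> real" where
  "ld n x = ln \<bar>det (tderiv (P ^^ n) x)\<bar>"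

lemma iter_det: "det (tderiv (P ^^ n) x) \<noteq> 0"
  by (rule bi_bounded_det[OF bi_bounded_iter R_pow])

lemma matrix_inv_measurable [measurable]: "(\<lambda>x. matrix_inv (tderiv (P ^^ n) x)) \<in> borel_measurable haar"
  unfolding borel_measurable_haar by (rule borel_measurable_matrix_inv[OF C1_maps_iter[OF C1] iter_det])

lemma tderiv_measurable [measurable]: "(\<lambda>x. tderiv (P ^^ n) x) \<in> borel_measurable haar"
  unfolding borel_measurable_haar by (rule C1_measurable[OF C1_maps_iter[OF C1]])

lemma measurables [measurable]: "li n \<in> borel_measurable haar" "lo n \<in> borel_measurable haar"
  "ld n \<in> borel_measurable haar"
proof -
  show "li n \<in> borel_measurable haar" "lo n \<in> borel_measurable haar"
    unfolding li_def[abs_def] lo_def[abs_def] by measurable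
  have "continuous_on UNIV (det :: real^2^2 \<Rightarrow> real)" unfolding det_2 by (intro continuous_intros)
  then have [measurable]: "(det :: real^2^2 \<Rightarrow> real) \<in> borel_measurable borel"
    by (rule borel_measurable_continuous_onI)
  show "ld n \<in> borel_measurable haar" unfolding ld_def[abs_def] by measurable
qed

lemma ln_R_pow: "ln (R ^ n) = ln R * real n"
  using R by (simp add: ln_realpow)

lemma li_bound: "\<bar>li n x\<bar> \<le> ln R * real n"
  unfolding li_def ln_R_pow[symmetric] by (rule bi_bounded_onorm(4)[OF bi_bounded_inv[OF bi_bounded_iter R_pow] R_pow])

lemma lo_bound: "\<bar>lo n x\<bar> \<le> ln R * real n"
  unfolding lo_def ln_R_pow[symmetric] by (rule bi_bounded_onorm(4)[OF bi_bounded_iter R_pow])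

lemma ld_bound: "\<bar>ld n x\<bar> \<le> 2 * ln R * real n"
  using bi_bounded_det_bounds(3)[OF bi_bounded_iter[of n x] R_pow] by (simp add: ld_def ln_R_pow)

lemma ln_onorm_mult_le:
  assumes "0 < onorm ((*v) (A ** B :: real^2^2))" "0 < onorm ((*v) (A::real^2^2))" "0 < onorm ((*v) (B::real^2^2))"
  shows "ln (onorm ((*v) (A ** B))) \<le> ln (onorm ((*v) A)) + ln (onorm ((*v) B))"
proof -
  have "onorm ((*v) (A ** B)) = onorm ((*v) A \<circ> (*v) B)" by (simp add: o_def matrix_vector_mul_assoc)
  also have "\<dots> \<le> onorm ((*v) A) * onorm ((*v) B)" by (rule onorm_compose) simp_all
  finally have "ln (onorm ((*v) (A ** B))) \<le> ln (onorm ((*v) A) * onorm ((*v) B))"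
    using assms by (intro ln_mono) auto
  then show ?thesis using assms by (simp add: ln_mult)
qed

lemma li_sub: "li (m + n) x \<le> li m x + li n ((P ^^ m) x)"
proof -
  have e: "matrix_inv (tderiv (P ^^ (m + n)) x) = matrix_inv (tderiv (P ^^ m) x) ** matrix_inv (tderiv (P ^^ n) ((P ^^ m) x))"
    unfolding tderiv_iter_add[OF C1] by (rule matrix_inv_mult[OF iter_det iter_det])
  have pos: "0 < onorm ((*v) (matrix_inv (tderiv (P ^^ n) x)))" for n x
    by (rule bi_bounded_onorm(3)[OF bi_bounded_inv[OF bi_bounded_iter R_pow] R_pow])
  show ?thesis unfolding li_def e
    by (rule ln_onorm_mult_le) (use pos[of "m + n" x] pos in \<open>auto simp: e\<close>)
qed

lemma lo_sub: "lo (m + n) x \<le> lo m x + lo n ((P ^^ m) x)"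
proof -
  have pos: "0 < onorm ((*v) (tderiv (P ^^ n) x))" for n x
    by (rule bi_bounded_onorm(3)[OF bi_bounded_iter R_pow])
  have "lo (m + n) x \<le> lo n ((P ^^ m) x) + lo m x"
    unfolding lo_def tderiv_iter_add[OF C1]
    by (rule ln_onorm_mult_le) (use pos[of "m + n" x] pos in \<open>auto simp: tderiv_iter_add[OF C1]\<close>)
  then show ?thesis by simp
qed

lemma ld_add: "ld (m + n) x = ld m x + ld n ((P ^^ m) x)"
  unfolding ld_def tderiv_iter_add[OF C1] det_mul abs_mult using iter_det by (simp add: ln_mult)

sublocale Li: subadditive_cocycle haar P li "ln R"
  by unfold_locales (use li_sub li_bound in auto)

sublocale Lo: subadditive_cocycle haar P lo "ln R"
  by unfold_locales (use lo_sub lo_bound in auto)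

text \<open>Kingman's theorem for \<open>li\<close> gives convergence almost everywhere. The
  quotients are bounded by ln R, so the integrals converge as well.\<close>

lemma chi_minus_limit: "(\<lambda>n. (\<integral>x. li n x \<partial>haar) / real n) \<longlonglongrightarrow> - (\<integral>x. chi_minus P x \<partial>haar)"
proof -
  have c: "ln (conorm (tderiv (P ^^ n) x)) = - li n x" for n x
    unfolding li_def by (rule ln_conorm[OF bi_bounded_iter R_pow])
  have chi: "chi_minus P x = lim (\<lambda>n. - (li n x / real n))" for x
    unfolding chi_minus_def c by simp
  have "(\<lambda>n. \<integral>x. - (li n x / real n) \<partial>haar) \<longlonglongrightarrow> (\<integral>x. lim (\<lambda>n. - (li n x / real n)) \<partial>haar)"
  proof (rule integral_lim_AE[where C = "ln R"])
    show "\<bar>- (li n x / real n)\<bar> \<le> ln R" if "x \<in> space haar" for n x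
      using Li.quotient_bound[OF that, of n] by simp
    show "AE x in haar. convergent (\<lambda>n. - (li n x / real n))"
      using Li.AE_convergent by eventually_elim (rule convergent_minus_iff[THEN iffD1])
  qed measurable
  then have "(\<lambda>n. - ((\<integral>x. li n x \<partial>haar) / real n)) \<longlonglongrightarrow> (\<integral>x. chi_minus P x \<partial>haar)"
    by (simp add: chi)
  from tendsto_minus[OF this] show ?thesis by simp
qed

lemma chi_plus_limit: "(\<lambda>n. (\<integral>x. lo n x \<partial>haar) / real n) \<longlonglongrightarrow> (\<integral>x. chi_plus P x \<partial>haar)"
proof -
  have chi: "chi_plus P x = lim (\<lambda>n. lo n x / real n)" for x
    unfolding chi_plus_def lo_def by simp
  have "(\<lambda>n. \<integral>x. lo n x / real n \<partial>haar) \<longlonglongrightarrow> (\<integral>x. chi_plus P x \<partial>haar)"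
    unfolding chi by (rule integral_lim_AE[OF _ Lo.quotient_bound Lo.AE_convergent]) measurable
  then show ?thesis by simp
qed

lemma integrable_ld: "integrable haar (ld n)"
  by (rule integrable_bounded[OF _ ld_bound]) measurable

lemma integral_ld: "(\<integral>x. ld n x \<partial>haar) = real n * (\<integral>x. ld 1 x \<partial>haar)"
proof (induction n)
  case 0
  have "ld 0 x = 0" for x using ld_add[of 0 0 x] by simp
  then show ?case by simp
next
  case (Suc n)
  have i: "integrable haar (\<lambda>x. ld 1 ((P ^^ n) x))"
    using integrable_distr[OF iter_measurable[of n], of "ld 1"] iter_invariant[of n] integrable_ld by simp
  have "(\<integral>x. ld (Suc n) x \<partial>haar) = (\<integral>x. ld n x + ld 1 ((P ^^ n) x) \<partial>haar)"
    using ld_add[of n 1] by simp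
  also have "\<dots> = (\<integral>x. ld n x \<partial>haar) + (\<integral>x. ld 1 x \<partial>haar)"
    using i integrable_ld integral_iter[of "ld 1" n] by simp
  finally show ?case using Suc by (simp add: algebra_simps)
qed

text \<open>By \<open>ln_onorm_inv\<close>, \<open>lo\<close> equals \<open>ld\<close> +
  \<open>li\<close> up to ln 8, an error that vanishes on division by n. The integral of
  \<open>ld n\<close> is exactly n times that of \<open>ld 1\<close>.\<close>

lemma chi_sum: "(\<integral>x. chi_plus P x \<partial>haar) = (\<integral>x. ld 1 x \<partial>haar) - (\<integral>x. chi_minus P x \<partial>haar)"
proof -
  define J where "J = (\<integral>x. ld 1 x \<partial>haar)"
  have "\<bar>(\<integral>x. lo n x \<partial>haar) - (real n * J + (\<integral>x. li n x \<partial>haar))\<bar> \<le> ln 8" for n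
  proof -
    have i: "integrable haar (lo n)" "integrable haar (li n)" by (rule Lo.integrable_a Li.integrable_a)+
    have "(\<integral>x. lo n x \<partial>haar) - (real n * J + (\<integral>x. li n x \<partial>haar)) = (\<integral>x. lo n x - (ld n x + li n x) \<partial>haar)"
      using i integrable_ld integral_ld[of n, folded J_def] by simp
    also have "\<bar>\<dots>\<bar> \<le> (\<integral>x. \<bar>lo n x - (ld n x + li n x)\<bar> \<partial>haar)" by (rule integral_abs_bound)
    also have "\<dots> \<le> (\<integral>x. ln 8 \<partial>haar)"
    proof (intro integral_mono integrable_abs Bochner_Integration.integrable_diff Bochner_Integration.integrable_add)
      show "\<bar>lo n x - (ld n x + li n x)\<bar> \<le> ln 8" for x
        unfolding lo_def ld_def li_def by (rule ln_onorm_inv[OF bi_bounded_iter R_pow])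
    qed (use i integrable_ld in auto)
    also have "\<dots> = ln 8" using prob_space by simp
    finally show ?thesis .
  qed
  then have b: "\<bar>(\<integral>x. lo n x \<partial>haar) / real n - (J + (\<integral>x. li n x \<partial>haar) / real n)\<bar> \<le> ln 8 / real n" if "n > 0" for n
  proof -
    have "(\<integral>x. lo n x \<partial>haar) / real n - (J + (\<integral>x. li n x \<partial>haar) / real n)
      = ((\<integral>x. lo n x \<partial>haar) - (real n * J + (\<integral>x. li n x \<partial>haar))) / real n"
      using that by (simp add: field_simps)
    then show ?thesis using \<open>\<bar>(\<integral>x. lo n x \<partial>haar) - (real n * J + (\<integral>x. li n x \<partial>haar))\<bar> \<le> ln 8\<close> that
      by (simp add: abs_divide divide_right_mono)
  qed
  have "(\<lambda>n. (\<integral>x. lo n x \<partial>haar) / real n - (J + (\<integral>x. li n x \<partial>haar) / real n)) \<longlonglongrightarrow> 0"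
  proof (rule Lim_null_comparison)
    show "\<forall>\<^sub>F n in sequentially. norm ((\<integral>x. lo n x \<partial>haar) / real n - (J + (\<integral>x. li n x \<partial>haar) / real n)) \<le> ln 8 / real n"
      using eventually_gt_at_top[of 0] by eventually_elim (use b in simp)
    show "(\<lambda>n. ln 8 / real n) \<longlonglongrightarrow> 0" by (rule lim_const_over_n)
  qed
  moreover have "(\<lambda>n. (\<integral>x. lo n x \<partial>haar) / real n - (J + (\<integral>x. li n x \<partial>haar) / real n))
     \<longlonglongrightarrow> (\<integral>x. chi_plus P x \<partial>haar) - (J + - (\<integral>x. chi_minus P x \<partial>haar))"
    by (intro tendsto_intros chi_plus_limit chi_minus_limit)
  ultimately have "(\<integral>x. chi_plus P x \<partial>haar) - (J + - (\<integral>x. chi_minus P x \<partial>haar)) = 0"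
    using LIMSEQ_unique by blast
  then show ?thesis by (simp add: J_def)
qed

end

section \<open>Uniform contraction and continuity of the exponents\<close>

text \<open>From 1 - x <= exp (- x) and (1 + x + 2 x^2) (1 - x) = 1 + x^2 (1 - 2 x) >= 1.\<close>

lemma exp_le_quadratic:
  assumes "x \<le> (1/2::real)"
  shows "exp x \<le> 1 + x + 2 * x\<^sup>2"
proof -
  have 1: "1 - x \<le> exp (- x)" using exp_ge_add_one_self[of "- x"] by simp
  have p: "0 < 1 - x" using assms by simp
  have "(1 + x + 2 * x\<^sup>2) * (1 - x) = 1 + x\<^sup>2 * (1 - 2 * x)"
    by (simp add: power2_eq_square algebra_simps)
  moreover have "0 \<le> x\<^sup>2 * (1 - 2 * x)" using assms by simp
  ultimately have "1 \<le> (1 + x + 2 * x\<^sup>2) * (1 - x)" by simp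
  moreover have q: "0 \<le> 1 + x + 2 * x\<^sup>2"
  proof -
    have "1 + x + 2 * x\<^sup>2 = (1/2 + x)\<^sup>2 + x\<^sup>2 + 3/4" by (simp add: power2_eq_square algebra_simps)
    also have "0 \<le> \<dots>" by (intro add_nonneg_nonneg) auto
    finally show ?thesis .
  qed
  ultimately have "1 \<le> (1 + x + 2 * x\<^sup>2) * exp (- x)" using 1 by (meson mult_left_mono order_trans)
  then have "1 * exp x \<le> ((1 + x + 2 * x\<^sup>2) * exp (- x)) * exp x" by (rule mult_right_mono) simp
  also have "\<dots> = 1 + x + 2 * x\<^sup>2" by (simp add: exp_minus)
  finally show ?thesis by simp
qed

lemma C1_near_refl: "0 < d \<Longrightarrow> C1_near d f f"
  by (simp add: C1_near_def)

lemma det_uniform: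
  assumes P: "P \<in> C1_maps" and e: "e > 0"
  shows "\<exists>d>0. \<forall>Q. C1_near d P Q \<longrightarrow> (\<forall>x. \<bar>det (tderiv P x) - det (tderiv Q x)\<bar> < e)"
proof -
  have "bounded (range (tderiv P))"
    by (intro compact_imp_bounded compact_continuous_image C1_tderiv_continuous P compact_torus2)
  then obtain a where a: "\<And>x. norm (tderiv P x) \<le> a" unfolding bounded_iff by auto
  have "uniformly_continuous_on (cball 0 (a + 1)) (det :: real^2^2 \<Rightarrow> real)"
    unfolding det_2 by (intro compact_uniformly_continuous compact_cball continuous_intros)
  then obtain d where d: "d > 0" "\<And>M M'. M \<in> cball 0 (a + 1) \<Longrightarrow> M' \<in> cball 0 (a + 1) \<Longrightarrow> dist M' M < d \<Longrightarrow>
      dist (det (M'::real^2^2)) (det M) < e"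
    using e unfolding uniformly_continuous_on_def by metis
  show ?thesis
  proof (intro exI[of _ "min d 1"] conjI allI impI)
    fix Q x assume "C1_near (min d 1) P Q"
    then have n: "norm (tderiv P x - tderiv Q x) < d" "norm (tderiv P x - tderiv Q x) < 1"
      by (auto simp: C1_near_def)
    have "norm (tderiv Q x) \<le> a + 1"
      using a[of x] n(2) norm_triangle_ineq2[of "tderiv Q x" "tderiv P x"] by (simp add: norm_minus_commute)
    then have "dist (det (tderiv P x)) (det (tderiv Q x)) < e"
      using a[of x] n(1) by (intro d(2)) (auto simp: dist_norm)
    then show "\<bar>det (tderiv P x) - det (tderiv Q x)\<bar> < e" by (simp add: dist_real_def)
  qed (use d in simp)
qed

section \<open>Quantitative consequences of the constants \<open>C_chi\<close> and
  \<open>C_det\<close>\<close>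

context bounded_torus_map begin

lemma ln_inv_bound: "norm v = 1 \<Longrightarrow> \<bar>ln (norm (matrix_inv (tderiv (P ^^ n) y) *v v))\<bar> \<le> ln R * real n"
  unfolding ln_R_pow[symmetric] by (rule bi_bounded_ln(2)[OF bi_bounded_inv[OF bi_bounded_iter R_pow] R_pow])

lemma torus_map_pow: "torus_map (P ^^ n)"
  by (rule torus_map_iter) unfold_locales

text \<open>The weights have sum at most 1. The bound makes the real-valued infima and suprema in
  \<open>C_chi\<close> usable.\<close>

lemma I_chi_bound:
  assumes v: "norm v = 1"
  shows "\<bar>I_chi P n x v\<bar> \<le> ln R * real n"
proof -
  interpret Pn: torus_map "P ^^ n" by (rule torus_map_pow)
  have L: "0 \<le> ln R * real n" using R by simp
  have "\<bar>I_chi P n x v\<bar> \<le> (\<Sum>y\<in>(P ^^ n) -` {x}.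
     \<bar>ln (norm (matrix_inv (tderiv (P ^^ n) y) *v v)) / \<bar>det (tderiv (P ^^ n) y)\<bar>\<bar>)"
    unfolding I_chi_def by (rule sum_abs)
  also have "\<dots> \<le> (\<Sum>y\<in>(P ^^ n) -` {x}. (ln R * real n) * (1 / \<bar>det (tderiv (P ^^ n) y)\<bar>))"
    using ln_inv_bound[OF v] by (intro sum_mono) (auto simp: abs_divide intro!: divide_right_mono)
  also have "\<dots> = (ln R * real n) * (\<Sum>y\<in>(P ^^ n) -` {x}. 1 / \<bar>det (tderiv (P ^^ n) y)\<bar>)"
    by (simp add: sum_distrib_left)
  also have "\<dots> \<le> (ln R * real n) * 1" by (intro mult_left_mono Pn.sum_weights_le_1 L)
  finally show ?thesis by simp
qed

text \<open>On every inverse branch |A v|^(-s) = exp (- s ln |A v|) is expanded to second order. The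
  linear terms add up to - s times \<open>I_chi\<close>, the quadratic ones to at most 2 (s n ln
  R)^2. The smallness of s keeps the exponent in the range of
  \<open>exp_le_quadratic\<close>.\<close>

lemma moment_bound:
  assumes v: "norm v = 1" and s: "0 < s" "s * (ln R * real n) \<le> 1/2"
  shows "torus_map.moment (P ^^ n) s x v \<le> 1 - s * I_chi P n x v + 2 * (s * (ln R * real n))\<^sup>2"
proof -
  interpret Pn: torus_map "P ^^ n" by (rule torus_map_pow)
  define Y where "Y = (P ^^ n) -` {x}"
  define w where "w y = 1 / \<bar>det (tderiv (P ^^ n) y)\<bar>" for y
  define u where "u y = norm (matrix_inv (tderiv (P ^^ n) y) *v v)" for y
  define B where "B = s * (ln R * real n)"
  have w: "0 \<le> w y" for y by (simp add: w_def)
  have u: "u y powr - s \<le> 1 - s * ln (u y) + 2 * B\<^sup>2" for y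
  proof -
    have p: "0 < u y" unfolding u_def by (rule bi_bounded_ln(1)[OF bi_bounded_inv[OF bi_bounded_iter R_pow] R_pow v])
    have l: "\<bar>s * ln (u y)\<bar> \<le> B"
      using ln_inv_bound[OF v, of n y] s(1) by (simp add: u_def B_def abs_mult)
    have "u y powr - s = exp (- (s * ln (u y)))" using p by (simp add: powr_def)
    also have "\<dots> \<le> 1 + - (s * ln (u y)) + 2 * (- (s * ln (u y)))\<^sup>2"
      using l s(2) by (intro exp_le_quadratic) (simp add: B_def)
    also have "(- (s * ln (u y)))\<^sup>2 \<le> B\<^sup>2"
      using l by (metis abs_le_square_iff abs_minus abs_of_nonneg abs_ge_zero order_trans)
    finally show ?thesis by simp
  qed
  have "Pn.moment s x v = (\<Sum>y\<in>Y. u y powr - s * w y)"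
    by (simp add: Pn.moment_def Y_def u_def w_def)
  also have "\<dots> \<le> (\<Sum>y\<in>Y. (1 - s * ln (u y) + 2 * B\<^sup>2) * w y)"
    by (intro sum_mono mult_right_mono u w)
  also have "\<dots> = (1 + 2 * B\<^sup>2) * (\<Sum>y\<in>Y. w y) - s * (\<Sum>y\<in>Y. ln (u y) * w y)"
  proof -
    have "(1 - s * ln (u y) + 2 * B\<^sup>2) * w y = (1 + 2 * B\<^sup>2) * w y - s * (ln (u y) * w y)" for y
      by (simp add: algebra_simps)
    then show ?thesis by (simp add: sum_subtractf sum_distrib_left)
  qed
  also have "(\<Sum>y\<in>Y. ln (u y) * w y) = I_chi P n x v"
    by (simp add: I_chi_def Y_def u_def w_def)
  also have "(1 + 2 * B\<^sup>2) * (\<Sum>y\<in>Y. w y) \<le> (1 + 2 * B\<^sup>2) * 1"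
    unfolding w_def Y_def by (intro mult_left_mono Pn.sum_weights_le_1) simp
  finally show ?thesis by (simp add: B_def)
qed

lemma C_chi_witness:
  assumes "c < C_chi P"
  shows "\<exists>n\<ge>1. \<forall>x v. norm v = 1 \<longrightarrow> real n * c \<le> I_chi P n x v"
proof -
  define a where "a n = (INF (x, v)\<in>unit_tangent. I_chi P n x v)" for n
  have bb: "bdd_below ((\<lambda>(x, v). I_chi P n x v) ` unit_tangent)" for n
  proof (rule bdd_belowI)
    fix t assume "t \<in> (\<lambda>(x, v). I_chi P n x v) ` unit_tangent"
    then obtain x v where "t = I_chi P n x v" "norm v = 1" by (auto simp: unit_tangent_def)
    then show "- (ln R * real n) \<le> t" using I_chi_bound[of v n x] by (simp add: abs_le_iff)
  qed
  have le: "a n \<le> I_chi P n x v" if "norm v = 1" for n x v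
  proof -
    have "(x, v) \<in> unit_tangent" using that by (simp add: unit_tangent_def)
    from cINF_lower[OF bb this] show ?thesis by (simp add: a_def)
  qed
  have "bdd_above ((\<lambda>n. 1 / real n * a n) ` {1..})"
  proof (rule bdd_aboveI2)
    fix n :: nat assume n: "n \<in> {1..}"
    have "a n \<le> ln R * real n"
      using le[of "axis 1 1" n undefined] I_chi_bound[of "axis 1 1" n undefined] by simp
    then show "1 / real n * a n \<le> ln R" using n by (simp add: divide_le_eq)
  qed
  then obtain n where n: "n \<in> {1..}" "c < 1 / real n * a n"
    using assms less_cSUP_iff[of "{1..}" "\<lambda>n. 1 / real n * a n" c] unfolding C_chi_def a_def[symmetric] by auto
  then have "real n * c \<le> a n" by (simp add: less_divide_eq mult.commute less_imp_le)
  then have "\<forall>x v. norm v = 1 \<longrightarrow> real n * c \<le> I_chi P n x v" using le order_trans by blast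
  then show ?thesis using n(1) by (intro exI[of _ n]) simp
qed

text \<open>The number m leaves a strict gap above n d, so that the bound n d survives a small
  perturbation of the map.\<close>

lemma C_det_witness:
  assumes "d < C_det P"
  shows "\<exists>n\<ge>1. \<exists>m. real n * d < m \<and> (\<forall>x. m \<le> ld n x)"
proof -
  define a where "a n = (INF x. ld n x)" for n
  have bb: "bdd_below (range (ld n))" for n
    using ld_bound by (intro bdd_belowI2[of _ "- (2 * ln R * real n)"]) (simp add: abs_le_iff minus_le_iff)
  have le: "a n \<le> ld n x" for n x
    unfolding a_def by (rule cINF_lower[OF bb]) simp
  have "bdd_above ((\<lambda>n. 1 / real n * a n) ` {1..})"
  proof (rule bdd_aboveI2)
    fix n :: nat assume n: "n \<in> {1..}"
    have "a n \<le> 2 * ln R * real n"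
      using le[of n undefined] ld_bound[of n undefined] by simp
    then show "1 / real n * a n \<le> 2 * ln R" using n by (simp add: divide_le_eq)
  qed
  then obtain n where n: "n \<in> {1..}" "d < 1 / real n * a n"
    using assms less_cSUP_iff[of "{1..}" "\<lambda>n. 1 / real n * a n" d]
    unfolding C_det_def a_def ld_def by auto
  then have "real n * d < a n" by (simp add: less_divide_eq mult.commute)
  then show ?thesis using le n(1) by (intro exI[of _ n]) auto
qed

end

lemma (in torus_map) moment_iterate:
  assumes S: "0 \<le> S" and step: "moment_contraction P s S"
  shows "moment_contraction (P ^^ m) s (S ^ m)"
  unfolding moment_contraction_def
proof (intro ballI impI)
  fix \<xi> :: "torus2 \<Rightarrow> real^2" assume \<xi>': "\<xi> \<in> borel_measurable borel" "\<forall>x. \<xi> x \<noteq> 0"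
  note \<xi> = \<xi>'(1) \<xi>'(2)[rule_format]
  show "(\<integral>\<^sup>+y. ennreal (norm (matrix_inv (tderiv (P ^^ m) y) *v \<xi> ((P ^^ m) y)) powr - s) \<partial>haar)
        \<le> ennreal (S ^ m) * (\<integral>\<^sup>+x. ennreal (norm (\<xi> x) powr - s) \<partial>haar)"
  proof (induction m)
    case 0
    have "det (mat 1 :: real^2^2) \<noteq> 0" by simp
    from matrix_inv_2(3)[OF this] have "matrix_inv (mat 1 :: real^2^2) = mat 1" by simp
    then show ?case using tderiv_id by (simp add: id_def)
  next
    case (Suc m)
    interpret Pm: torus_map "P ^^ m" by (rule torus_map_iter) unfold_locales
    \<comment> \<open>The field pulled back by m steps replaces \<xi> in one more application of
      \<open>step\<close>.\<close>
    define \<zeta> where "\<zeta> x = matrix_inv (tderiv (P ^^ m) x) *v \<xi> ((P ^^ m) x)" for x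
    have [measurable]: "\<xi> \<in> borel_measurable borel" "P ^^ m \<in> borel_measurable borel"
      "(\<lambda>x. matrix_inv (tderiv (P ^^ m) x)) \<in> borel_measurable borel"
      using \<xi> Pm.P_measurable borel_measurable_matrix_inv[OF Pm.C1 Pm.det_nz] by auto
    have \<zeta>m: "\<zeta> \<in> borel_measurable borel" unfolding \<zeta>_def[abs_def] by measurable
    have \<zeta>nz: "\<zeta> x \<noteq> 0" for x
    proof
      assume "\<zeta> x = 0"
      then have "tderiv (P ^^ m) x *v \<zeta> x = 0" by simp
      then show False using \<xi>(2) Pm.det_nz by (simp add: \<zeta>_def matrix_vector_mul_assoc matrix_inv_2(2))
    qed
    have e: "matrix_inv (tderiv (P ^^ Suc m) y) *v \<xi> ((P ^^ Suc m) y) = matrix_inv (tderiv P y) *v \<zeta> (P y)" for y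
    proof -
      have "tderiv (P ^^ Suc m) y = tderiv (P ^^ m) (P y) ** tderiv P y"
        using tderiv_iter_add[OF C1, of 1 m y] by simp
      then show ?thesis
        using matrix_inv_mult[OF Pm.det_nz det_nz]
        by (simp add: \<zeta>_def matrix_vector_mul_assoc funpow_swap1 del: funpow.simps) (simp add: funpow_swap1)
    qed
    have "(\<integral>\<^sup>+y. ennreal (norm (matrix_inv (tderiv (P ^^ Suc m) y) *v \<xi> ((P ^^ Suc m) y)) powr - s) \<partial>haar)
      \<le> ennreal S * (\<integral>\<^sup>+x. ennreal (norm (\<zeta> x) powr - s) \<partial>haar)"
      unfolding e using step \<zeta>m \<zeta>nz unfolding moment_contraction_def by blast
    also have "\<dots> \<le> ennreal S * (ennreal (S ^ m) * (\<integral>\<^sup>+x. ennreal (norm (\<xi> x) powr - s) \<partial>haar))"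
      unfolding \<zeta>_def by (intro mult_left_mono Suc) simp
    also have "\<dots> = ennreal (S ^ Suc m) * (\<integral>\<^sup>+x. ennreal (norm (\<xi> x) powr - s) \<partial>haar)"
      using S by (simp add: ennreal_mult mult.assoc)
    finally show ?case .
  qed
qed

lemma bounded_torus_mapI: "torus_map g \<Longrightarrow> 1 \<le> R \<Longrightarrow> (\<And>x. bi_bounded R (tderiv g x)) \<Longrightarrow> bounded_torus_map g R"
  by (intro bounded_torus_map.intro bounded_torus_map_axioms.intro)

text \<open>The constants are chosen before g, which makes the error in
  \<open>chi_minus_estimate\<close> uniform near f. Time n0 serves \<open>C_chi\<close> and time n1
  serves \<open>C_det\<close>; at N = n0 * n1 both are available, as n1 rounds of the moment bound
  and n0 rounds of the determinant bound.\<close>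

theorem contracting_near:
  assumes f: "f \<in> U1"
  shows "\<exists>N>0. \<exists>R s sg b d. d > 0 \<and> (\<forall>g. torus_map g \<longrightarrow> C1_near d f g \<longrightarrow>
    bounded_torus_map g R \<and>
    contracting_cocycle haar (g ^^ N) (\<lambda>y. matrix_inv (tderiv (g ^^ N) y)) (R ^ N) s sg b)"
proof -
  have fE: "f \<in> End1" and C: "C_chi f > - (1/2) * C_det f" using f by (auto simp: U1_def)
  interpret f0: torus_map f by (rule End1_torus_map[OF fE])
  obtain R d0 where R: "R \<ge> 1" "d0 > 0" "\<And>g x. C1_near d0 f g \<Longrightarrow> bi_bounded R (tderiv g x)"
    using uniform_bounds[OF f0.C1 f0.det_nz] by blast
  interpret f: bounded_torus_map f R
    by (rule bounded_torus_mapI[OF _ R(1) R(3)[OF C1_near_refl[OF R(2)]]]) unfold_locales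
  \<comment> \<open>A third of the gap: c and d, each lowered by \<gamma>, still satisfy c + d/2 = 3
    \<gamma> / 2 > 0.\<close>
  define \<gamma> where "\<gamma> = (C_chi f + 1/2 * C_det f) / 3"
  have \<gamma>: "\<gamma> > 0" using C by (simp add: \<gamma>_def)
  define c where "c = C_chi f - \<gamma>"
  define d where "d = C_det f - \<gamma>"
  have "3 * \<gamma> = C_chi f + 1/2 * C_det f" by (simp add: \<gamma>_def)
  then have "2 * (c + d / 2) = 3 * \<gamma>" unfolding c_def d_def by (simp add: field_simps)
  then have cd: "c + d / 2 > 0" using \<gamma> by simp
  obtain n0 where n0: "n0 \<ge> 1" "\<And>x v. norm v = 1 \<Longrightarrow> real n0 * c \<le> I_chi f n0 x v"
    using f.C_chi_witness[of c] \<gamma> by (auto simp: c_def)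
  obtain n1 m where n1: "n1 \<ge> 1" "real n1 * d < m" "\<And>x. m \<le> f.ld n1 x"
    using f.C_det_witness[of d] \<gamma> by (auto simp: d_def)
  define L where "L = ln R * real n0"
  have L: "0 \<le> L" using R(1) by (simp add: L_def)
  define \<delta> where "\<delta> = real n0 * (c + d / 2)"
  have \<delta>: "\<delta> > 0" using n0(1) cd by (simp add: \<delta>_def)
  \<comment> \<open>The first bound gives s L <= 1/2, as \<open>moment_bound\<close> requires, and s
    <= 2. The second makes the quadratic error smaller than the linear gain: s (2 L^2 + 1) <
    \<delta>.\<close>
  define s where "s = min (1 / (2 * (L + 1))) (\<delta> / (2 * (2 * L\<^sup>2 + 1)))"
  have q: "0 < 2 * L\<^sup>2 + 1" by (intro add_nonneg_pos) auto
  have s: "s > 0" "s * L \<le> 1/2" "s \<le> 2" "s * (2 * L\<^sup>2 + 1) < \<delta>"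
  proof -
    show s0: "s > 0" using L \<delta> q by (simp add: s_def)
    have "s \<le> 1 / (2 * (L + 1))" by (simp add: s_def)
    then have s1: "s * (L + 1) \<le> 1/2" using L by (simp add: le_divide_eq mult_ac)
    then show "s * L \<le> 1/2" using s0 by (simp add: algebra_simps)
    have "s * 1 \<le> s * (L + 1)" using s0 L by (intro mult_left_mono) auto
    then show "s \<le> 2" using s1 by simp
    have "s \<le> \<delta> / (2 * (2 * L\<^sup>2 + 1))" by (simp add: s_def)
    then have "2 * (s * (2 * L\<^sup>2 + 1)) \<le> \<delta>" using q by (simp add: le_divide_eq mult_ac)
    moreover have "0 < s * (2 * L\<^sup>2 + 1)" using s0 q by simp
    ultimately show "s * (2 * L\<^sup>2 + 1) < \<delta>" by linarith
  qed
  \<comment> \<open>The 1 added to 2 L^2 makes the bound on the moments strict, as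
    \<open>moment_global\<close> demands.\<close>
  define S where "S = exp (- (s * (real n0 * c)) + s\<^sup>2 * (2 * L\<^sup>2 + 1))"
  interpret P0: torus_map "f ^^ n0" by (rule f.torus_map_pow)
  have mom: "P0.moment s x v < S" if v: "norm v = 1" for x v
  proof -
    have "P0.moment s x v \<le> 1 - s * I_chi f n0 x v + 2 * (s * L)\<^sup>2"
      using f.moment_bound[OF v s(1), of n0 x] s(2) by (simp add: L_def)
    also have "\<dots> \<le> 1 - s * (real n0 * c) + 2 * (s * L)\<^sup>2"
      using n0(2)[OF v] s(1) by (intro add_right_mono diff_left_mono mult_left_mono) auto
    also have "\<dots> < 1 + (- (s * (real n0 * c)) + s\<^sup>2 * (2 * L\<^sup>2 + 1))"
    proof -
      have "2 * (s * L)\<^sup>2 < s\<^sup>2 * (2 * L\<^sup>2 + 1)" using s(1) by (simp add: power_mult_distrib algebra_simps)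
      then show ?thesis by simp
    qed
    also have "\<dots> \<le> S" unfolding S_def by (rule exp_ge_add_one_self)
    finally show ?thesis .
  qed
  obtain e0 where e0: "e0 > 0" "\<And>Q. Q \<in> C1_maps \<Longrightarrow> C1_near e0 (f ^^ n0) Q \<Longrightarrow>
      \<forall>x. det (tderiv Q x) \<noteq> 0 \<Longrightarrow> moment_contraction Q s S"
    using P0.moment_global[OF mom] by blast
  obtain d1 where d1: "d1 > 0" "\<And>g. C1_near d1 f g \<Longrightarrow> g \<in> C1_maps \<Longrightarrow> C1_near e0 (f ^^ n0) (g ^^ n0)"
    using C1_near_iter[OF f0.C1 e0(1)] by blast
  \<comment> \<open>The gap of \<open>C_det_witness\<close> after exponentiation: by this much the
    determinants may move.\<close>
  have em: "exp m - exp (real n1 * d) > 0" using n1(2) by simp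
  obtain e1 where e1: "e1 > 0" "\<And>Q x. C1_near e1 (f ^^ n1) Q \<Longrightarrow>
      \<bar>det (tderiv (f ^^ n1) x) - det (tderiv Q x)\<bar> < exp m - exp (real n1 * d)"
    using det_uniform[OF C1_maps_iter[OF f0.C1] em] by blast
  obtain d2 where d2: "d2 > 0" "\<And>g. C1_near d2 f g \<Longrightarrow> g \<in> C1_maps \<Longrightarrow> C1_near e1 (f ^^ n1) (g ^^ n1)"
    using C1_near_iter[OF f0.C1 e1(1)] by blast
  define N where "N = n0 * n1"
  define dd where "dd = min d0 (min d1 d2)"
  define sg where "sg = S ^ n1"
  define b where "b = exp (- (real n0 * (real n1 * d)))"
  have rho: "sg * b powr (s / 2) < 1"
  proof -
    have 1: "sg = exp (real n1 * (- (s * (real n0 * c)) + s\<^sup>2 * (2 * L\<^sup>2 + 1)))"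
      unfolding sg_def S_def by (rule exp_of_nat_mult[symmetric])
    have 2: "b powr (s / 2) = exp ((s / 2) * (- (real n0 * (real n1 * d))))"
      by (simp add: b_def powr_def)
    have "sg * b powr (s / 2) = exp (real n1 * (- (s * (real n0 * c)) + s\<^sup>2 * (2 * L\<^sup>2 + 1)) + (s / 2) * (- (real n0 * (real n1 * d))))"
      unfolding 1 2 by (rule exp_add[symmetric])
    \<comment> \<open>The exponent is n1 s times error minus gain. Here the hypothesis on f acts,
      through \<delta> > 0.\<close>
    also have "real n1 * (- (s * (real n0 * c)) + s\<^sup>2 * (2 * L\<^sup>2 + 1)) + (s / 2) * (- (real n0 * (real n1 * d)))
        = real n1 * s * (s * (2 * L\<^sup>2 + 1) - \<delta>)"
      by (simp add: \<delta>_def power2_eq_square algebra_simps)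
    also have "\<dots> < 0" using n1(1) s(1,4) by (intro mult_pos_neg) auto
    finally show ?thesis by simp
  qed
  have "bounded_torus_map g R \<and>
    contracting_cocycle haar (g ^^ N) (\<lambda>y. matrix_inv (tderiv (g ^^ N) y)) (R ^ N) s sg b"
    if g: "torus_map g" and ng: "C1_near dd f g" for g
  proof
    have C1_near: "C1_near d0 f g" "C1_near d1 f g" "C1_near d2 f g"
      using ng by (auto intro: C1_near_mono simp: dd_def)
    show gb: "bounded_torus_map g R" by (rule bounded_torus_mapI[OF g R(1) R(3)[OF C1_near(1)]])
    interpret g: bounded_torus_map g R by (rule gb)
    interpret g0: torus_map "g ^^ n0" by (rule g.torus_map_pow)
    have gN: "g ^^ N = (g ^^ n0) ^^ n1" "g ^^ N = (g ^^ n1) ^^ n0"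
      by (simp_all add: N_def funpow_mult mult.commute)
    show "contracting_cocycle haar (g ^^ N) (\<lambda>y. matrix_inv (tderiv (g ^^ N) y)) (R ^ N) s sg b"
    proof (intro contracting_cocycle.intro contracting_cocycle_axioms.intro)
      show "mpt haar (g ^^ N)" by (rule g.mpt_iter)
      show "(\<lambda>y. matrix_inv (tderiv (g ^^ N) y)) \<in> borel_measurable haar" by (rule g.matrix_inv_measurable)
      show "norm v / R ^ N \<le> norm (matrix_inv (tderiv (g ^^ N) x) *v v)"
        "norm (matrix_inv (tderiv (g ^^ N) x) *v v) \<le> R ^ N * norm v" for x v
        using bi_boundedD[OF bi_bounded_inv[OF g.bi_bounded_iter[of N x] g.R_pow], of v] by auto
      show "1 \<le> R ^ N" by (rule g.R_pow)
      show "0 < s" "s \<le> 2" by (rule s)+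
      show "0 \<le> sg" by (simp add: sg_def S_def)
      show "0 < b" by (simp add: b_def)
      show "sg * b powr (s / 2) < 1" by (rule rho)
      show "\<bar>det (matrix_inv (tderiv (g ^^ N) x))\<bar> \<le> b" for x
      proof -
        have n1d: "real n1 * d \<le> g.ld n1 x" for x
        proof -
          have "exp m \<le> \<bar>det (tderiv (f ^^ n1) x)\<bar>"
            using n1(3)[of x] f.iter_det[of n1 x] unfolding f.ld_def by (simp add: ln_ge_iff)
          moreover have "\<bar>det (tderiv (f ^^ n1) x) - det (tderiv (g ^^ n1) x)\<bar> < exp m - exp (real n1 * d)"
            by (rule e1(2)[OF d2(2)[OF C1_near(3) g.C1]])
          ultimately have "exp (real n1 * d) \<le> \<bar>det (tderiv (g ^^ n1) x)\<bar>" by linarith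
          then show ?thesis using g.iter_det[of n1 x] unfolding g.ld_def by (simp add: ln_ge_iff)
        qed
        have "real k * (real n1 * d) \<le> g.ld (k * n1) x" for k
        proof (induction k)
          case 0
          show ?case using g.ld_add[of 0 0 x] by simp
        next
          case (Suc k)
          then show ?case using n1d[of "(g ^^ (k * n1)) x"] g.ld_add[of "k * n1" n1 x]
            by (simp add: algebra_simps)
        qed
        then have "real n0 * (real n1 * d) \<le> ln \<bar>det (tderiv (g ^^ N) x)\<bar>"
          unfolding N_def g.ld_def .
        then have "exp (real n0 * (real n1 * d)) \<le> \<bar>det (tderiv (g ^^ N) x)\<bar>"
          using g.iter_det[of N x] by (simp add: ln_ge_iff)
        moreover have "\<bar>det (matrix_inv (tderiv (g ^^ N) x))\<bar> * \<bar>det (tderiv (g ^^ N) x)\<bar> = 1"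
          using matrix_inv_2(3)[OF g.iter_det[of N x]] by (metis det_mul det_I abs_mult abs_one)
        ultimately have "\<bar>det (matrix_inv (tderiv (g ^^ N) x))\<bar> * exp (real n0 * (real n1 * d)) \<le> 1"
          by (metis abs_ge_zero mult_left_mono)
        then show ?thesis by (simp add: b_def exp_minus field_simps)
      qed
      fix \<xi> :: "torus2 \<Rightarrow> real^2" assume \<xi>: "\<xi> \<in> borel_measurable haar" "\<And>x. x \<in> space haar \<Longrightarrow> \<xi> x \<noteq> 0"
      have nz: "\<forall>x. det (tderiv (g ^^ n0) x) \<noteq> 0" using g.iter_det by blast
      have "moment_contraction (g ^^ n0) s S"
        by (rule e0(2)[OF g0.C1 d1(2)[OF C1_near(2) g.C1] nz])
      then have "moment_contraction (g ^^ N) s sg"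
        unfolding gN(1) sg_def by (intro g0.moment_iterate) (simp add: S_def)
      then show "(\<integral>\<^sup>+y. ennreal (norm (matrix_inv (tderiv (g ^^ N) y) *v \<xi> ((g ^^ N) y)) powr - s) \<partial>haar)
        \<le> ennreal sg * (\<integral>\<^sup>+x. ennreal (norm (\<xi> x) powr - s) \<partial>haar)"
        using \<xi> unfolding moment_contraction_def by (simp add: borel_measurable_haar space_haar)
    qed
  qed
  moreover have "dd > 0" using R(2) d1(1) d2(1) by (simp add: dd_def)
  moreover have "N > 0" using n0(1) n1(1) by (simp add: N_def)
  ultimately show ?thesis by blast
qed


text \<open>At the multiples m k the value of \<open>\<beta>\<close> lies between m (\<beta> k - K)
  and m \<beta> k. Dividing by N k m and letting m grow traps the limit in an interval of length K /
  (N k). The map g enters the bound only through R, N, s, sg and b.\<close>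

lemma chi_minus_estimate:
  assumes g: "bounded_torus_map g R"
    and c: "contracting_cocycle haar (g ^^ N) (\<lambda>y. matrix_inv (tderiv (g ^^ N) y)) (R ^ N) s sg b"
    and N: "N > 0" and k: "k > 0"
  shows "\<bar>(\<integral>x. chi_minus g x \<partial>haar) + (\<integral>x. bounded_torus_map.li g (N * k) x \<partial>haar) / real (N * k)\<bar>
    \<le> 2 * (ln 2 + 2 * (2 * (R ^ N)\<^sup>2 / (1 - sg * b powr (s / 2)))) / real (N * k)"
proof -
  interpret g: bounded_torus_map g R by (rule g)
  interpret c: contracting_cocycle haar "g ^^ N" "\<lambda>y. matrix_inv (tderiv (g ^^ N) y)" "R ^ N" s sg b by (rule c)
  define K where "K = 2 * (ln 2 + 2 * c.K1)"
  have K: "K = 2 * (ln 2 + 2 * (2 * (R ^ N)\<^sup>2 / (1 - sg * b powr (s / 2))))"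
    by (simp add: K_def c.K1_def c.\<rho>_def)
  have "0 \<le> c.K1" using c.\<rho>_bounds by (simp add: c.K1_def)
  then have K0: "0 \<le> K" by (simp add: K_def)
  \<comment> \<open>The abstract product of inverse derivatives is the inverse derivative of the
    iterate, which identifies \<open>\<beta>\<close> with the integral of \<open>li\<close>.\<close>
  have B: "c.B j y = matrix_inv (tderiv (g ^^ (N * j)) y)" for j y
  proof (induction j arbitrary: y)
    case 0
    have "det (mat 1 :: real^2^2) \<noteq> 0" by simp
    from matrix_inv_2(3)[OF this] show ?case using tderiv_id by (simp add: id_def)
  next
    case (Suc j)
    have "c.B (Suc j) y = matrix_inv (tderiv (g ^^ N) y) ** matrix_inv (tderiv (g ^^ (N * j)) ((g ^^ N) y))"
      using Suc by simp
    also have "\<dots> = matrix_inv (tderiv (g ^^ (N + N * j)) y)"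
      unfolding tderiv_iter_add[OF g.C1] by (rule matrix_inv_mult[OF g.iter_det g.iter_det, symmetric])
    finally show ?case by simp
  qed
  have \<beta>: "c.\<beta> j = (\<integral>x. g.li (N * j) x \<partial>haar)" for j
    unfolding c.\<beta>_def c.L_def B g.li_def ..
  have up: "c.\<beta> (Suc m * k) \<le> real (Suc m) * c.\<beta> k" for m
  proof (induction m)
    case (Suc m)
    have "c.\<beta> (Suc (Suc m) * k) = c.\<beta> (k + Suc m * k)" by simp
    also have "\<dots> \<le> c.\<beta> k + c.\<beta> (Suc m * k)" by (rule c.\<beta>_subadditive)
    also have "\<dots> \<le> c.\<beta> k + real (Suc m) * c.\<beta> k" using Suc by simp
    finally show ?case by (simp add: algebra_simps)
  qed simp
  have low: "real (Suc m) * (c.\<beta> k - K) \<le> c.\<beta> (Suc m * k)" for m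
  proof (induction m)
    case 0
    show ?case using K0 by simp
  next
    case (Suc m)
    have "real (Suc (Suc m)) * (c.\<beta> k - K) = (c.\<beta> k - K) + real (Suc m) * (c.\<beta> k - K)"
      by (simp add: algebra_simps)
    also have "\<dots> \<le> (c.\<beta> k - K) + c.\<beta> (Suc m * k)" using Suc by simp
    also have "\<dots> \<le> c.\<beta> (k + Suc m * k)" using c.\<beta>_superadditive[of k "Suc m * k"] by (simp add: K_def)
    finally show ?case by simp
  qed
  define M where "M = real (N * k)"
  have M: "M > 0" using N k by (simp add: M_def)
  define a where "a n = (\<integral>x. g.li n x \<partial>haar) / real n" for n
  have "strict_mono (\<lambda>m. N * k * Suc m)" using N k by (intro strict_monoI) simp
  from LIMSEQ_subseq_LIMSEQ[OF g.chi_minus_limit this]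
  have lim: "(\<lambda>m. a (N * k * Suc m)) \<longlonglongrightarrow> - (\<integral>x. chi_minus g x \<partial>haar)" by (simp add: o_def a_def)
  have am: "a (N * k * Suc m) = c.\<beta> (Suc m * k) / (M * real (Suc m))" for m
    unfolding a_def \<beta> M_def by (simp only: of_nat_mult mult_ac)
  have u: "a (N * k * Suc m) \<le> c.\<beta> k / M" for m
  proof -
    have "a (N * k * Suc m) \<le> (real (Suc m) * c.\<beta> k) / (M * real (Suc m))"
      unfolding am using M by (intro divide_right_mono up) auto
    also have "\<dots> = c.\<beta> k / M" by (simp del: of_nat_Suc)
    finally show ?thesis .
  qed
  have l: "(c.\<beta> k - K) / M \<le> a (N * k * Suc m)" for m
  proof -
    have "(c.\<beta> k - K) / M = (real (Suc m) * (c.\<beta> k - K)) / (M * real (Suc m))" by (simp del: of_nat_Suc)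
    also have "\<dots> \<le> a (N * k * Suc m)"
      unfolding am using M by (intro divide_right_mono low) auto
    finally show ?thesis .
  qed
  have "- (\<integral>x. chi_minus g x \<partial>haar) \<le> c.\<beta> k / M" by (rule LIMSEQ_le_const2[OF lim]) (use u in blast)
  moreover have "(c.\<beta> k - K) / M \<le> - (\<integral>x. chi_minus g x \<partial>haar)" by (rule LIMSEQ_le_const[OF lim]) (use l in blast)
  ultimately have "\<bar>(\<integral>x. chi_minus g x \<partial>haar) + c.\<beta> k / M\<bar> \<le> K / M"
    using K0 M by (simp add: diff_divide_distrib abs_le_iff)
  then show ?thesis unfolding \<beta> K M_def .
qed

section \<open>Continuity of the integrals at a fixed time, and passage to the limit\<close>

lemma integral_diff_bound:
  assumes P: "prob_space M" and i: "integrable M f" "integrable M g"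
    and b: "\<And>x. x \<in> space M \<Longrightarrow> \<bar>f x - g x\<bar> \<le> (e::real)"
  shows "\<bar>(\<integral>x. f x \<partial>M) - (\<integral>x. g x \<partial>M)\<bar> \<le> e"
proof -
  interpret prob_space M by (rule P)
  have "\<bar>(\<integral>x. f x \<partial>M) - (\<integral>x. g x \<partial>M)\<bar> = \<bar>\<integral>x. f x - g x \<partial>M\<bar>" using i by simp
  also have "\<dots> \<le> (\<integral>x. \<bar>f x - g x\<bar> \<partial>M)" by (rule integral_abs_bound)
  also have "\<dots> \<le> (\<integral>x. e \<partial>M)" using i b by (intro integral_mono) auto
  also have "\<dots> = e" by (simp add: prob_space)
  finally show ?thesis .
qed

text \<open>The conorm avoids the inverse matrix. It is Lipschitz in the matrix and at least R^(-n)
  for all maps with the bound R, so its logarithm is Lipschitz too.\<close>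

lemma li_continuous:
  assumes f: "bounded_torus_map f R" and e: "e > 0"
  shows "\<exists>d>0. \<forall>g. bounded_torus_map g R \<longrightarrow> C1_near d f g \<longrightarrow>
    \<bar>(\<integral>x. bounded_torus_map.li g n x \<partial>haar) - (\<integral>x. bounded_torus_map.li f n x \<partial>haar)\<bar> \<le> e"
proof -
  interpret f: bounded_torus_map f R by (rule f)
  have Rn: "0 < R ^ n" "R \<noteq> 0" using f.R_pow[of n] f.R by auto
  obtain d where d: "d > 0" "\<And>g. C1_near d f g \<Longrightarrow> g \<in> C1_maps \<Longrightarrow> C1_near (e / (2 * R ^ n)) (f ^^ n) (g ^^ n)"
    using C1_near_iter[OF f.C1, of "e / (2 * R ^ n)" n] e Rn by auto
  show ?thesis
  proof (intro exI[of _ d] conjI d(1) allI impI)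
    fix g assume g: "bounded_torus_map g R" and ng: "C1_near d f g"
    interpret g: bounded_torus_map g R by (rule g)
    show "\<bar>(\<integral>x. g.li n x \<partial>haar) - (\<integral>x. f.li n x \<partial>haar)\<bar> \<le> e"
    proof (rule integral_diff_bound[OF prob_space_haar g.Li.integrable_a f.Li.integrable_a])
      fix x
      have c: "g.li n x = - ln (conorm (tderiv (g ^^ n) x))" "f.li n x = - ln (conorm (tderiv (f ^^ n) x))"
        unfolding g.li_def f.li_def
        using ln_conorm[OF g.bi_bounded_iter g.R_pow] ln_conorm[OF f.bi_bounded_iter f.R_pow] by simp_all
      have "\<bar>g.li n x - f.li n x\<bar> = \<bar>ln (conorm (tderiv (f ^^ n) x)) - ln (conorm (tderiv (g ^^ n) x))\<bar>"
        unfolding c by simp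
      also have "\<dots> \<le> \<bar>conorm (tderiv (f ^^ n) x) - conorm (tderiv (g ^^ n) x)\<bar> / (1 / R ^ n)"
        using conorm_bounds(1)[OF f.bi_bounded_iter f.R_pow] conorm_bounds(1)[OF g.bi_bounded_iter g.R_pow] Rn
        by (intro ln_diff_abs) auto
      also have "\<dots> \<le> (2 * norm (tderiv (f ^^ n) x - tderiv (g ^^ n) x)) / (1 / R ^ n)"
        using Rn by (intro divide_right_mono conorm_diff) auto
      also have "\<dots> \<le> (2 * (e / (2 * R ^ n))) / (1 / R ^ n)"
        using d(2)[OF ng g.C1] Rn by (intro divide_right_mono mult_left_mono) (auto simp: C1_near_def less_imp_le)
      also have "\<dots> = e" using Rn by simp
      finally show "\<bar>g.li n x - f.li n x\<bar> \<le> e" .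
    qed
  qed
qed

lemma ld_continuous:
  assumes f: "bounded_torus_map f R" and e: "e > 0"
  shows "\<exists>d>0. \<forall>g. bounded_torus_map g R \<longrightarrow> C1_near d f g \<longrightarrow>
    \<bar>(\<integral>x. bounded_torus_map.ld g n x \<partial>haar) - (\<integral>x. bounded_torus_map.ld f n x \<partial>haar)\<bar> \<le> e"
proof -
  interpret f: bounded_torus_map f R by (rule f)
  define k where "k = 1 / (R ^ n)\<^sup>2"
  have k: "k > 0" using f.R by (simp add: k_def)
  obtain d1 where d1: "d1 > 0" "\<And>Q x. C1_near d1 (f ^^ n) Q \<Longrightarrow> \<bar>det (tderiv (f ^^ n) x) - det (tderiv Q x)\<bar> < e * k"
    using det_uniform[OF C1_maps_iter[OF f.C1], of "e * k" n] e k by auto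
  obtain d where d: "d > 0" "\<And>g. C1_near d f g \<Longrightarrow> g \<in> C1_maps \<Longrightarrow> C1_near d1 (f ^^ n) (g ^^ n)"
    using C1_near_iter[OF f.C1 d1(1)] by blast
  show ?thesis
  proof (intro exI[of _ d] conjI d(1) allI impI)
    fix g assume g: "bounded_torus_map g R" and ng: "C1_near d f g"
    interpret g: bounded_torus_map g R by (rule g)
    show "\<bar>(\<integral>x. g.ld n x \<partial>haar) - (\<integral>x. f.ld n x \<partial>haar)\<bar> \<le> e"
    proof (rule integral_diff_bound[OF prob_space_haar g.integrable_ld f.integrable_ld])
      fix x
      define p where "p = det (tderiv (f ^^ n) x)"
      define q where "q = det (tderiv (g ^^ n) x)"
      have "\<bar>g.ld n x - f.ld n x\<bar> = \<bar>ln \<bar>q\<bar> - ln \<bar>p\<bar>\<bar>" by (simp add: g.ld_def f.ld_def p_def q_def)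
      also have "\<dots> \<le> \<bar>\<bar>q\<bar> - \<bar>p\<bar>\<bar> / k"
        using bi_bounded_det_bounds(1)[OF f.bi_bounded_iter f.R_pow] bi_bounded_det_bounds(1)[OF g.bi_bounded_iter g.R_pow]
        unfolding p_def q_def by (intro ln_diff_abs k) (auto simp: k_def)
      also have "\<dots> \<le> (e * k) / k"
      proof (rule divide_right_mono)
        have "\<bar>p - q\<bar> < e * k" unfolding p_def q_def by (rule d1(2)[OF d(2)[OF ng g.C1]])
        then show "\<bar>\<bar>q\<bar> - \<bar>p\<bar>\<bar> \<le> e * k" by linarith
      qed (use k in simp)
      also have "\<dots> = e" using k by simp
      finally show "\<bar>g.ld n x - f.ld n x\<bar> \<le> e" .
    qed
  qed
qed

text \<open>First k is fixed so that at the single time n = N k the exponent is known up to e/8 for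
  all g near f; only then is g moved closer to f, so that the integrals at time n differ little. The
  three errors stay below e/2, which leaves room for the e/8 from the determinant in
  \<open>chi_sum\<close>.\<close>

lemma exponents_continuous:
  assumes f: "f \<in> U1" and e: "e > 0"
  shows "\<exists>d>0. \<forall>g. torus_map g \<longrightarrow> C1_near d f g \<longrightarrow>
    \<bar>(\<integral>x. chi_minus g x \<partial>haar) - (\<integral>x. chi_minus f x \<partial>haar)\<bar> < e \<and>
    \<bar>(\<integral>x. chi_plus g x \<partial>haar) - (\<integral>x. chi_plus f x \<partial>haar)\<bar> < e"
proof -
  have ft: "torus_map f" using f by (intro End1_torus_map) (simp add: U1_def)
  obtain N R s sg b d0 where N: "N > 0" and d0: "d0 > 0"
    and bt: "\<And>g. torus_map g \<Longrightarrow> C1_near d0 f g \<Longrightarrow> bounded_torus_map g R"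
    and cc: "\<And>g. torus_map g \<Longrightarrow> C1_near d0 f g \<Longrightarrow>
      contracting_cocycle haar (g ^^ N) (\<lambda>y. matrix_inv (tderiv (g ^^ N) y)) (R ^ N) s sg b"
    using contracting_near[OF f] by blast
  have fb: "bounded_torus_map f R" by (rule bt[OF ft C1_near_refl[OF d0]])
  define K where "K = 2 * (ln 2 + 2 * (2 * (R ^ N)\<^sup>2 / (1 - sg * b powr (s / 2))))"
  have "(\<lambda>k. K / real N * inverse (real (Suc k))) \<longlonglongrightarrow> K / real N * 0"
    by (intro tendsto_intros LIMSEQ_inverse_real_of_nat)
  then have "\<forall>\<^sub>F k in sequentially. K / real N * inverse (real (Suc k)) < e / 8"
    using e by (intro order_tendstoD(2)[of _ "K / real N * 0"]) auto
  then obtain k0 where "K / real N * inverse (real (Suc k0)) < e / 8" by (auto simp: eventually_sequentially)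
  moreover have "K / real (N * Suc k0) = K / real N * inverse (real (Suc k0))"
    by (simp only: of_nat_mult divide_inverse inverse_mult_distrib mult.assoc)
  ultimately have "Suc k0 > 0" "K / real (N * Suc k0) < e / 8" by simp_all
  then obtain k where k: "k > 0" "K / real (N * k) < e / 8" by blast
  define n where "n = N * k"
  have n: "n > 0" using N k by (simp add: n_def)
  obtain d1 where d1: "d1 > 0" "\<And>g. bounded_torus_map g R \<Longrightarrow> C1_near d1 f g \<Longrightarrow>
      \<bar>(\<integral>x. bounded_torus_map.li g n x \<partial>haar) - (\<integral>x. bounded_torus_map.li f n x \<partial>haar)\<bar> \<le> e / 8"
    using li_continuous[OF fb, of "e / 8" n] e by auto
  obtain d2 where d2: "d2 > 0" "\<And>g. bounded_torus_map g R \<Longrightarrow> C1_near d2 f g \<Longrightarrow>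
      \<bar>(\<integral>x. bounded_torus_map.ld g 1 x \<partial>haar) - (\<integral>x. bounded_torus_map.ld f 1 x \<partial>haar)\<bar> \<le> e / 8"
    using ld_continuous[OF fb, of "e / 8" 1] e by auto
  show ?thesis
  proof (intro exI[of _ "min d0 (min d1 d2)"] conjI allI impI)
    fix g assume g: "torus_map g" and "C1_near (min d0 (min d1 d2)) f g"
    then have C1_near: "C1_near d0 f g" "C1_near d1 f g" "C1_near d2 f g" by (auto intro: C1_near_mono)
    have gb: "bounded_torus_map g R" by (rule bt[OF g C1_near(1)])
    define lg where "lg = (\<integral>x. bounded_torus_map.li g n x \<partial>haar)"
    define lf where "lf = (\<integral>x. bounded_torus_map.li f n x \<partial>haar)"
    have 1: "\<bar>(\<integral>x. chi_minus g x \<partial>haar) + lg / real n\<bar> < e / 8"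
      using chi_minus_estimate[OF gb cc[OF g C1_near(1)] N k(1)] k(2) unfolding n_def lg_def K_def by linarith
    have 2: "\<bar>(\<integral>x. chi_minus f x \<partial>haar) + lf / real n\<bar> < e / 8"
      using chi_minus_estimate[OF fb cc[OF ft C1_near_refl[OF d0]] N k(1)] k(2) unfolding n_def lf_def K_def by linarith
    have "\<bar>lg - lf\<bar> \<le> e / 8" unfolding lg_def lf_def by (rule d1(2)[OF gb C1_near(2)])
    moreover have "\<bar>lg - lf\<bar> / real n \<le> \<bar>lg - lf\<bar> / 1" using n by (intro divide_left_mono) auto
    ultimately have "\<bar>lg - lf\<bar> / real n \<le> e / 8" by (metis div_by_1 order_trans)
    then have 3: "\<bar>lg / real n - lf / real n\<bar> \<le> e / 8"
      by (simp only: diff_divide_distrib[symmetric] abs_divide abs_of_nat)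
    have m: "\<bar>(\<integral>x. chi_minus g x \<partial>haar) - (\<integral>x. chi_minus f x \<partial>haar)\<bar> < e / 2"
      using 1 2 3 e by linarith
    then show "\<bar>(\<integral>x. chi_minus g x \<partial>haar) - (\<integral>x. chi_minus f x \<partial>haar)\<bar> < e" using e by linarith
    show "\<bar>(\<integral>x. chi_plus g x \<partial>haar) - (\<integral>x. chi_plus f x \<partial>haar)\<bar> < e"
      using bounded_torus_map.chi_sum[OF gb] bounded_torus_map.chi_sum[OF fb] d2(2)[OF gb C1_near(3)] m e by linarith
  qed (use d0 d1 d2 in simp)
qed

text \<open>The preimage of an open set is the trace on U of a union of metric balls.
  \<open>C1_dist_near\<close> supplies their radii from the neighbourhoods in the sense of
  \<open>C1_near\<close>.\<close>

lemma continuous_map_C1I: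
  assumes "U \<subseteq> C1_maps"
    and F: "\<And>f e. f \<in> U \<Longrightarrow> e > 0 \<Longrightarrow> \<exists>d>0. \<forall>g\<in>U. C1_near d f g \<longrightarrow> \<bar>F g - F f\<bar> < (e::real)"
  shows "continuous_map (subtopology C1_topology U) euclideanreal F"
proof -
  have top: "topspace (subtopology C1_topology U) = U"
    using assms(1) by (auto simp: C1_topology_def)
  have "openin (subtopology C1_topology U) {f \<in> U. F f \<in> V}" if V: "open V" for V
  proof -
    have "\<exists>d>0. \<forall>g\<in>U. C1_dist f g < d \<longrightarrow> F g \<in> V" if f: "f \<in> U" "F f \<in> V" for f
    proof -
      obtain e where e: "e > 0" "\<And>y. dist y (F f) < e \<Longrightarrow> y \<in> V"
        using V f(2) unfolding open_dist by blast
      obtain d where d: "d > 0" "\<And>g. g \<in> U \<Longrightarrow> C1_near d f g \<Longrightarrow> \<bar>F g - F f\<bar> < e"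
        using F[OF f(1) e(1)] by blast
      have "F g \<in> V" if g: "g \<in> U" "C1_dist f g < d / 4" for g
      proof -
        have "C1_near d f g" using assms(1) f(1) g by (intro C1_dist_near) auto
        then show ?thesis using d(2)[OF g(1)] by (intro e(2)) (simp add: dist_real_def)
      qed
      then show ?thesis using d(1) by (intro exI[of _ "d / 4"]) auto
    qed
    then obtain d where d: "\<And>f. f \<in> U \<Longrightarrow> F f \<in> V \<Longrightarrow> d f > 0"
      "\<And>f g. f \<in> U \<Longrightarrow> F f \<in> V \<Longrightarrow> g \<in> U \<Longrightarrow> C1_dist f g < d f \<Longrightarrow> F g \<in> V"
      by metis
    define T where "T = (\<Union>f\<in>{f \<in> U. F f \<in> V}. C1.mball f (d f))"
    have "openin C1_topology T" unfolding T_def C1_topology_def by (intro openin_Union) auto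
    moreover have "{f \<in> U. F f \<in> V} = T \<inter> U"
    proof (intro equalityI subsetI)
      fix f assume "f \<in> {f \<in> U. F f \<in> V}"
      then have "f \<in> C1.mball f (d f)" using d(1)[of f] assms(1) by auto
      then show "f \<in> T \<inter> U" using \<open>f \<in> {f \<in> U. F f \<in> V}\<close> unfolding T_def by blast
    next
      fix g assume "g \<in> T \<inter> U"
      then obtain f where "f \<in> U" "F f \<in> V" "C1_dist f g < d f" "g \<in> U" by (auto simp: T_def)
      then show "g \<in> {f \<in> U. F f \<in> V}" using d(2) by blast
    qed
    ultimately show ?thesis unfolding openin_subtopology by blast
  qed
  then show ?thesis unfolding continuous_map_def top by simp
qed

theorem theoremB:
  "continuous_map (subtopology C1_topology U1) euclideanreal (\<lambda>f. \<integral>x. chi_minus f x \<partial>haar) \<and>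
   continuous_map (subtopology C1_topology U1) euclideanreal (\<lambda>f. \<integral>x. chi_plus f x \<partial>haar)"
proof (intro conjI continuous_map_C1I)
  show U: "U1 \<subseteq> C1_maps" "U1 \<subseteq> C1_maps"
    using C1_local_diffeo_imp_C1 by (auto simp: U1_def End1_def)
  fix f and e :: real assume f: "f \<in> U1" and e: "e > 0"
  obtain d where d: "d > 0" "\<And>g. torus_map g \<Longrightarrow> C1_near d f g \<Longrightarrow>
    \<bar>(\<integral>x. chi_minus g x \<partial>haar) - (\<integral>x. chi_minus f x \<partial>haar)\<bar> < e \<and>
    \<bar>(\<integral>x. chi_plus g x \<partial>haar) - (\<integral>x. chi_plus f x \<partial>haar)\<bar> < e"
    using exponents_continuous[OF f e] by blast
  have "torus_map g" if "g \<in> U1" for g using that by (intro End1_torus_map) (simp add: U1_def)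
  then show "\<exists>d>0. \<forall>g\<in>U1. C1_near d f g \<longrightarrow> \<bar>(\<integral>x. chi_minus g x \<partial>haar) - (\<integral>x. chi_minus f x \<partial>haar)\<bar> < e"
    "\<exists>d>0. \<forall>g\<in>U1. C1_near d f g \<longrightarrow> \<bar>(\<integral>x. chi_plus g x \<partial>haar) - (\<integral>x. chi_plus f x \<partial>haar)\<bar> < e"
    using d by blast+
qed

end
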